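(* (i) There is an absolute constant $c>0$ such that for all integers $n\ge 2$ and $q\ge 1$ there exist $m$, an antichain $\Pi\subset\{0,1\}^m$ of cardinality $n!$ and a bijection between $\Pi$ and the permutations of $\{0,\ldots,n-1\}$ for which $L(P_{q,\Pi})\le c\,qn\log_2 n$. (ii) There is an absolute constant $c>0$ such that for all integers $n\ge 2$ and $q\ge 1$, $L(P_{q,\Pi_1})\le c\,(qn\log_2 n+n^2)$.
   Context: $L(F)$ denotes the minimal number of gates in a circuit over the basis $\{\vee,\wedge\}$ (binary disjunction and conjunction gates, inputs being the variables) computing the (possibly partially defined) boolean operator $F$; a circuit computes a partially defined operator if its outputs agree with $F$ on every input where $F$ is defined. Let $X=(x_0,\ldots,x_{n-1})$ with $x_i=(x_{i,0},\ldots,x_{i,q-1})^T$ be a $q\times n$ matrix of boolean variables. Given an antichain $\Pi\subset\{0,1\}^m$ of cardinality $n!$ together with a bijection assigning to each element of $\Pi$ a permutation $\pi$ of $\{0,\ldots,n-1\}$, and a vector $Y$ of $m$ boolean variables, the monotone permutation operator $P_{q,\Pi}(X,Y)$ is the partially defined operator defined only for $Y\in\Pi$, with $P_{q,\Pi}(X,Y)=\pi(X)=(x_{\pi(0)},\ldots,x_{\pi(n-1)})$ where $\pi$ is the permutation assigned to $Y$. $\Pi_1\subset\{0,1\}^{n\times n}$ is the set of $n\times n$ permutation matrices $Y=\{y_{j,k}\}$ (every row and column of weight $1$), the permutation assigned to $Y$ being $\pi$ with $\pi(k)$ equal to the row index $j$ of the unique $1$ in column $k$; thus on $\Pi_1$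 the operator $P_{q,\Pi_1}$ coincides with the boolean matrix product $z_{i,k}=\bigvee_{j} x_{i,j}y_{j,k}$. *)

theory Defs
  imports
    Complex_Main
    "HOL-Library.FuncSet"
    "HOL-Library.Extended_Real"
    "HOL-Combinatorics.Permutations"
begin

subsection \<open>Partially defined boolean operators\<close>

text \<open>
  An operator carries its sets of input variables and output positions; it is undefined
  on the assignments that are mapped to \<open>None\<close>. Assignments are total functions on the type of
  variables; circuits can read only the variables in \<open>in_vars\<close>.
\<close>

record ('v, 'o) bool_operator =
  in_vars :: "'v set"
  out_pos :: "'o set"
  op_map :: "('v \<Rightarrow> bool) \<Rightarrow> ('o \<Rightarrow> bool) option"


subsection \<open>Circuits over the basis of binary disjunction and conjunction\<close>

text \<open>
  A circuit is a straight-line program: \<open>Gate i\<close> refers to the \<open>i\<close>-th gate of the list (from 0).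
  There are no constants, and an output may be a variable, which costs no gate.
\<close>

datatype 'v node = Input 'v | Gate nat

datatype 'v gate = Disj "'v node" "'v node" | Conj "'v node" "'v node"

record ('v, 'o) circuit =
  gates :: "'v gate list"
  out_node :: "'o \<Rightarrow> 'v node"

fun wf_node :: "'v set \<Rightarrow> nat \<Rightarrow> 'v node \<Rightarrow> bool" where
  "wf_node V l (Input v) \<longleftrightarrow> v \<in> V"
| "wf_node V l (Gate i) \<longleftrightarrow> i < l"

fun wf_gate :: "'v set \<Rightarrow> nat \<Rightarrow> 'v gate \<Rightarrow> bool" where
  "wf_gate V l (Disj s t) \<longleftrightarrow> wf_node V l s \<and> wf_node V l t"
| "wf_gate V l (Conj s t) \<longleftrightarrow> wf_node V l s \<and> wf_node V l t"

definition wf_circuit :: "'v set \<Rightarrow> 'o set \<Rightarrow> ('v, 'o) circuit \<Rightarrow> bool" where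
  "wf_circuit V W C \<longleftrightarrow>
     (\<forall>i < length (gates C). wf_gate V i (gates C ! i)) \<and>
     (\<forall>w \<in> W. wf_node V (length (gates C)) (out_node C w))"

fun node_val :: "('v \<Rightarrow> bool) \<Rightarrow> bool list \<Rightarrow> 'v node \<Rightarrow> bool" where
  "node_val a vs (Input v) = a v"
| "node_val a vs (Gate i) = vs ! i"

fun gate_val :: "('v \<Rightarrow> bool) \<Rightarrow> bool list \<Rightarrow> 'v gate \<Rightarrow> bool" where
  "gate_val a vs (Disj s t) \<longleftrightarrow> node_val a vs s \<or> node_val a vs t"
| "gate_val a vs (Conj s t) \<longleftrightarrow> node_val a vs s \<and> node_val a vs t"

definition gate_vals :: "('v \<Rightarrow> bool) \<Rightarrow> 'v gate list \<Rightarrow> bool list" where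
  "gate_vals a gs = foldl (\<lambda>vs g. vs @ [gate_val a vs g]) [] gs"

definition circuit_val :: "('v, 'o) circuit \<Rightarrow> ('v \<Rightarrow> bool) \<Rightarrow> 'o \<Rightarrow> bool" where
  "circuit_val C a w = node_val a (gate_vals a (gates C)) (out_node C w)"

definition computes :: "('v, 'o) circuit \<Rightarrow> ('v, 'o) bool_operator \<Rightarrow> bool" where
  "computes C F \<longleftrightarrow>
     wf_circuit (in_vars F) (out_pos F) C \<and>
     (\<forall>a z. op_map F a = Some z \<longrightarrow> (\<forall>w \<in> out_pos F. circuit_val C a w = z w))"

text \<open>
  The value is \<open>\<infinity>\<close> if no circuit computes the operator, so an upper bound on the complexity
  includes the existence of a circuit; otherwise the infimum is attained.
\<close>

definition complexity :: "('v, 'o) bool_operator \<Rightarrow> enat" where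
  "complexity F = (INF C \<in> {C. computes C F}. enat (length (gates C)))"


subsection \<open>Monotone permutation operators\<close>

text \<open>
  \<open>XVar i j\<close> is the entry of the matrix \<open>X\<close> in row \<open>i < q\<close> and column \<open>j < n\<close>. The coordinates
  of \<open>Y\<close> are indexed by an arbitrary set \<open>J\<close>, and the cube of 0/1 vectors over \<open>J\<close> is
  \<open>J \<rightarrow>\<^sub>E UNIV\<close>.
\<close>

datatype 'j pvar = XVar nat nat | YVar 'j

definition cube_antichain :: "'j set \<Rightarrow> ('j \<Rightarrow> bool) set \<Rightarrow> bool" where
  "cube_antichain J S \<longleftrightarrow>
     S \<subseteq> (J \<rightarrow>\<^sub>E UNIV) \<and> (\<forall>u \<in> S. \<forall>v \<in> S. (\<forall>j \<in> J. u j \<le> v j) \<longrightarrow> u = v)"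

text \<open>
  \<open>\<sigma>\<close> is the assignment of permutations to the elements of \<open>S\<close>; column \<open>k\<close> of the result is
  column \<open>\<sigma> Y k\<close> of \<open>X\<close>.
\<close>

definition perm_operator ::
  "nat \<Rightarrow> nat \<Rightarrow> 'j set \<Rightarrow> ('j \<Rightarrow> bool) set \<Rightarrow> (('j \<Rightarrow> bool) \<Rightarrow> nat \<Rightarrow> nat)
    \<Rightarrow> ('j pvar, nat \<times> nat) bool_operator" where
  "perm_operator q n J S \<sigma> =
     \<lparr> in_vars = {XVar i j | i j. i < q \<and> j < n} \<union> YVar ` J,
       out_pos = {..<q} \<times> {..<n},
       op_map = (\<lambda>a. let Y = (\<lambda>j \<in> J. a (YVar j)) in
                       if Y \<in> S then Some (\<lambda>(i, k). a (XVar i (\<sigma> Y k))) else None) \<rparr>"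

definition perm_matrices :: "nat \<Rightarrow> (nat \<times> nat \<Rightarrow> bool) set" where
  "perm_matrices n =
     {Y \<in> ({..<n} \<times> {..<n}) \<rightarrow>\<^sub>E UNIV.
        (\<forall>j<n. card {k. k < n \<and> Y (j, k)} = 1) \<and> (\<forall>k<n. card {j. j < n \<and> Y (j, k)} = 1)}"

definition perm_of_matrix :: "nat \<Rightarrow> (nat \<times> nat \<Rightarrow> bool) \<Rightarrow> nat \<Rightarrow> nat" where
  "perm_of_matrix n Y k = (if k < n then THE j. j < n \<and> Y (j, k) else k)"

lemma perm_of_matrix_iff:
  assumes "Y \<in> perm_matrices n" "k < n"
  shows "j < n \<and> Y (j, k) \<longleftrightarrow> j = perm_of_matrix n Y k"
proof -
  have "card {j. j < n \<and> Y (j, k)} = 1"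
    using assms by (auto simp: perm_matrices_def)
  then obtain j0 where "{j. j < n \<and> Y (j, k)} = {j0}"
    by (auto simp: card_1_singleton_iff)
  then have *: "\<And>j. j < n \<and> Y (j, k) \<longleftrightarrow> j = j0"
    by blast
  then have "perm_of_matrix n Y k = j0"
    using assms(2) by (simp add: perm_of_matrix_def)
  then show ?thesis
    using * by simp
qed

text \<open>On permutation matrices the operator is the boolean matrix product.\<close>

lemma perm_operator_matrix_product:
  assumes "Y \<in> perm_matrices n" "k < n" and Y: "Y = (\<lambda>p \<in> {..<n} \<times> {..<n}. a (YVar p))"
  shows "\<exists>z. op_map (perm_operator q n ({..<n} \<times> {..<n}) (perm_matrices n) (perm_of_matrix n)) a
               = Some z \<and> z (i, k) = (\<exists>j<n. a (XVar i j) \<and> a (YVar (j, k)))"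
proof -
  have "a (YVar (j, k)) = Y (j, k)" if "j < n" for j
    using that assms(2) by (simp add: Y)
  then have "(\<exists>j<n. a (XVar i j) \<and> a (YVar (j, k))) = a (XVar i (perm_of_matrix n Y k))"
    using perm_of_matrix_iff[OF assms(1,2)] by metis
  moreover have "op_map (perm_operator q n ({..<n} \<times> {..<n}) (perm_matrices n) (perm_of_matrix n)) a
      = (let Y = Y in if Y \<in> perm_matrices n
         then Some (\<lambda>(i, k). a (XVar i (perm_of_matrix n Y k))) else None)"
    unfolding Y perm_operator_def bool_operator.select_convs ..
  ultimately show ?thesis
    using assms(1) by simp
qed

lemma cube_antichain_perm_matrices: "cube_antichain ({..<n} \<times> {..<n}) (perm_matrices n)"
proof -
  have "u = v" if u: "u \<in> perm_matrices n" and v: "v \<in> perm_matrices n"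
    and le: "\<forall>p \<in> {..<n} \<times> {..<n}. u p \<le> v p" for u v
  proof
    fix p :: "nat \<times> nat"
    obtain j k where p: "p = (j, k)" by force
    show "u p = v p"
    proof (cases "j < n \<and> k < n")
      case True
      have "u (perm_of_matrix n u k, k)" "perm_of_matrix n u k < n"
        using perm_of_matrix_iff[OF u, of k] True by auto
      then have "v (perm_of_matrix n u k, k)"
        using le True by auto
      then have "perm_of_matrix n u k = perm_of_matrix n v k"
        using perm_of_matrix_iff[OF v, of k] True \<open>perm_of_matrix n u k < n\<close> by blast
      then show ?thesis
        using perm_of_matrix_iff[OF u, of k j] perm_of_matrix_iff[OF v, of k j] True p by auto
    next
      case False
      then show ?thesis
        using u v p by (auto simp: perm_matrices_def PiE_def extensional_def)
    qed
  qed
  then show ?thesis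
    by (auto simp: cube_antichain_def perm_matrices_def)
qed

lemma bij_betw_perm_of_matrix:
  "bij_betw (perm_of_matrix n) (perm_matrices n) {\<pi>. \<pi> permutes {..<n}}"
proof (rule bij_betw_byWitness
    [where f' = "\<lambda>\<pi>. \<lambda>(j, k) \<in> {..<n} \<times> {..<n}. j = \<pi> k"])
  show "\<forall>Y \<in> perm_matrices n.
      (\<lambda>(j, k) \<in> {..<n} \<times> {..<n}. j = perm_of_matrix n Y k) = Y"
  proof (intro ballI ext)
    fix Y :: "nat \<times> nat \<Rightarrow> bool" and p :: "nat \<times> nat"
    assume Y: "Y \<in> perm_matrices n"
    show "(\<lambda>(j, k) \<in> {..<n} \<times> {..<n}. j = perm_of_matrix n Y k) p = Y p"
    proof (cases "p \<in> {..<n} \<times> {..<n}")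
      case True
      then show ?thesis using perm_of_matrix_iff[OF Y, of "snd p" "fst p"] by (cases p) auto
    next
      case False
      moreover have "Y p = undefined"
        using Y False by (intro PiE_arb[where f = Y]) (auto simp: perm_matrices_def)
      ultimately show ?thesis by simp
    qed
  qed
  show "\<forall>\<pi> \<in> {\<pi>. \<pi> permutes {..<n}}.
      perm_of_matrix n (\<lambda>(j, k) \<in> {..<n} \<times> {..<n}. j = \<pi> k) = \<pi>"
  proof (intro ballI ext)
    fix \<pi> :: "nat \<Rightarrow> nat" and k
    assume "\<pi> \<in> {\<pi>. \<pi> permutes {..<n}}"
    then have \<pi>: "\<pi> permutes {..<n}" by simp
    then show "perm_of_matrix n (\<lambda>(j, k) \<in> {..<n} \<times> {..<n}. j = \<pi> k) k = \<pi> k"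
      using permutes_in_image[OF \<pi>, of k] permutes_not_in[OF \<pi>, of k]
      by (auto simp: perm_of_matrix_def intro!: the_equality)
  qed
  show "perm_of_matrix n ` perm_matrices n \<subseteq> {\<pi>. \<pi> permutes {..<n}}"
  proof clarify
    fix Y assume Y: "Y \<in> perm_matrices n"
    have "inj_on (perm_of_matrix n Y) {..<n}"
    proof (rule inj_onI)
      fix k l assume kl: "k \<in> {..<n}" "l \<in> {..<n}" "perm_of_matrix n Y k = perm_of_matrix n Y l"
      obtain j where jk: "j = perm_of_matrix n Y k" and jl: "j = perm_of_matrix n Y l"
        using kl(3) by simp
      have j: "j < n" "Y (j, k)"
        using perm_of_matrix_iff[OF Y, of k j] kl(1) jk by simp_all
      have "Y (j, l)"
        using perm_of_matrix_iff[OF Y, of l j] kl(2) jl by simp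
      have "card {k. k < n \<and> Y (j, k)} = 1"
        using Y j(1) by (simp add: perm_matrices_def)
      then obtain k0 where k0: "{k. k < n \<and> Y (j, k)} = {k0}"
        by (auto simp: card_1_singleton_iff)
      have "k \<in> {k0}" "l \<in> {k0}"
        unfolding k0[symmetric] using kl(1,2) j \<open>Y (j, l)\<close> by simp_all
      then show "k = l" by simp
    qed
    moreover have "perm_of_matrix n Y ` {..<n} \<subseteq> {..<n}"
    proof (rule image_subsetI)
      fix k assume "k \<in> {..<n}"
      then show "perm_of_matrix n Y k \<in> {..<n}"
        using perm_of_matrix_iff[OF Y, of k "perm_of_matrix n Y k"] by simp
    qed
    ultimately have "bij_betw (perm_of_matrix n Y) {..<n} {..<n}"
      by (simp add: bij_betw_def endo_inj_surj)
    then show "perm_of_matrix n Y permutes {..<n}"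
      by (rule bij_imp_permutes) (simp add: perm_of_matrix_def)
  qed
  show "(\<lambda>\<pi>. \<lambda>(j, k) \<in> {..<n} \<times> {..<n}. j = \<pi> k) ` {\<pi>. \<pi> permutes {..<n}} \<subseteq> perm_matrices n"
  proof clarify
    fix \<pi> :: "nat \<Rightarrow> nat" assume \<pi>: "\<pi> permutes {..<n}"
    let ?Y = "\<lambda>(j, k) \<in> {..<n} \<times> {..<n}. j = \<pi> k"
    have "{k. k < n \<and> ?Y (j, k)} = {inv \<pi> j}" if "j < n" for j
    proof -
      have "inv \<pi> j < n"
        using that permutes_in_image[OF permutes_inv[OF \<pi>], of j] by simp
      moreover have "j = \<pi> k \<longleftrightarrow> k = inv \<pi> j" for k
        using permutes_inv_eq[OF \<pi>, of j k] by metis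
      ultimately show ?thesis using that by auto
    qed
    moreover have "{j. j < n \<and> ?Y (j, k)} = {\<pi> k}" if "k < n" for k
      using that permutes_in_image[OF \<pi>, of k] by auto
    moreover have "?Y \<in> ({..<n} \<times> {..<n}) \<rightarrow>\<^sub>E UNIV"
      by simp
    ultimately show "?Y \<in> perm_matrices n"
      unfolding perm_matrices_def by simp
  qed
qed

end

theory Submission
  imports Defs
begin

text \<open>
  (i) A Benes network on \<open>2 ^ k\<close> lines realises every permutation with \<open>k * 2 ^ k\<close> switches, so it
  suffices to let \<open>Y\<close> list the states of all switches, each together with its negation: vectors of this
  form are an antichain, and distinct permutations have distinct switch states.

  (ii) The switch states have to be computed from the permutation matrix. The orbits that drive the
  looping algorithm of the network can be found with \<open>O(n ^ 5)\<close> gates, which is too much. One round of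
  sorting cuts the exponent: split the \<open>n\<close> columns into \<open>s \<approx> n powr (1/3)\<close> groups of
  \<open>r = n / s\<close>, sort every group by the target group (radix order), deal the results out to \<open>s\<close>
  new groups, and observe that every new group now holds at most \<open>2 * r / s\<close> columns for any target
  group. Hence each new group can be sorted into target segments of fixed length, which are
  sent to their targets and permuted there. All control inside a group is cheap, as \<open>r\<close> is small, and
  only three rounds of group-sized networks are used; a control cost of \<open>n powr e\<close> becomes
  \<open>n powr max 2 ((2 * e + 1) / 3)\<close>, and a bounded number of repetitions reaches \<open>n\<^sup>2\<close>.
\<close>

section \<open>Wires derivable with a given number of gates\<close>

text \<open>The basis has no negation and circuits have no constants, while a switch needs its state
  in both polarities. This obstacle shapes the development: every control bit is computed together
  with its complement, and complements are obtained by monotone means that are valid on the domain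
  of the operator. In (ii) the complement of a matrix entry is the disjunction of the other entries
  of its line, \<open>False\<close> is the conjunction of two entries of a line, and
  \<open>True\<close> is the disjunction of a line.

  The cube root arises as follows. An interval of \<open>L\<close> sorted items deals at most
  \<open>L div s + 1\<close> of them to each new group, so a new group holds at most
  \<open>r div s + s\<close> items of one block. This is of order \<open>r / s\<close> as long as
  \<open>s * s\<close> is of order at most \<open>r\<close>, that is, \<open>s\<close> is of order
  at most \<open>n powr (1/3)\<close>. The control of \<open>s\<close> groups costs about
  \<open>s * (n / s) powr e\<close>, so for \<open>e > 1\<close> the largest admissible
  \<open>s\<close> is the best.

  Each repetition multiplies the data cost by a constant, so only boundedly many are affordable.
  Slots may stay empty, hence the routing statement that is iterated speaks of partial permutation
  matrices.\<close>

text \<open>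
  \<open>derives D A k B\<close>: starting from the boolean functions in \<open>A\<close>, at most \<open>k\<close> gates give all functions
  in \<open>B\<close>, up to equality on the domain \<open>D\<close> of a partially defined operator.
\<close>

inductive derives :: "'a set \<Rightarrow> ('a \<Rightarrow> bool) set \<Rightarrow> nat \<Rightarrow> ('a \<Rightarrow> bool) set \<Rightarrow> bool" for D where
  derives_base: "(\<And>f. f \<in> B \<Longrightarrow> \<exists>g\<in>A. \<forall>a\<in>D. f a = g a) \<Longrightarrow> derives D A k B"
| derives_disj_gate: "f \<in> A \<Longrightarrow> g \<in> A \<Longrightarrow> derives D (insert (\<lambda>a. f a \<or> g a) A) k B \<Longrightarrow> derives D A (Suc k) B"
| derives_conj_gate: "f \<in> A \<Longrightarrow> g \<in> A \<Longrightarrow> derives D (insert (\<lambda>a. f a \<and> g a) A) k B \<Longrightarrow> derives D A (Suc k) B"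

text \<open>Wires matter only on \<open>D\<close>, while gates combine functions on the whole type;
  the proof replays the gates on representatives. Hence a source wire may be exchanged for any
  function agreeing with it on \<open>D\<close>, such as a switch state for the variable of
  \<open>Y\<close> that holds it.\<close>

lemma derives_cong_source:
  assumes "derives D A k B" "\<And>f. f \<in> A \<Longrightarrow> \<exists>g\<in>A'. \<forall>a\<in>D. f a = g a"
  shows "derives D A' k B"
  using assms
proof (induction arbitrary: A')
  case (derives_base B A k)
  show ?case
  proof (rule derives.derives_base)
    fix f assume "f \<in> B"
    then obtain g where g: "g \<in> A" "\<forall>a\<in>D. f a = g a" using derives_base.hyps by blast
    then obtain g' where "g' \<in> A'" "\<forall>a\<in>D. g a = g' a" using derives_base.prems by blast
    then show "\<exists>g\<in>A'. \<forall>a\<in>D. f a = g a" using g by (intro bexI[of _ g']) simp_all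
  qed
next
  case (derives_disj_gate f A g k B)
  obtain f' where f: "f' \<in> A'" "\<forall>a\<in>D. f a = f' a"
    using derives_disj_gate.prems[OF derives_disj_gate.hyps(1)] by blast
  obtain g' where g: "g' \<in> A'" "\<forall>a\<in>D. g a = g' a"
    using derives_disj_gate.prems[OF derives_disj_gate.hyps(2)] by blast
  have "derives D (insert (\<lambda>a. f' a \<or> g' a) A') k B"
  proof (rule derives_disj_gate.IH)
    fix h assume "h \<in> insert (\<lambda>a. f a \<or> g a) A"
    then consider "h = (\<lambda>a. f a \<or> g a)" | "h \<in> A" by blast
    then show "\<exists>h'\<in>insert (\<lambda>a. f' a \<or> g' a) A'. \<forall>a\<in>D. h a = h' a"
    proof cases
      case 1
      then show ?thesis using f g by simp
    next
      case 2
      then show ?thesis using derives_disj_gate.prems by blast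
    qed
  qed
  then show ?case by (rule derives.derives_disj_gate[OF f(1) g(1)])
next
  case (derives_conj_gate f A g k B)
  obtain f' where f: "f' \<in> A'" "\<forall>a\<in>D. f a = f' a"
    using derives_conj_gate.prems[OF derives_conj_gate.hyps(1)] by blast
  obtain g' where g: "g' \<in> A'" "\<forall>a\<in>D. g a = g' a"
    using derives_conj_gate.prems[OF derives_conj_gate.hyps(2)] by blast
  have "derives D (insert (\<lambda>a. f' a \<and> g' a) A') k B"
  proof (rule derives_conj_gate.IH)
    fix h assume "h \<in> insert (\<lambda>a. f a \<and> g a) A"
    then consider "h = (\<lambda>a. f a \<and> g a)" | "h \<in> A" by blast
    then show "\<exists>h'\<in>insert (\<lambda>a. f' a \<and> g' a) A'. \<forall>a\<in>D. h a = h' a"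
    proof cases
      case 1
      then show ?thesis using f g by simp
    next
      case 2
      then show ?thesis using derives_conj_gate.prems by blast
    qed
  qed
  then show ?case by (rule derives.derives_conj_gate[OF f(1) g(1)])
qed

lemma derives_subset: "B \<subseteq> A \<Longrightarrow> derives D A k B"
  by (rule derives_base) auto

lemma derives_trans:
  assumes "derives D A k B" "derives D (A \<union> B) l C"
  shows "derives D A (k + l) C"
  using assms
proof (induction)
  case (derives_base B A k)
  then have "derives D A l C"
    by (elim derives_cong_source) blast
  then show ?case
  proof (induction)
    case (derives_base B A l)
    show ?case by (rule derives.derives_base) (rule derives_base)
  next
    case (derives_disj_gate f A g l B)
    show ?case using derives.derives_disj_gate[OF derives_disj_gate.hyps(1,2) derives_disj_gate.IH] by simp
  next
    case (derives_conj_gate f A g l B)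
    show ?case using derives.derives_conj_gate[OF derives_conj_gate.hyps(1,2) derives_conj_gate.IH] by simp
  qed
next
  case (derives_disj_gate f A g k B)
  have "derives D (insert (\<lambda>a. f a \<or> g a) A) (k + l) C"
    by (rule derives_disj_gate.IH, rule derives_cong_source[OF derives_disj_gate.prems]) blast
  then show ?case using derives.derives_disj_gate[OF derives_disj_gate.hyps(1,2)] by simp
next
  case (derives_conj_gate f A g k B)
  have "derives D (insert (\<lambda>a. f a \<and> g a) A) (k + l) C"
    by (rule derives_conj_gate.IH, rule derives_cong_source[OF derives_conj_gate.prems]) blast
  then show ?case using derives.derives_conj_gate[OF derives_conj_gate.hyps(1,2)] by simp
qed

lemma derives_mono:
  assumes "derives D A k B" "A \<subseteq> A'" "k \<le> k'" "B' \<subseteq> B"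
  shows "derives D A' k' B'"
proof -
  have "derives D A' k B" using assms(1,2) by (elim derives_cong_source) blast
  then have "derives D A' (k + (k' - k)) B'"
    using assms(4) by (intro derives_trans[OF _ derives_subset]) auto
  then show ?thesis using assms(3) by simp
qed

lemma derives_source: "derives D A k B \<Longrightarrow> A \<subseteq> A' \<Longrightarrow> derives D A' k B"
  by (rule derives_mono) auto

lemma derives_le: "derives D A k B \<Longrightarrow> k \<le> k' \<Longrightarrow> derives D A k' B"
  by (rule derives_mono) auto

lemma derives_Un:
  assumes "derives D A k B" "derives D A l C"
  shows "derives D A (k + l) (B \<union> C)"
proof -
  have *: "derives D (A \<union> B) l (B \<union> C)" if "derives D A l C" for A l C
    using that
  proof (induction)
    case (derives_base C A k)
    show ?case by (rule derives.derives_base) (use derives_base in blast)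
  next
    case (derives_disj_gate f A g k C)
    show ?case using derives.derives_disj_gate[of f _ g, OF _ _ derives_disj_gate.IH[unfolded Un_insert_left]] derives_disj_gate.hyps(1,2) by simp
  next
    case (derives_conj_gate f A g k C)
    show ?case using derives.derives_conj_gate[of f _ g, OF _ _ derives_conj_gate.IH[unfolded Un_insert_left]] derives_conj_gate.hyps(1,2) by simp
  qed
  show ?thesis by (rule derives_trans[OF assms(1) *[OF assms(2)]])
qed

lemma derives_keep: "derives D A k B \<Longrightarrow> derives D A k (A \<union> B)"
  using derives_Un[OF derives_subset[of A A D 0], of k B] by simp

lemma derives_UN:
  assumes "finite I" "\<And>i. i \<in> I \<Longrightarrow> derives D A k (B i)"
  shows "derives D A (card I * k) (\<Union>i\<in>I. B i)"
  using assms
proof (induction rule: finite_induct)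
  case empty
  then show ?case by (simp add: derives_subset)
next
  case (insert i I)
  then show ?case using derives_Un[of D A k "B i" "card I * k"] by simp
qed

lemma derives_image:
  assumes "finite I" "\<And>i. i \<in> I \<Longrightarrow> derives D A k {f i}"
  shows "derives D A (card I * k) (f ` I)"
  using derives_UN[OF assms] by (simp add: UNION_singleton_eq_range)

lemma derives_wire: "f \<in> A \<Longrightarrow> derives D A 0 {f}"
  by (simp add: derives_subset)

lemma derives_cong:
  assumes "derives D A k {f}" "\<And>a. a \<in> D \<Longrightarrow> f a = g a"
  shows "derives D A k {g}"
  using derives_trans[OF assms(1), of 0 "{g}"] assms(2)
  by (auto intro: derives_base)

lemma derives_disj:
  assumes "derives D A k {f}" "derives D A l {g}"
  shows "derives D A (k + l + 1) {\<lambda>a. f a \<or> g a}"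
proof -
  have "derives D (A \<union> ({f} \<union> {g})) (Suc 0) {\<lambda>a. f a \<or> g a}"
    by (rule derives_disj_gate[of f _ g]) (simp_all add: derives_subset)
  from derives_trans[OF derives_Un[OF assms] this] show ?thesis by simp
qed

lemma derives_conj:
  assumes "derives D A k {f}" "derives D A l {g}"
  shows "derives D A (k + l + 1) {\<lambda>a. f a \<and> g a}"
proof -
  have "derives D (A \<union> ({f} \<union> {g})) (Suc 0) {\<lambda>a. f a \<and> g a}"
    by (rule derives_conj_gate[of f _ g]) (simp_all add: derives_subset)
  from derives_trans[OF derives_Un[OF assms] this] show ?thesis by simp
qed

section \<open>Constants, multiplexers and complementary pairs of wires\<close>

definition constants :: "('a \<Rightarrow> bool) set" where
  "constants = {\<lambda>_. False, \<lambda>_. True}"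

lemma derives_const: "constants \<subseteq> A \<Longrightarrow> derives D A 0 {\<lambda>_. b}"
  by (cases b) (auto simp: constants_def derives_wire)

text \<open>\<open>b\<close> is fixed when the circuit is built and does not depend on the input, so
  the case distinction costs no gate; a false guard leaves a constant wire.\<close>

lemma derives_guard_conj:
  "constants \<subseteq> A \<Longrightarrow> (b \<Longrightarrow> derives D A k {f}) \<Longrightarrow> derives D A k {\<lambda>a. b \<and> f a}"
  by (cases b) (auto intro: derives_le[OF derives_const[of A D False]])

lemma derives_guard_imp:
  "constants \<subseteq> A \<Longrightarrow> (b \<Longrightarrow> derives D A k {f}) \<Longrightarrow> derives D A k {\<lambda>a. b \<longrightarrow> f a}"
  by (cases b) (auto intro: derives_le[OF derives_const[of A D True]])

lemma derives_ex:
  fixes N :: nat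
  assumes "constants \<subseteq> A" "\<And>i. i < N \<Longrightarrow> derives D A k {f i}"
  shows "derives D A (N * (k + 1)) {\<lambda>a. \<exists>i<N. f i a}"
  using assms(2)
proof (induction N)
  case 0
  then show ?case using derives_const[OF assms(1), of D False] by simp
next
  case (Suc N)
  then have "derives D A (N * (k + 1) + k + 1) {\<lambda>a. (\<exists>i<N. f i a) \<or> f N a}"
    by (intro derives_disj) auto
  then show ?case
    by (rule derives_cong[OF derives_le]) (auto simp: less_Suc_eq)
qed

lemma derives_all:
  fixes N :: nat
  assumes "constants \<subseteq> A" "\<And>i. i < N \<Longrightarrow> derives D A k {f i}"
  shows "derives D A (N * (k + 1)) {\<lambda>a. \<forall>i<N. f i a}"
  using assms(2)
proof (induction N)
  case 0
  then show ?case using derives_const[OF assms(1), of D True] by simp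
next
  case (Suc N)
  then have "derives D A (N * (k + 1) + k + 1) {\<lambda>a. (\<forall>i<N. f i a) \<and> f N a}"
    by (intro derives_conj) auto
  then show ?case
    by (rule derives_cong[OF derives_le]) (auto simp: less_Suc_eq)
qed

lemma derives_mux:
  assumes "c \<in> A" "(\<lambda>a. \<not> c a) \<in> A" "derives D A 0 {f}" "derives D A 0 {g}"
  shows "derives D A 3 {\<lambda>a. if c a then f a else g a}"
proof -
  have "derives D A ((0+0+1)+(0+0+1)+1) {\<lambda>a. (c a \<and> f a) \<or> (\<not> c a \<and> g a)}"
    by (intro derives_disj derives_conj assms derives_wire)
  then show ?thesis by (rule derives_cong[OF derives_le]) auto
qed

definition array :: "nat \<Rightarrow> nat \<Rightarrow> (nat \<Rightarrow> nat \<Rightarrow> 'a \<Rightarrow> bool) \<Rightarrow> ('a \<Rightarrow> bool) set" where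
  "array N M f = {f i j | i j. i < N \<and> j < M}"

text \<open>Negation cannot be applied at the point of use, so control families are carried in both
  polarities.\<close>

definition dual :: "('a \<Rightarrow> bool) set \<Rightarrow> ('a \<Rightarrow> bool) set" where
  "dual A = A \<union> (\<lambda>f a. \<not> f a) ` A"

lemma array_memI: "i < N \<Longrightarrow> j < M \<Longrightarrow> f i j \<in> array N M f"
  by (auto simp: array_def)

lemma dual_array_memI:
  assumes "i < N" "j < M"
  shows "f i j \<in> dual (array N M f)" "(\<lambda>a. \<not> f i j a) \<in> dual (array N M f)"
  using array_memI[OF assms, of f] by (auto simp: dual_def)

lemma derives_array:
  assumes "\<And>i j. i < N \<Longrightarrow> j < M \<Longrightarrow> derives D A k {f i j}"
  shows "derives D A (N * M * k) (array N M f)"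
proof -
  have "derives D A (card ({..<N} \<times> {..<M}) * k) ((\<lambda>(i, j). f i j) ` ({..<N} \<times> {..<M}))"
    by (rule derives_image) (auto intro: assms)
  moreover have "(\<lambda>(i, j). f i j) ` ({..<N} \<times> {..<M}) = array N M f"
    by (auto simp: array_def)
  ultimately show ?thesis by (simp add: card_cartesian_product)
qed

lemma derives_dual_array:
  assumes "\<And>i j. i < N \<Longrightarrow> j < M \<Longrightarrow> derives D A k {f i j}"
    and "\<And>i j. i < N \<Longrightarrow> j < M \<Longrightarrow> derives D A l {\<lambda>a. \<not> f i j a}"
  shows "derives D A (N * M * (k + l)) (dual (array N M f))"
proof -
  have "derives D A (N * M * k + N * M * l) (array N M f \<union> array N M (\<lambda>i j a. \<not> f i j a))"
    by (intro derives_Un derives_array assms)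
  moreover have "array N M f \<union> array N M (\<lambda>i j a. \<not> f i j a) = dual (array N M f)"
    unfolding dual_def array_def by (rule arg_cong2[where f = "(\<union>)"]) blast+
  ultimately show ?thesis by (simp add: distrib_left)
qed

text \<open>A circuit cannot separate two inputs that its sources do not separate. This turns the
  correctness of the network into injectivity of the map from permutations to switch states.\<close>

lemma derives_determines:
  assumes "derives D A k B" "a \<in> D" "b \<in> D" "\<And>f. f \<in> A \<Longrightarrow> f a = f b" "f \<in> B"
  shows "f a = f b"
  using assms
proof (induction)
  case (derives_base B A k)
  then obtain g where "g \<in> A" "\<forall>a\<in>D. f a = g a" by blast
  then show ?case using derives_base by metis
next
  case (derives_disj_gate f A g k B)
  then show ?case by auto
next
  case (derives_conj_gate f A g k B)
  then show ?case by auto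
qed

section \<open>Straight-line programs realising derived wires\<close>

lemma wf_node_mono: "wf_node V l s \<Longrightarrow> l \<le> l' \<Longrightarrow> wf_node V l' s"
  by (cases s) auto

lemma gate_vals_snoc: "gate_vals a (gs @ [g]) = gate_vals a gs @ [gate_val a (gate_vals a gs) g]"
  by (simp add: gate_vals_def)

lemma length_gate_vals: "length (gate_vals a gs) = length gs"
proof (induction gs rule: rev_induct)
  case Nil
  show ?case by (simp add: gate_vals_def)
next
  case (snoc g gs)
  then show ?case by (simp add: gate_vals_snoc)
qed

lemma node_val_snoc:
  "wf_node V (length gs) s \<Longrightarrow> node_val a (gate_vals a (gs @ [g])) s = node_val a (gate_vals a gs) s"
  by (cases s) (auto simp: gate_vals_snoc nth_append length_gate_vals)

definition program :: "'v set \<Rightarrow> 'v gate list \<Rightarrow> bool" where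
  "program V gs \<longleftrightarrow> (\<forall>i < length gs. wf_gate V i (gs ! i))"

definition has_wire :: "'v set \<Rightarrow> ('v \<Rightarrow> bool) set \<Rightarrow> 'v gate list \<Rightarrow> (('v \<Rightarrow> bool) \<Rightarrow> bool) \<Rightarrow> bool" where
  "has_wire V D gs f \<longleftrightarrow>
     (\<exists>s. wf_node V (length gs) s \<and> (\<forall>a\<in>D. node_val a (gate_vals a gs) s = f a))"

lemma has_wire_snoc: "has_wire V D gs f \<Longrightarrow> has_wire V D (gs @ [g]) f"
  unfolding has_wire_def
proof (elim exE conjE)
  fix s assume s: "wf_node V (length gs) s" "\<forall>a\<in>D. node_val a (gate_vals a gs) s = f a"
  show "\<exists>s. wf_node V (length (gs @ [g])) s \<and> (\<forall>a\<in>D. node_val a (gate_vals a (gs @ [g])) s = f a)"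
    using s wf_node_mono[OF s(1), of "length (gs @ [g])"] node_val_snoc[OF s(1)]
    by (intro exI[of _ s]) simp
qed

lemma program_extend:
  assumes "program V gs" "wf_gate V (length gs) g" "\<And>a. a \<in> D \<Longrightarrow> gate_val a (gate_vals a gs) g = f a"
  shows "program V (gs @ [g])" "has_wire V D (gs @ [g]) f"
proof -
  show "program V (gs @ [g])"
    using assms by (auto simp: program_def nth_append less_Suc_eq)
  show "has_wire V D (gs @ [g]) f"
    unfolding has_wire_def using assms
    by (intro exI[of _ "Gate (length gs)"])
       (auto simp: gate_vals_snoc nth_append length_gate_vals)
qed

lemma derives_program:
  assumes "derives D A k B" "program V gs" "\<And>f. f \<in> A \<Longrightarrow> has_wire V D gs f"
  shows "\<exists>gs'. program V gs' \<and> length gs' \<le> length gs + k \<and> (\<forall>f\<in>B. has_wire V D gs' f)"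
  using assms
proof (induction arbitrary: gs)
  case (derives_base B A k)
  have "has_wire V D gs f" if "f \<in> B" for f
  proof -
    obtain g where g: "g \<in> A" "\<forall>a\<in>D. f a = g a" using derives_base.hyps \<open>f \<in> B\<close> by blast
    then show ?thesis using derives_base.prems(2)[OF g(1)] by (simp add: has_wire_def)
  qed
  then show ?case using derives_base.prems(1) by (intro exI[of _ gs]) auto
next
  case (derives_disj_gate f A g k B)
  obtain s where s: "wf_node V (length gs) s" "\<forall>a\<in>D. node_val a (gate_vals a gs) s = f a"
    using derives_disj_gate.prems(2)[OF derives_disj_gate.hyps(1)] unfolding has_wire_def by blast
  obtain t where t: "wf_node V (length gs) t" "\<forall>a\<in>D. node_val a (gate_vals a gs) t = g a"
    using derives_disj_gate.prems(2)[OF derives_disj_gate.hyps(2)] unfolding has_wire_def by blast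
  have "\<exists>gs'. program V gs' \<and> length gs' \<le> length (gs @ [Disj s t]) + k \<and> (\<forall>f\<in>B. has_wire V D gs' f)"
  proof (rule derives_disj_gate.IH)
    show "program V (gs @ [Disj s t])"
      using derives_disj_gate.prems(1) s(1) t(1) by (intro program_extend(1)[where D = "{}" and f = undefined]) simp_all
    show "has_wire V D (gs @ [Disj s t]) h" if "h \<in> insert (\<lambda>a. f a \<or> g a) A" for h
    proof (cases "h \<in> A")
      case True
      then show ?thesis using derives_disj_gate.prems(2) by (intro has_wire_snoc)
    next
      case False
      then have h: "h = (\<lambda>a. f a \<or> g a)" using that by simp
      show ?thesis using derives_disj_gate.prems(1) s t by (intro program_extend(2)) (simp_all add: h)
    qed
  qed
  then show ?case by simp
next
  case (derives_conj_gate f A g k B)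
  obtain s where s: "wf_node V (length gs) s" "\<forall>a\<in>D. node_val a (gate_vals a gs) s = f a"
    using derives_conj_gate.prems(2)[OF derives_conj_gate.hyps(1)] unfolding has_wire_def by blast
  obtain t where t: "wf_node V (length gs) t" "\<forall>a\<in>D. node_val a (gate_vals a gs) t = g a"
    using derives_conj_gate.prems(2)[OF derives_conj_gate.hyps(2)] unfolding has_wire_def by blast
  have "\<exists>gs'. program V gs' \<and> length gs' \<le> length (gs @ [Conj s t]) + k \<and> (\<forall>f\<in>B. has_wire V D gs' f)"
  proof (rule derives_conj_gate.IH)
    show "program V (gs @ [Conj s t])"
      using derives_conj_gate.prems(1) s(1) t(1) by (intro program_extend(1)[where D = "{}" and f = undefined]) simp_all
    show "has_wire V D (gs @ [Conj s t]) h" if "h \<in> insert (\<lambda>a. f a \<and> g a) A" for h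
    proof (cases "h \<in> A")
      case True
      then show ?thesis using derives_conj_gate.prems(2) by (intro has_wire_snoc)
    next
      case False
      then have h: "h = (\<lambda>a. f a \<and> g a)" using that by simp
      show ?thesis using derives_conj_gate.prems(1) s t by (intro program_extend(2)) (simp_all add: h)
    qed
  qed
  then show ?case by simp
qed

lemma complexity_le_derives:
  assumes "derives D ((\<lambda>v a. a v) ` in_vars F) k (out ` out_pos F)"
    and "\<And>a z w. op_map F a = Some z \<Longrightarrow> w \<in> out_pos F \<Longrightarrow> a \<in> D \<and> out w a = z w"
  shows "complexity F \<le> enat k"
proof -
  have "\<exists>gs. program (in_vars F) gs \<and> length gs \<le> k
      \<and> (\<forall>f \<in> out ` out_pos F. has_wire (in_vars F) D gs f)"
  proof (rule derives_program[OF assms(1), where gs = "[]", simplified list.size add_0])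
    show "program (in_vars F) []" by (simp add: program_def)
    show "has_wire (in_vars F) D [] f" if "f \<in> (\<lambda>v a. a v) ` in_vars F" for f
    proof -
      obtain v where "v \<in> in_vars F" "f = (\<lambda>a. a v)" using \<open>f \<in> _\<close> by blast
      then show ?thesis unfolding has_wire_def by (intro exI[of _ "Input v"]) simp
    qed
  qed
  then obtain gs where gs: "program (in_vars F) gs" "length gs \<le> k"
    "\<And>w. w \<in> out_pos F \<Longrightarrow> has_wire (in_vars F) D gs (out w)" by auto
  then obtain s where s: "\<And>w. w \<in> out_pos F \<Longrightarrow> wf_node (in_vars F) (length gs) (s w)"
    "\<And>w a. w \<in> out_pos F \<Longrightarrow> a \<in> D \<Longrightarrow> node_val a (gate_vals a gs) (s w) = out w a"
    unfolding has_wire_def by metis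
  define C where "C = \<lparr>gates = gs, out_node = s\<rparr>"
  have "computes C F"
    unfolding computes_def wf_circuit_def circuit_val_def C_def
    using gs(1) s assms(2) by (auto simp: program_def)
  then have "complexity F \<le> enat (length (gates C))"
    unfolding complexity_def by (intro INF_lower) simp
  also have "\<dots> \<le> enat k" using gs(2) by (simp add: C_def)
  finally show ?thesis .
qed

section \<open>The Benes network\<close>

text \<open>\<open>j\<close> with its lowest bit flipped: the other line of switch
  \<open>j div 2\<close>.\<close>

definition mate :: "nat \<Rightarrow> nat" where
  "mate j = (if even j then j + 1 else j - 1)"

lemma mate_mate [simp]: "mate (mate j) = j"
  by (auto simp: mate_def)

lemma mate_neq [simp]: "mate j \<noteq> j" "j \<noteq> mate j"
  by (auto simp: mate_def elim: oddE)

lemma mate_less: "j < 2 * K \<Longrightarrow> mate j < 2 * K"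
  by (auto simp: mate_def elim!: evenE)

lemma div2_eq_cases: "i div 2 = j div 2 \<longleftrightarrow> i = j \<or> i = mate (j::nat)"
  by (auto simp: mate_def elim!: oddE evenE)

lemma mate_double [simp]: "mate (2 * i) = Suc (2 * i)" "mate (Suc (2 * i)) = 2 * i"
  by (auto simp: mate_def)

text \<open>
  Outputs \<open>j\<close> and \<open>mate j\<close> share a switch, and so do \<open>j\<close> and \<open>inv P (mate (P j))\<close>, on the input side;
  both pairs must be sent to different subnetworks. \<open>shuttle P\<close> composes the two involutions, so
  a colouring which is constant on its orbits and separates \<open>j\<close> from \<open>mate j\<close> will do. Comparing
  the least elements of the two orbits is such a colouring.
\<close>

definition shuttle :: "(nat \<Rightarrow> nat) \<Rightarrow> nat \<Rightarrow> nat" where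
  "shuttle P j = mate (inv P (mate (P j)))"

text \<open>The orbit of \<open>j\<close>, cut off after \<open>2 * K\<close> steps; no orbit within
  \<open>{..<2 * K}\<close> is longer, and a bounded union of powers can be written as a
  circuit.\<close>

definition trail :: "nat \<Rightarrow> (nat \<Rightarrow> nat) \<Rightarrow> nat \<Rightarrow> nat set" where
  "trail K P j = {(shuttle P ^^ t) j | t. t < 2 * K}"

text \<open>The comparison of minima is spelled out with bounded quantifiers over membership in the
  two orbits, so that it can be evaluated gate by gate.\<close>

definition colour :: "nat \<Rightarrow> (nat \<Rightarrow> nat) \<Rightarrow> nat \<Rightarrow> bool" where
  "colour K P j \<longleftrightarrow> (\<exists>m<2*K. m \<in> trail K P j \<and> (\<forall>l<2*K. l < m \<longrightarrow> l \<notin> trail K P (mate j)))"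

context
  fixes K :: nat and P :: "nat \<Rightarrow> nat"
  assumes P: "P permutes {..<2 * K}"
begin

lemma shuttle_less: "j < 2 * K \<Longrightarrow> shuttle P j < 2 * K"
  unfolding shuttle_def
  using permutes_in_image[OF P] permutes_in_image[OF permutes_inv[OF P]] mate_less
  by (metis lessThan_iff)

lemma P_inv: "P (inv P j) = j" "inv P (P j) = j"
  using permutes_inverses[OF P] by auto

text \<open>\<open>shuttle P\<close> is a product of two involutions, so conjugation by
  \<open>mate\<close>, one of the factors, inverts it.\<close>

lemma shuttle_mate_shuttle: "shuttle P (mate (shuttle P j)) = mate j"
  by (simp add: shuttle_def P_inv)

lemma mate_shuttle: "mate (shuttle P j) = inv P (mate (P j))"
  by (simp add: shuttle_def)

lemma inj_shuttle: "inj (shuttle P)"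
  by (rule inj_on_inverseI[where g = "\<lambda>j. mate (shuttle P (mate j))"])
     (simp add: shuttle_mate_shuttle)

text \<open>By the inversion rule an equation between the \<open>t\<close>-th iterate at
  \<open>j\<close> and \<open>mate j\<close> loses one factor at either end and becomes the same
  equation at \<open>shuttle P j\<close> with \<open>t - 2\<close>. What remains are
  \<open>t = 0\<close> and \<open>t = 1\<close>, that is, fixed points of one of the two
  involutions, and neither has any.\<close>

lemma shuttle_power_neq_mate: "(shuttle P ^^ t) j \<noteq> mate j"
proof (induction t arbitrary: j rule: less_induct)
  case (less t)
  consider "t = 0" | "t = 1" | t' where "t = Suc (Suc t')"
    by (metis One_nat_def not0_implies_Suc)
  then show ?case
  proof cases
    case 2
    have "inv P (mate (P j)) \<noteq> j" using P_inv mate_neq by metis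
    then show ?thesis using 2 by (simp add: shuttle_def) (metis mate_mate)
  next
    case 3
    show ?thesis
    proof
      assume "(shuttle P ^^ t) j = mate j"
      then have "shuttle P ((shuttle P ^^ t') (shuttle P j)) = shuttle P (mate (shuttle P j))"
        using 3 by (simp add: shuttle_mate_shuttle funpow_swap1)
      then have "(shuttle P ^^ t') (shuttle P j) = mate (shuttle P j)"
        using inj_shuttle by (simp add: inj_eq)
      then show False using less.IH[of t'] 3 by simp
    qed
  qed simp
qed

lemma shuttle_power_less: "j < 2 * K \<Longrightarrow> (shuttle P ^^ t) j < 2 * K"
  by (induction t) (auto simp: shuttle_less)

lemma shuttle_period:
  assumes "j < 2 * K"
  obtains p where "0 < p" "p \<le> 2 * K" "(shuttle P ^^ p) j = j"
proof -
  have "\<not> inj_on (\<lambda>t. (shuttle P ^^ t) j) {..2 * K}"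
  proof
    assume "inj_on (\<lambda>t. (shuttle P ^^ t) j) {..2 * K}"
    then have "card {..2 * K} \<le> card {..<2 * K}"
      by (rule card_inj_on_le) (use shuttle_power_less[OF assms] in auto)
    then show False by simp
  qed
  then obtain t u where tu: "t \<le> 2 * K" "u \<le> 2 * K" "t < u" "(shuttle P ^^ t) j = (shuttle P ^^ u) j"
    unfolding inj_on_def by (metis atMost_iff nat_neq_iff)
  have "(shuttle P ^^ t) ((shuttle P ^^ (u - t)) j) = (shuttle P ^^ t) j"
    using tu by (simp flip: funpow_add[unfolded fun_eq_iff comp_def, rule_format])
  then have "(shuttle P ^^ (u - t)) j = j"
    using inj_fn[OF inj_shuttle, of t] by (simp add: inj_eq)
  then show thesis using that[of "u - t"] tu by auto
qed

lemma trail_iff: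
  assumes "j < 2 * K"
  shows "l \<in> trail K P j \<longleftrightarrow> (\<exists>t. (shuttle P ^^ t) j = l)"
proof
  assume "\<exists>t. (shuttle P ^^ t) j = l"
  then obtain t where t: "(shuttle P ^^ t) j = l" by blast
  obtain p where p: "0 < p" "p \<le> 2 * K" "(shuttle P ^^ p) j = j" using shuttle_period[OF assms] .
  have "(shuttle P ^^ (t mod p)) j = l"
    using funpow_mod_eq[OF p(3), of t] t by simp
  moreover have "t mod p < 2 * K" using p by (meson less_le_trans mod_less_divisor)
  ultimately show "l \<in> trail K P j" by (auto simp: trail_def)
qed (auto simp: trail_def)

lemma trail_shuttle:
  assumes "j < 2 * K"
  shows "trail K P (shuttle P j) = trail K P j"
proof -
  obtain p where p: "0 < p" "(shuttle P ^^ p) j = j" using shuttle_period[OF assms] by blast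
  have "(\<exists>t. (shuttle P ^^ t) (shuttle P j) = l) \<longleftrightarrow> (\<exists>t. (shuttle P ^^ t) j = l)" for l
  proof
    assume "\<exists>t. (shuttle P ^^ t) (shuttle P j) = l"
    then obtain t where "(shuttle P ^^ Suc t) j = l" by (auto simp: funpow_swap1)
    then show "\<exists>t. (shuttle P ^^ t) j = l" by blast
  next
    assume "\<exists>t. (shuttle P ^^ t) j = l"
    then obtain t where t: "(shuttle P ^^ t) j = l" by blast
    have "(shuttle P ^^ (t + (p - 1))) (shuttle P j) = (shuttle P ^^ (t + p)) j"
      using p by (cases p) (auto simp: funpow_swap1)
    also have "\<dots> = l" using p t by (simp add: funpow_add)
    finally show "\<exists>t. (shuttle P ^^ t) (shuttle P j) = l" by blast
  qed
  then show ?thesis using trail_iff assms shuttle_less by blast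
qed

lemma trail_subset: "j < 2 * K \<Longrightarrow> trail K P j \<subseteq> {..<2 * K}"
  using shuttle_power_less by (auto simp: trail_def)

lemma self_in_trail: "j < 2 * K \<Longrightarrow> j \<in> trail K P j"
  unfolding trail_def by (auto intro!: exI[of _ 0])

lemma trail_in:
  assumes "j < 2 * K" "l \<in> trail K P j"
  shows "trail K P l = trail K P j"
proof -
  obtain t where t: "l = (shuttle P ^^ t) j" using trail_iff[OF assms(1), of l] assms(2) by auto
  show ?thesis unfolding t
    by (induction t) (simp_all add: trail_shuttle shuttle_power_less assms(1))
qed

lemma trails_disjoint:
  assumes "j < 2 * K" "l \<in> trail K P j" "l \<in> trail K P (mate j)"
  shows False
proof -
  have "trail K P j = trail K P (mate j)"
    using trail_in assms mate_less by metis
  then have "mate j \<in> trail K P j"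
    using self_in_trail assms(1) mate_less by blast
  then show False using trail_iff[OF assms(1)] shuttle_power_neq_mate by blast
qed

lemma colour_iff_Min:
  assumes "j < 2 * K"
  shows "colour K P j \<longleftrightarrow> Min (trail K P j) < Min (trail K P (mate j))"
proof -
  let ?A = "trail K P j" and ?B = "trail K P (mate j)"
  have fin: "finite ?A" "finite ?B" and ne: "?A \<noteq> {}" "?B \<noteq> {}"
    using trail_subset[OF assms] trail_subset[OF mate_less[OF assms]] finite_subset
      self_in_trail[OF assms] self_in_trail[OF mate_less[OF assms]] by blast+
  show ?thesis
  proof
    assume "colour K P j"
    then obtain m where m: "m \<in> ?A" "\<forall>l<2*K. l < m \<longrightarrow> l \<notin> ?B" "m < 2 * K"
      by (auto simp: colour_def)
    have "Min ?B \<in> ?B" using fin ne by simp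
    then have "\<not> Min ?B < m" using m trail_subset[OF mate_less[OF assms]] by auto
    moreover have "Min ?B \<noteq> m" using trails_disjoint[OF assms m(1)] \<open>Min ?B \<in> ?B\<close> by blast
    ultimately show "Min ?A < Min ?B" using Min_le[OF fin(1) m(1)] by linarith
  next
    assume "Min ?A < Min ?B"
    then show "colour K P j"
      unfolding colour_def using Min_in[OF fin(1) ne(1)] trail_subset[OF assms] Min_le[OF fin(2)]
      by (intro exI[of _ "Min ?A"]) force
  qed
qed

lemma colour_mate:
  assumes "j < 2 * K"
  shows "colour K P (mate j) \<longleftrightarrow> \<not> colour K P j"
proof -
  have "Min (trail K P j) \<noteq> Min (trail K P (mate j))"
  proof
    assume eq: "Min (trail K P j) = Min (trail K P (mate j))"
    have "Min (trail K P i) \<in> trail K P i" if "i < 2 * K" for i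
      using that trail_subset finite_subset self_in_trail by (intro Min_in) blast+
    then show False using trails_disjoint[OF assms] eq assms mate_less by metis
  qed
  then show ?thesis
    unfolding colour_iff_Min[OF assms] colour_iff_Min[OF mate_less[OF assms]] by auto
qed

text \<open>The orbit of \<open>j\<close> does not change, and neither does the competing orbit:
  \<open>shuttle P\<close> maps \<open>mate (shuttle P j)\<close> back to
  \<open>mate j\<close>.\<close>

lemma colour_shuttle:
  assumes "j < 2 * K"
  shows "colour K P (shuttle P j) = colour K P j"
proof -
  let ?j = "mate (shuttle P j)"
  have "trail K P (mate j) = trail K P (shuttle P ?j)" by (simp only: shuttle_mate_shuttle)
  also have "\<dots> = trail K P ?j"
    by (intro trail_shuttle mate_less shuttle_less assms)
  finally show ?thesis
    using trail_shuttle[OF assms] assms shuttle_less[OF assms] by (simp add: colour_iff_Min)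
qed

text \<open>With \<open>i = inv P l\<close>, the two lines of an input switch feed the outputs
  \<open>i\<close> and \<open>mate (shuttle P i)\<close>; invariance under \<open>shuttle P\<close>
  and alternation under \<open>mate\<close> send them to different subnetworks.\<close>

lemma colour_inv_mate:
  assumes "l < 2 * K"
  shows "colour K P (inv P (mate l)) \<longleftrightarrow> \<not> colour K P (inv P l)"
proof -
  have l: "inv P l < 2 * K" using permutes_in_image[OF permutes_inv[OF P], of l] assms by simp
  have "inv P (mate l) = mate (shuttle P (inv P l))" by (simp add: mate_shuttle P_inv)
  then show ?thesis
    using colour_mate[OF shuttle_less[OF l]] colour_shuttle[OF l] by simp
qed

end

section \<open>Recursive construction of the network\<close>

text \<open>The permutation left to the subnetwork of colour \<open>c\<close>: output switch
  \<open>i\<close> takes its line of colour \<open>c\<close> from there, and source line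
  \<open>l\<close> enters through input switch \<open>l div 2\<close>. Permutations map outputs to
  their sources throughout.\<close>

definition half :: "nat \<Rightarrow> bool \<Rightarrow> (nat \<Rightarrow> nat) \<Rightarrow> nat \<Rightarrow> nat" where
  "half K c P i =
     (if i < K then P (if colour K P (2 * i) = c then 2 * i else Suc (2 * i)) div 2 else i)"

lemma half_colour:
  assumes "P permutes {..<2 * K}" "j < 2 * K"
  shows "half K (colour K P j) P (j div 2) = P j div 2"
proof -
  consider i where "j = 2 * i" | i where "j = Suc (2 * i)" by (metis oddE evenE Suc_eq_plus1)
  then show ?thesis
  proof cases
    case 1
    then show ?thesis using assms(2) by (simp add: half_def)
  next
    case 2
    then show ?thesis using assms(2) colour_mate[OF assms(1), of "2 * i"] by (auto simp: half_def)
  qed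
qed

text \<open>Two outputs of one colour never draw on the same input switch, because colours alternate
  on the input side as well; this gives injectivity.\<close>

lemma half_permutes:
  assumes P: "P permutes {..<2 * K}"
  shows "half K c P permutes {..<K}"
proof (rule bij_imp_permutes)
  have src: "\<exists>j<2*K. j div 2 = i \<and> colour K P j = c" if "i < K" for i
    using that colour_mate[OF P, of "2 * i"]
    by (cases "colour K P (2 * i) = c") (auto intro: exI[of _ "2 * i"] exI[of _ "Suc (2 * i)"])
  have "inj_on (half K c P) {..<K}"
  proof (rule inj_onI)
    fix i i' assume ii: "i \<in> {..<K}" "i' \<in> {..<K}" "half K c P i = half K c P i'"
    obtain j where j: "j < 2 * K" "j div 2 = i" "colour K P j = c" using src ii(1) by auto
    obtain j' where j': "j' < 2 * K" "j' div 2 = i'" "colour K P j' = c" using src ii(2) by auto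
    have "P j div 2 = P j' div 2"
      using ii(3) half_colour[OF P j(1)] half_colour[OF P j'(1)] j j' by simp
    moreover have "P j \<noteq> mate (P j')"
    proof
      assume "P j = mate (P j')"
      then have "j = inv P (mate (P j'))" using permutes_inverses(2)[OF P] by metis
      moreover have "P j' < 2 * K" using permutes_in_image[OF P, of j'] j' by simp
      ultimately show False
        using colour_inv_mate[OF P, of "P j'"] j j' permutes_inverses(2)[OF P] by simp
    qed
    ultimately have "P j = P j'" by (simp add: div2_eq_cases)
    then have "j = j'" using permutes_inj[OF P] by (simp add: inj_eq)
    then show "i = i'" using j j' by simp
  qed
  moreover have "half K c P ` {..<K} \<subseteq> {..<K}"
  proof (rule image_subsetI)
    fix i assume "i \<in> {..<K}"
    then obtain j where j: "j < 2 * K" "j div 2 = i" "colour K P j = c" using src by auto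
    then show "half K c P i \<in> {..<K}"
      using half_colour[OF P j(1)] permutes_in_image[OF P, of j] by auto
  qed
  ultimately show "bij_betw (half K c P) {..<K} {..<K}"
    by (simp add: bij_betw_def endo_inj_surj)
qed (simp add: half_def)

text \<open>Switch states are functions of the permutation, collected independently of it: the same
  finite set yields the coordinates of the code in (i) and the wires to be computed in (ii).\<close>

fun controls :: "nat \<Rightarrow> ((nat \<Rightarrow> nat) \<Rightarrow> bool) set" where
  "controls 0 = {}"
| "controls (Suc k) =
     (\<lambda>i P. colour (2 ^ k) P (2 * i)) ` {..<2 ^ k} \<union>
     (\<lambda>i P. colour (2 ^ k) P (inv P (2 * i))) ` {..<2 ^ k} \<union>
     (\<Union>c. (\<lambda>\<kappa> P. \<kappa> (half (2 ^ k) c P)) ` controls k)"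

lemma finite_controls: "finite (controls k)"
  by (induction k) auto

definition control_wires :: "nat \<Rightarrow> ('a \<Rightarrow> nat \<Rightarrow> nat) \<Rightarrow> ('a \<Rightarrow> bool) set" where
  "control_wires k P = dual ((\<lambda>\<kappa> a. \<kappa> (P a)) ` controls k)"

lemma control_wires_Suc:
  "control_wires (Suc k) P =
     dual ((\<lambda>i a. colour (2 ^ k) (P a) (2 * i)) ` {..<2 ^ k}) \<union>
     dual ((\<lambda>i a. colour (2 ^ k) (P a) (inv (P a) (2 * i))) ` {..<2 ^ k}) \<union>
     (\<Union>c. control_wires k (\<lambda>a. half (2 ^ k) c (P a)))"
  by (auto simp: control_wires_def dual_def image_Un image_UN image_image)

lemma dual_image_memI:
  assumes "i \<in> I"
  shows "f i \<in> dual (f ` I)" "(\<lambda>a. \<not> f i a) \<in> dual (f ` I)"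
  using assms by (auto simp: dual_def)

text \<open>Each of the \<open>k\<close> levels spends one multiplexer of 3 gates per line and bit
  before the two subnetworks and one behind them, hence the factor 6.\<close>

lemma derives_benes:
  assumes "\<And>a. a \<in> D \<Longrightarrow> P a permutes {..<2 ^ k}"
  shows "derives D (array (2 ^ k) p x \<union> control_wires k P) (6 * p * k * 2 ^ k)
           (array (2 ^ k) p (\<lambda>j b a. x (P a j) b a))"
  using assms
proof (induction k arbitrary: P x)
  case 0
  then have P0: "P a 0 = 0" if "a \<in> D" for a
    using permutes_in_image[OF 0[OF that], of 0] by simp
  show ?case
  proof (rule derives_base)
    fix f assume "f \<in> array (2 ^ 0) p (\<lambda>j b a. x (P a j) b a)"
    then obtain b where b: "b < p" "f = (\<lambda>a. x (P a 0) b a)" by (auto simp: array_def)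
    then show "\<exists>g\<in>array (2 ^ 0) p x \<union> control_wires 0 P. \<forall>a\<in>D. f a = g a"
      using array_memI[of 0 "2 ^ 0" b p x] P0 by (intro bexI[of _ "x 0 b"]) simp_all
  qed
next
  case (Suc k)
  define K :: nat where "K = 2 ^ k"
  have P: "P a permutes {..<2 * K}" if "a \<in> D" for a using Suc.prems[OF that] by (simp add: K_def)
  let ?A = "array (2 ^ Suc k) p x \<union> control_wires (Suc k) P"
  \<comment> \<open>\<open>E i\<close> is the colour of the output fed by input line
    \<open>2 * i\<close>, so it is the setting of input switch \<open>i\<close>; \<open>u c\<close>
    and \<open>w c\<close> are the inputs and outputs of the subnetwork of colour
    \<open>c\<close>.\<close>
  define E where "E i a = colour K (P a) (inv (P a) (2 * i))" for i a
  define u where "u c i b a = (if E i a = c then x (2 * i) b a else x (Suc (2 * i)) b a)" for c i b a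
  define w where "w c i b a = u c (half K c (P a) i) b a" for c i b a
  have E: "E i \<in> ?A" "(\<lambda>a. \<not> E i a) \<in> ?A" if "i < K" for i
    unfolding control_wires_Suc E_def[abs_def] K_def[symmetric]
    using dual_image_memI[of i "{..<K}" "\<lambda>i a. colour K (P a) (inv (P a) (2 * i))"] that by blast+
  have C: "(\<lambda>a. colour K (P a) (2 * i)) \<in> ?A" "(\<lambda>a. \<not> colour K (P a) (2 * i)) \<in> ?A" if "i < K" for i
    unfolding control_wires_Suc K_def[symmetric]
    using dual_image_memI[of i "{..<K}" "\<lambda>i a. colour K (P a) (2 * i)"] that by blast+
  have x: "x j b \<in> ?A" if "j < 2 * K" "b < p" for j b
    using that array_memI[of j "2 ^ Suc k" b p x] by (simp add: K_def)
  have u: "derives D ?A (K * p * 3) (array K p (u c))" for c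
  proof (rule derives_array)
    fix i b assume ib: "i < K" "b < p"
    then have x1: "derives D ?A 0 {x (2 * i) b}" and x2: "derives D ?A 0 {x (Suc (2 * i)) b}"
      by (intro derives_wire x; simp)+
    show "derives D ?A 3 {u c i b}"
    proof (cases c)
      case True
      have "u c i b = (\<lambda>a. if E i a then x (2 * i) b a else x (Suc (2 * i)) b a)"
        using True by (auto simp: u_def)
      then show ?thesis using derives_mux[OF E[OF ib(1)] x1 x2] by simp
    next
      case False
      have "u c i b = (\<lambda>a. if E i a then x (Suc (2 * i)) b a else x (2 * i) b a)"
        using False by (auto simp: u_def)
      then show ?thesis using derives_mux[OF E[OF ib(1)] x2 x1] by simp
    qed
  qed
  have w: "derives D (?A \<union> array K p (u c)) (6 * p * k * K) (array K p (w c))" for c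
  proof -
    have "derives D (array K p (u c) \<union> control_wires k (\<lambda>a. half K c (P a))) (6 * p * k * K)
        (array K p (w c))"
      unfolding w_def K_def
      by (rule Suc.IH) (use half_permutes[OF P] in \<open>simp add: K_def\<close>)
    then show ?thesis by (rule derives_source) (auto simp: control_wires_Suc K_def)
  qed
  have uw: "derives D ?A (K * p * 3 + 6 * p * k * K) (array K p (w c))" for c
    by (rule derives_trans[OF u w])
  let ?B = "array K p (w True) \<union> array K p (w False)"
  have z: "derives D (?A \<union> ?B) (2 * K * p * 3) (array (2 * K) p (\<lambda>j b a. x (P a j) b a))"
  proof (rule derives_array)
    fix j b assume jb: "j < 2 * K" "b < p"
    let ?i = "j div 2"
    have i: "?i < K" using jb by auto
    have wires: "derives D (?A \<union> ?B) 0 {w c ?i b}" for c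
      using i jb by (cases c) (auto intro!: derives_wire array_memI)
    \<comment> \<open>Output \<open>j\<close> is read from the subnetwork of its own colour. The
      parity of \<open>P a j\<close> decides whether \<open>E\<close> gives that colour or the
      opposite one.\<close>
    have route: "x (P a j) b a = w (colour K (P a) j) ?i b a" if "a \<in> D" for a
    proof -
      let ?l = "P a j"
      have l: "?l < 2 * K" using permutes_in_image[OF P[OF that], of j] jb by simp
      have inv: "inv (P a) ?l = j" using permutes_inverses(2)[OF P[OF that]] by simp
      have "w (colour K (P a) j) ?i b a = u (colour K (P a) j) (?l div 2) b a"
        by (simp add: w_def half_colour[OF P[OF that] jb(1)])
      also have "\<dots> = x ?l b a"
      proof (cases "even ?l")
        case True
        then have l2: "2 * (?l div 2) = ?l" by simp
        then have "E (?l div 2) a = colour K (P a) j" by (simp only: E_def l2 inv)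
        then show ?thesis by (simp add: u_def l2)
      next
        case False
        then have l2: "Suc (2 * (?l div 2)) = ?l" by simp
        then have "mate ?l = 2 * (?l div 2)" by (metis mate_double(2))
        then have "E (?l div 2) a = (\<not> colour K (P a) j)"
          using colour_inv_mate[OF P[OF that] l] by (simp add: E_def inv)
        then show ?thesis by (simp add: u_def l2)
      qed
      finally show ?thesis by simp
    qed
    show "derives D (?A \<union> ?B) 3 {\<lambda>a. x (P a j) b a}"
    proof (cases "even j")
      case True
      then have j: "2 * ?i = j" by simp
      have "derives D (?A \<union> ?B) 3 {\<lambda>a. if colour K (P a) (2 * ?i) then w True ?i b a else w False ?i b a}"
        by (rule derives_mux) (use C[OF i] wires in simp_all)
      then show ?thesis
        by (rule derives_cong) (simp add: route j)
    next
      case False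
      then have "j = Suc (2 * ?i)" by simp
      then have j: "j = mate (2 * ?i)" by (metis mate_double(1))
      have "derives D (?A \<union> ?B) 3 {\<lambda>a. if colour K (P a) (2 * ?i) then w False ?i b a else w True ?i b a}"
        by (rule derives_mux) (use C[OF i] wires in simp_all)
      then show ?thesis
      proof (rule derives_cong)
        fix a assume a: "a \<in> D"
        have "colour K (P a) j = (\<not> colour K (P a) (2 * ?i))"
          using colour_mate[OF P[OF a], of "2 * ?i"] i j by simp
        then show "(if colour K (P a) (2 * ?i) then w False ?i b a else w True ?i b a) = x (P a j) b a"
          by (simp add: route[OF a])
      qed
    qed
  qed
  have "derives D ?A ((K * p * 3 + 6 * p * k * K) + (K * p * 3 + 6 * p * k * K) + 2 * K * p * 3)
      (array (2 * K) p (\<lambda>j b a. x (P a j) b a))"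
    by (rule derives_trans[OF derives_Un[OF uw uw] z])
  moreover have "(K * p * 3 + 6 * p * k * K) + (K * p * 3 + 6 * p * k * K) + 2 * K * p * 3
      = 6 * p * Suc k * 2 ^ Suc k"
    by (simp add: K_def algebra_simps)
  ultimately show ?case by (simp add: K_def)
qed

section \<open>Computing the switch states of the Benes network\<close>

abbreviation "onehot N P \<equiv> array N N (\<lambda>j l a. P a j = l)"

text \<open>\<open>shuttle P j = l\<close> is equivalent to \<open>P (mate l) = mate (P j)\<close>,
  which mentions no inverse; the disjunction runs over the value \<open>m\<close> of
  \<open>P j\<close>.\<close>

lemma derives_shuttle:
  assumes P: "\<And>a. a \<in> D \<Longrightarrow> P a permutes {..<2 * K}" and "constants \<subseteq> A"
    "onehot (2 * K) P \<subseteq> A"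
  shows "derives D A (4 * K * K * (4 * K)) (onehot (2 * K) (\<lambda>a. shuttle (P a)))"
proof -
  have M: "(\<lambda>a. P a j = l) \<in> A" if "j < 2 * K" "l < 2 * K" for j l
    using array_memI[OF that, of "\<lambda>j l a. P a j = l"] assms(3) by blast
  have "derives D A (2 * K * (2 * K) * (2 * K * (0 + 0 + 1 + 1))) (onehot (2 * K) (\<lambda>a. shuttle (P a)))"
  proof (rule derives_array)
    fix j l assume jl: "j < 2 * K" "l < 2 * K"
    have "derives D A (2 * K * (0 + 0 + 1 + 1)) {\<lambda>a. \<exists>m<2*K. P a j = m \<and> P a (mate l) = mate m}"
      by (intro derives_ex derives_conj derives_wire M assms(2) jl mate_less)
    then show "derives D A (2 * K * (0 + 0 + 1 + 1)) {\<lambda>a. shuttle (P a) j = l}"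
    proof (rule derives_cong)
      fix a assume a: "a \<in> D"
      have "P a j < 2 * K" using permutes_in_image[OF P[OF a], of j] jl by simp
      moreover have "P a (mate l) = mate (P a j) \<longleftrightarrow> shuttle (P a) j = l"
        unfolding shuttle_def using permutes_inverses[OF P[OF a]] mate_mate by metis
      ultimately show "(\<exists>m<2*K. P a j = m \<and> P a (mate l) = mate m) = (shuttle (P a) j = l)"
        by auto
    qed
  qed
  then show ?thesis by (simp add: algebra_simps)
qed

text \<open>An entry is off exactly when another entry of its row is on, which is a monotone
  condition.\<close>

lemma derives_onehot_dual:
  assumes "constants \<subseteq> A" "onehot N F \<subseteq> A" "\<And>a j. a \<in> D \<Longrightarrow> j < N \<Longrightarrow> F a j < N"
  shows "derives D A (N * N * N) (dual (onehot N F))"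
proof -
  have M: "(\<lambda>a. F a j = l) \<in> A" if "j < N" "l < N" for j l
    using array_memI[OF that, of "\<lambda>j l a. F a j = l"] assms(2) by blast
  have "derives D A (N * N * (0 + N * (0 + 1))) (dual (onehot N F))"
  proof (rule derives_dual_array)
    fix j l assume jl: "j < N" "l < N"
    show "derives D A 0 {\<lambda>a. F a j = l}" by (intro derives_wire M jl)
    have "derives D A (N * (0 + 1)) {\<lambda>a. \<exists>m<N. m \<noteq> l \<and> F a j = m}"
      by (intro derives_ex derives_guard_conj derives_wire M assms(1) jl)
    then show "derives D A (N * (0 + 1)) {\<lambda>a. F a j \<noteq> l}"
      by (rule derives_cong) (use assms(3) jl in auto)
  qed
  then show ?thesis by simp
qed

lemma derives_onehot_power:
  assumes "constants \<subseteq> A" "onehot N F \<subseteq> A" "\<And>a j. a \<in> D \<Longrightarrow> j < N \<Longrightarrow> F a j < N"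
  shows "derives D A (t * (2 * N * N * N)) (onehot N (\<lambda>a. F a ^^ t))"
proof (induction t)
  case 0
  have "derives D A (N * N * 0) (onehot N (\<lambda>a. F a ^^ 0))"
    by (rule derives_array) (simp add: derives_const assms(1))
  then show ?case by simp
next
  case (Suc t)
  let ?A = "A \<union> onehot N (\<lambda>a. F a ^^ t)"
  have M: "(\<lambda>a. F a j = l) \<in> ?A" "(\<lambda>a. (F a ^^ t) j = l) \<in> ?A" if "j < N" "l < N" for j l
    using array_memI[OF that, of "\<lambda>j l a. F a j = l"]
      array_memI[OF that, of "\<lambda>j l a. (F a ^^ t) j = l"] assms(2) by blast+
  have A: "constants \<subseteq> ?A" using assms(1) by blast
  have less: "(F a ^^ t) j < N" if "a \<in> D" "j < N" for a j t
    by (induction t) (use that assms(3) in auto)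
  have "derives D ?A (N * N * (N * (0 + 0 + 1 + 1))) (onehot N (\<lambda>a. F a ^^ Suc t))"
  proof (rule derives_array)
    fix j l assume jl: "j < N" "l < N"
    have "derives D ?A (N * (0 + 0 + 1 + 1)) {\<lambda>a. \<exists>m<N. (F a ^^ t) j = m \<and> F a m = l}"
      by (intro derives_ex derives_conj derives_wire M A jl)
    then show "derives D ?A (N * (0 + 0 + 1 + 1)) {\<lambda>a. (F a ^^ Suc t) j = l}"
      by (rule derives_cong) (use less jl in auto)
  qed
  from derives_trans[OF Suc.IH this] show ?case by (simp add: algebra_simps)
qed

text \<open>Each of the \<open>N\<close> powers is computed from the start by repeated matrix
  multiplication, at \<open>O(N ^ 4)\<close> gates. This waste sets the exponent 5, which the
  sorting scheme reduces anyway.\<close>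

lemma derives_trail:
  assumes P: "\<And>a. a \<in> D \<Longrightarrow> P a permutes {..<2 * K}" and A: "constants \<subseteq> A" "onehot (2 * K) P \<subseteq> A"
    and N: "N = 2 * K"
  shows "derives D A (9 * N ^ 5) (dual (array N N (\<lambda>j m a. m \<in> trail K (P a) j)))"
proof (cases "N = 0")
  case True
  then show ?thesis by (simp add: array_def dual_def derives_subset)
next
  case False
  let ?T = "onehot N (\<lambda>a. shuttle (P a))"
  let ?W = "\<lambda>t. onehot N (\<lambda>a. shuttle (P a) ^^ t)"
  let ?A1 = "A \<union> ?T"
  have T: "derives D A (2 * N ^ 3) ?T"
    using derives_shuttle[OF P A] by (simp add: N power3_eq_cube algebra_simps)
  have lt: "shuttle (P a) j < N" if "a \<in> D" "j < N" for a j
    using shuttle_less[OF P[OF that(1)]] that(2) by (simp add: N)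
  have W: "derives D ?A1 (3 * N ^ 4) (dual (?W t))" if "t < N" for t
  proof -
    have 1: "derives D ?A1 (t * (2 * N * N * N)) (?W t)"
      by (rule derives_onehot_power) (use A lt in auto)
    have 2: "derives D (?A1 \<union> ?W t) (N * N * N) (dual (?W t))"
    proof (rule derives_onehot_dual)
      show "(shuttle (P a) ^^ t) j < N" if "a \<in> D" "j < N" for a j
        by (induction t) (use that lt in auto)
    qed (use A in auto)
    show ?thesis
    proof (rule derives_le[OF derives_trans[OF 1 2]])
      have "t * (2 * N * N * N) \<le> N * (2 * N * N * N)"
        using that by (intro mult_le_mono) simp_all
      also have "\<dots> = 2 * N ^ 4" by (simp add: power4_eq_xxxx)
      finally have "t * (2 * N * N * N) \<le> 2 * N ^ 4" .
      moreover have "N * N * N \<le> N ^ 4"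
        using power_increasing[of 3 4 N] False by (simp add: power3_eq_cube)
      ultimately show "t * (2 * N * N * N) + N * N * N \<le> 3 * N ^ 4" by simp
    qed
  qed
  let ?A2 = "?A1 \<union> (\<Union>t\<in>{..<N}. dual (?W t))"
  have WW: "derives D ?A1 (card {..<N} * (3 * N ^ 4)) (\<Union>t\<in>{..<N}. dual (?W t))"
    by (rule derives_UN) (use W in auto)
  have mem: "(\<lambda>a. (shuttle (P a) ^^ t) j = m) \<in> ?A2" "(\<lambda>a. \<not> (shuttle (P a) ^^ t) j = m) \<in> ?A2"
    if "t < N" "j < N" "m < N" for t j m
    using dual_array_memI[OF that(2,3), of "\<lambda>j m a. (shuttle (P a) ^^ t) j = m"] that(1) by blast+
  have A2: "constants \<subseteq> ?A2" using A by blast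
  have R: "derives D ?A2 (N * N * (N * (0 + 1) + N * (0 + 1)))
      (dual (array N N (\<lambda>j m a. m \<in> trail K (P a) j)))"
  proof (rule derives_dual_array)
    fix j m assume jm: "j < N" "m < N"
    have "derives D ?A2 (N * (0 + 1)) {\<lambda>a. \<exists>t<N. (shuttle (P a) ^^ t) j = m}"
      by (intro derives_ex derives_wire mem A2 jm)
    then show "derives D ?A2 (N * (0 + 1)) {\<lambda>a. m \<in> trail K (P a) j}"
      by (rule derives_cong) (auto simp: trail_def N)
    have "derives D ?A2 (N * (0 + 1)) {\<lambda>a. \<forall>t<N. \<not> (shuttle (P a) ^^ t) j = m}"
      by (intro derives_all derives_wire mem A2 jm)
    then show "derives D ?A2 (N * (0 + 1)) {\<lambda>a. m \<notin> trail K (P a) j}"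
      by (rule derives_cong) (auto simp: trail_def N)
  qed
  have "derives D A (2 * N ^ 3 + (card {..<N} * (3 * N ^ 4) + N * N * (N * (0 + 1) + N * (0 + 1))))
      (dual (array N N (\<lambda>j m a. m \<in> trail K (P a) j)))"
    by (rule derives_trans[OF T derives_trans[OF WW R]])
  moreover have "2 * N ^ 3 + (card {..<N} * (3 * N ^ 4) + N * N * (N * (0 + 1) + N * (0 + 1))) \<le> 9 * N ^ 5"
  proof -
    have "2 * N ^ 3 + (card {..<N} * (3 * N ^ 4) + N * N * (N * (0 + 1) + N * (0 + 1))) = 4 * N ^ 3 + 3 * N ^ 5"
      by (simp add: numeral_eq_Suc algebra_simps)
    moreover have "N ^ 3 \<le> N ^ 5" using False by (intro power_increasing) simp_all
    ultimately show ?thesis by linarith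
  qed
  ultimately show ?thesis by (rule derives_le)
qed

text \<open>The complement of a colour is the colour of the mate, so complements cost no further
  gates.\<close>

lemma derives_colour:
  assumes P: "\<And>a. a \<in> D \<Longrightarrow> P a permutes {..<2 * K}" and A: "constants \<subseteq> A" "onehot (2 * K) P \<subseteq> A"
    and N: "N = 2 * K"
  shows "derives D A (12 * N ^ 5) (dual ((\<lambda>j a. colour K (P a) j) ` {..<N}))"
proof (cases "N = 0")
  case True
  then show ?thesis by (simp add: dual_def derives_subset)
next
  case False
  let ?R = "dual (array N N (\<lambda>j m a. m \<in> trail K (P a) j))"
  let ?A = "A \<union> ?R"
  let ?C = "(\<lambda>j a. colour K (P a) j) ` {..<N}"
  have mem: "(\<lambda>a. m \<in> trail K (P a) j) \<in> ?A" "(\<lambda>a. m \<notin> trail K (P a) j) \<in> ?A"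
    if "j < N" "m < N" for j m
    using dual_array_memI[OF that, of "\<lambda>j m a. m \<in> trail K (P a) j"] by blast+
  have A': "constants \<subseteq> ?A" using A by blast
  have "derives D ?A (card {..<N} * (N * (0 + N * (0 + 1) + 1 + 1))) ?C"
  proof (rule derives_image)
    fix j assume "j \<in> {..<N}"
    then have j: "j < N" "mate j < N" using mate_less N by auto
    show "derives D ?A (N * (0 + N * (0 + 1) + 1 + 1)) {\<lambda>a. colour K (P a) j}"
      unfolding colour_def N[symmetric]
      by (intro derives_ex derives_conj derives_all derives_guard_imp derives_wire mem A' j)
  qed simp
  then have 1: "derives D ?A (N * (N * (N + 2))) ?C" by simp
  have memC: "(\<lambda>a. colour K (P a) j) \<in> ?A \<union> ?C" if "j < N" for j
    by (rule UnI2, rule image_eqI[of _ _ j]) (use that in simp_all)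
  have 2: "derives D (?A \<union> ?C) 0 (dual ?C)"
  proof (rule derives_base)
    fix f assume "f \<in> dual ?C"
    then consider j where "j < N" "f = (\<lambda>a. colour K (P a) j)"
      | j where "j < N" "f = (\<lambda>a. \<not> colour K (P a) j)" by (auto simp: dual_def)
    then show "\<exists>g\<in>?A \<union> ?C. \<forall>a\<in>D. f a = g a"
    proof cases
      case 1
      then show ?thesis using memC by (intro bexI[of _ f]) simp_all
    next
      case 2
      have "\<forall>a\<in>D. f a = colour K (P a) (mate j)"
        using colour_mate[OF P] 2 by (simp add: N)
      moreover have "(\<lambda>a. colour K (P a) (mate j)) \<in> ?A \<union> ?C"
        using mate_less[of j K] 2 N by (intro memC) simp
      ultimately show ?thesis by (rule bexI[of "\<lambda>g. \<forall>a\<in>D. f a = g a"])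
    qed
  qed
  have "derives D A (9 * N ^ 5 + (N * (N * (N + 2)) + 0)) (dual ?C)"
    by (rule derives_trans[OF derives_trail[OF P A N] derives_trans[OF 1 2]])
  moreover have "9 * N ^ 5 + (N * (N * (N + 2)) + 0) \<le> 12 * N ^ 5"
  proof -
    have "N * (N * (N + 2)) = N ^ 3 + 2 * N ^ 2" by (simp add: numeral_eq_Suc algebra_simps)
    moreover have "N ^ 3 \<le> N ^ 5" "N ^ 2 \<le> N ^ 5"
      using False by (intro power_increasing; simp)+
    ultimately show ?thesis by linarith
  qed
  ultimately show ?thesis by (rule derives_le)
qed

text \<open>Halving the size divides the fifth power by 32 while only two subproblems arise, so the
  top level dominates: \<open>12 * N ^ 5\<close> for the colours, \<open>2 * 20 * K ^ 5\<close> for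
  the subproblems and the quadratic terms stay below \<open>20 * N ^ 5\<close>.\<close>

lemma derives_controls:
  assumes "\<And>a. a \<in> D \<Longrightarrow> P a permutes {..<2 ^ k}"
  shows "derives D (constants \<union> onehot (2 ^ k) P) (20 * (2 ^ k) ^ 5) (control_wires k P)"
  using assms
proof (induction k arbitrary: P)
  case 0
  show ?case by (simp add: control_wires_def dual_def derives_subset)
next
  case (Suc k)
  define K :: nat where "K = 2 ^ k"
  define N where "N = 2 * K"
  have P: "P a permutes {..<2 * K}" if "a \<in> D" for a using Suc.prems[OF that] by (simp add: K_def)
  let ?S = "constants \<union> onehot N P"
  let ?C = "dual ((\<lambda>j a. colour K (P a) j) ` {..<N})"
  let ?A = "?S \<union> ?C"
  have C: "derives D ?S (12 * N ^ 5) ?C"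
    by (rule derives_colour[OF P]) (auto simp: N_def)
  have M: "(\<lambda>a. P a j = l) \<in> ?A" if "j < N" "l < N" for j l
    using array_memI[OF that, of "\<lambda>j l a. P a j = l"] by blast
  have col: "(\<lambda>a. colour K (P a) j) \<in> ?A" "(\<lambda>a. \<not> colour K (P a) j) \<in> ?A" if "j < N" for j
    using dual_image_memI[of j "{..<N}" "\<lambda>j a. colour K (P a) j"] that by blast+
  have A: "constants \<subseteq> ?A" by blast
  let ?E = "(\<lambda>i a. colour K (P a) (inv (P a) (2 * i))) ` {..<K}"
  have E: "derives D ?A (card {..<K} * (N * (0 + 0 + 1 + 1)) + card {..<K} * (N * (0 + 0 + 1 + 1))) (dual ?E)"
  proof -
    have *: "(\<exists>j<N. P a j = 2 * i \<and> Q j) \<longleftrightarrow> Q (inv (P a) (2 * i))" if "a \<in> D" "i < K" for a i Q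
    proof -
      have "inv (P a) (2 * i) < N"
        using permutes_in_image[OF permutes_inv[OF P[OF that(1)]], of "2 * i"] that(2) by (simp add: N_def)
      then show ?thesis using permutes_inverses[OF P[OF that(1)]] by metis
    qed
    have 1: "derives D ?A (card {..<K} * (N * (0 + 0 + 1 + 1))) ?E"
    proof (rule derives_image)
      fix i assume i: "i \<in> {..<K}"
      then have "2 * i < N" by (simp add: N_def)
      then have "derives D ?A (N * (0 + 0 + 1 + 1)) {\<lambda>a. \<exists>j<N. P a j = 2 * i \<and> colour K (P a) j}"
        by (intro derives_ex derives_conj derives_wire M col A)
      then show "derives D ?A (N * (0 + 0 + 1 + 1)) {\<lambda>a. colour K (P a) (inv (P a) (2 * i))}"
        by (rule derives_cong) (use * i in simp)
    qed simp
    have 2: "derives D ?A (card {..<K} * (N * (0 + 0 + 1 + 1)))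
        ((\<lambda>i a. \<not> colour K (P a) (inv (P a) (2 * i))) ` {..<K})"
    proof (rule derives_image)
      fix i assume i: "i \<in> {..<K}"
      then have "2 * i < N" by (simp add: N_def)
      then have "derives D ?A (N * (0 + 0 + 1 + 1)) {\<lambda>a. \<exists>j<N. P a j = 2 * i \<and> \<not> colour K (P a) j}"
        by (intro derives_ex derives_conj derives_wire M col A)
      then show "derives D ?A (N * (0 + 0 + 1 + 1)) {\<lambda>a. \<not> colour K (P a) (inv (P a) (2 * i))}"
        by (rule derives_cong) (use * i in simp)
    qed simp
    show ?thesis
      using derives_Un[OF 1 2] by (simp add: dual_def image_image)
  qed
  let ?H = "\<lambda>c. onehot K (\<lambda>a. half K c (P a))"
  have H: "derives D ?A (K * K * 7) (?H c)" for c
  proof (rule derives_array)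
    fix i l assume il: "i < K" "l < K"
    then have lt: "2 * i < N" "Suc (2 * i) < N" "2 * l < N" "Suc (2 * l) < N"
      by (auto simp: N_def)
    let ?f = "\<lambda>b a. colour K (P a) (2 * i) = b"
    have f: "?f b \<in> ?A" for b using col[OF lt(1)] by (cases b) simp_all
    have "derives D ?A ((0 + (0 + 0 + 1) + 1) + (0 + (0 + 0 + 1) + 1) + 1)
       {\<lambda>a. (?f c a \<and> (P a (2 * i) = 2 * l \<or> P a (2 * i) = Suc (2 * l))) \<or>
            (?f (\<not> c) a \<and> (P a (Suc (2 * i)) = 2 * l \<or> P a (Suc (2 * i)) = Suc (2 * l)))}"
      by (intro derives_disj derives_conj derives_wire M f lt)
    then show "derives D ?A 7 {\<lambda>a. half K c (P a) i = l}"
    proof (rule derives_cong[OF derives_le])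
      have dl: "m div 2 = l \<longleftrightarrow> m = 2 * l \<or> m = Suc (2 * l)" for m by auto
      show "((?f c a \<and> (P a (2 * i) = 2 * l \<or> P a (2 * i) = Suc (2 * l))) \<or>
            (?f (\<not> c) a \<and> (P a (Suc (2 * i)) = 2 * l \<or> P a (Suc (2 * i)) = Suc (2 * l))))
         = (half K c (P a) i = l)" for a
        using il by (auto simp: half_def dl)
    qed simp
  qed
  have sub: "derives D ?A (K * K * 7 + 20 * K ^ 5) (control_wires k (\<lambda>a. half K c (P a)))" for c
  proof -
    have "derives D (constants \<union> ?H c) (20 * K ^ 5) (control_wires k (\<lambda>a. half K c (P a)))"
      using Suc.IH[of "\<lambda>a. half K c (P a)"] half_permutes[OF P] by (simp add: K_def)
    then have "derives D (?A \<union> ?H c) (20 * K ^ 5) (control_wires k (\<lambda>a. half K c (P a)))"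
      by (rule derives_source) blast
    from derives_trans[OF H this] show ?thesis .
  qed
  have "control_wires (Suc k) P \<subseteq> ?A \<union> dual ?E \<union>
      (control_wires k (\<lambda>a. half K True (P a)) \<union> control_wires k (\<lambda>a. half K False (P a)))"
  proof -
    have "dual ((\<lambda>i a. colour K (P a) (2 * i)) ` {..<K}) \<subseteq> ?C"
      by (auto simp: dual_def N_def)
    moreover have "(\<Union>c. control_wires k (\<lambda>a. half K c (P a)))
      = control_wires k (\<lambda>a. half K True (P a)) \<union> control_wires k (\<lambda>a. half K False (P a))"
      by (auto simp: UNIV_bool)
    ultimately show ?thesis unfolding control_wires_Suc K_def[symmetric] by blast
  qed
  then have "derives D ?S (12 * N ^ 5 + (card {..<K} * (N * (0 + 0 + 1 + 1)) + card {..<K} * (N * (0 + 0 + 1 + 1))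
      + (K * K * 7 + 20 * K ^ 5 + (K * K * 7 + 20 * K ^ 5)))) (control_wires (Suc k) P)"
    by (intro derives_mono[OF derives_trans[OF C derives_keep[OF
        derives_Un[OF E derives_Un[OF sub[of True] sub[of False]]]]]]) auto
  moreover have "12 * N ^ 5 + (card {..<K} * (N * (0 + 0 + 1 + 1)) + card {..<K} * (N * (0 + 0 + 1 + 1))
      + (K * K * 7 + 20 * K ^ 5 + (K * K * 7 + 20 * K ^ 5))) \<le> 20 * N ^ 5"
  proof -
    have "K ^ 2 \<le> K ^ 5" by (intro power_increasing) (simp_all add: K_def)
    then show ?thesis by (simp add: N_def power_mult_distrib power2_eq_square algebra_simps)
  qed
  ultimately have "derives D ?S (20 * N ^ 5) (control_wires (Suc k) P)" by (rule derives_le)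
  then show ?case by (simp add: N_def K_def)
qed

section \<open>Routing along partial permutation matrices\<close>

definition mprod :: "nat \<Rightarrow> (nat \<Rightarrow> nat \<Rightarrow> 'a \<Rightarrow> bool) \<Rightarrow> (nat \<Rightarrow> nat \<Rightarrow> 'a \<Rightarrow> bool) \<Rightarrow> nat \<Rightarrow> nat \<Rightarrow> 'a \<Rightarrow> bool" where
  "mprod N G x j b a \<longleftrightarrow> (\<exists>u<N. G j u a \<and> x u b a)"

text \<open>Rows and columns may be empty: the slots of the sorting scheme are not all occupied, and
  sizes are padded to powers of two.\<close>

definition partial_perm :: "nat \<Rightarrow> (nat \<Rightarrow> nat \<Rightarrow> 'a \<Rightarrow> bool) \<Rightarrow> 'a \<Rightarrow> bool" where
  "partial_perm N G a \<longleftrightarrow>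
     (\<forall>j<N. \<forall>u<N. \<forall>v<N. G j u a \<longrightarrow> G j v a \<longrightarrow> u = v) \<and>
     (\<forall>i<N. \<forall>j<N. \<forall>u<N. G i u a \<longrightarrow> G j u a \<longrightarrow> i = j)"

lemma partial_permI:
  assumes "\<And>j u v. j < N \<Longrightarrow> u < N \<Longrightarrow> v < N \<Longrightarrow> G j u a \<Longrightarrow> G j v a \<Longrightarrow> u = v"
    and "\<And>i j u. i < N \<Longrightarrow> j < N \<Longrightarrow> u < N \<Longrightarrow> G i u a \<Longrightarrow> G j u a \<Longrightarrow> i = j"
  shows "partial_perm N G a"
  using assms unfolding partial_perm_def by blast

lemma partial_permD:
  assumes "partial_perm N G a"
  shows "j < N \<Longrightarrow> u < N \<Longrightarrow> v < N \<Longrightarrow> G j u a \<Longrightarrow> G j v a \<Longrightarrow> u = v"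
    and "i < N \<Longrightarrow> j < N \<Longrightarrow> u < N \<Longrightarrow> G i u a \<Longrightarrow> G j u a \<Longrightarrow> i = j"
  using assms unfolding partial_perm_def by blast+

text \<open>
  Routing \<open>p\<close>-bit columns costs \<open>c * p * (k + 1) * 2 ^ k\<close> gates on the data and \<open>h k\<close> gates of control.
\<close>

definition router :: "'a set \<Rightarrow> nat \<Rightarrow> (nat \<Rightarrow> nat) \<Rightarrow> bool" where
  "router D c h \<longleftrightarrow>
     (\<forall>k p G x. (\<forall>a\<in>D. partial_perm (2 ^ k) G a) \<longrightarrow>
        derives D (constants \<union> dual (array (2 ^ k) (2 ^ k) G) \<union> array (2 ^ k) p x)
          (c * p * (k + 1) * 2 ^ k + h k) (array (2 ^ k) p (mprod (2 ^ k) G x)))"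

lemma permutation_of_relation:
  assumes "\<And>j. j < m \<Longrightarrow> \<exists>l<m. R j l"
    and "\<And>j l l'. j < m \<Longrightarrow> l < m \<Longrightarrow> l' < m \<Longrightarrow> R j l \<Longrightarrow> R j l' \<Longrightarrow> l = l'"
    and "\<And>j j' l. j < m \<Longrightarrow> j' < m \<Longrightarrow> l < m \<Longrightarrow> R j l \<Longrightarrow> R j' l \<Longrightarrow> j = j'"
  shows "\<exists>P. P permutes {..<m::nat} \<and> (\<forall>j<m. \<forall>l<m. P j = l \<longleftrightarrow> R j l)"
proof -
  define P where "P j = (if j < m then SOME l. l < m \<and> R j l else j)" for j
  have P: "P j < m \<and> R j (P j)" if "j < m" for j
    using someI_ex[of "\<lambda>l. l < m \<and> R j l"] assms(1)[OF that] that by (simp add: P_def)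
  have "inj_on P {..<m}"
    by (rule inj_onI) (metis P assms(3) lessThan_iff)
  moreover have "P ` {..<m} \<subseteq> {..<m}" using P by auto
  ultimately have "bij_betw P {..<m} {..<m}" by (simp add: bij_betw_def endo_inj_surj)
  then have "P permutes {..<m}" by (rule bij_imp_permutes) (simp add: P_def)
  moreover have "\<forall>j<m. \<forall>l<m. P j = l \<longleftrightarrow> R j l" using P assms(2) by metis
  ultimately show ?thesis by blast
qed

text \<open>
  A partial permutation matrix \<open>G\<close> of size \<open>N\<close> extends to the permutation matrix
  \<open>((G, E), (E', G\<^sup>T))\<close> of size \<open>2 * N\<close>, where \<open>E\<close> and \<open>E'\<close> are diagonal and mark the empty rows and
  the empty columns of \<open>G\<close>.
\<close>

definition completion :: "nat \<Rightarrow> (nat \<Rightarrow> nat \<Rightarrow> 'a \<Rightarrow> bool) \<Rightarrow> nat \<Rightarrow> nat \<Rightarrow> 'a \<Rightarrow> bool" where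
  "completion N G j l a =
     (if j < N then if l < N then G j l a else l = N + j \<and> (\<forall>u<N. \<not> G j u a)
      else if l < N then j = N + l \<and> (\<forall>i<N. \<not> G i l a) else G (l - N) (j - N) a)"

lemma completion_permutation:
  assumes "partial_perm N G a"
  shows "\<exists>P. P permutes {..<2 * N} \<and> (\<forall>j<2*N. \<forall>l<2*N. P j = l \<longleftrightarrow> completion N G j l a)"
proof (rule permutation_of_relation)
  note G = partial_permD[OF assms]
  have sub: "m - N < N" if "m < 2 * N" for m using that by linarith
  show "\<exists>l<2 * N. completion N G j l a" if "j < 2 * N" for j
  proof (cases "j < N")
    case True
    show ?thesis
    proof (cases "\<exists>u<N. G j u a")
      case u: True
      then show ?thesis using True unfolding completion_def by force
    next
      case False
      then show ?thesis using True by (intro exI[of _ "N + j"]) (simp add: completion_def)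
    qed
  next
    case False
    show ?thesis
    proof (cases "\<exists>i<N. G i (j - N) a")
      case True
      then obtain i where "i < N" "G i (j - N) a" by blast
      then show ?thesis using False by (intro exI[of _ "N + i"]) (simp add: completion_def)
    next
      case none: False
      have "j - N < N" using False that by linarith
      then show ?thesis using False that none by (intro exI[of _ "j - N"]) (simp add: completion_def)
    qed
  qed
  show "l = l'" if "j < 2 * N" "l < 2 * N" "l' < 2 * N" "completion N G j l a" "completion N G j l' a" for j l l'
    using that G(1)[of j l l'] G(2)[of "l - N" "l' - N" "j - N"]
    unfolding completion_def by (auto simp: sub eq_diff_iff split: if_splits)
  show "j = j'" if "j < 2 * N" "j' < 2 * N" "l < 2 * N" "completion N G j l a" "completion N G j' l a" for j j' l
    using that G(2)[of j j' l] G(1)[of "l - N" "j - N" "j' - N"]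
    unfolding completion_def by (auto simp: sub eq_diff_iff split: if_splits)
qed

text \<open>The completion doubles the size and adds a level, so
  \<open>6 * p * (k + 1) * 2 ^ (k + 1)\<close> gives the 12. On the control side
  \<open>20 * (2 * N) ^ 5\<close> gives 640, and the emptiness tests of the completion add at most
  4.\<close>

lemma router_benes: "router D 12 (\<lambda>k. 644 * (2 ^ k) ^ 5)"
  unfolding router_def
proof (intro allI impI)
  fix k p :: nat and G x :: "nat \<Rightarrow> nat \<Rightarrow> 'a \<Rightarrow> bool"
  define N :: nat where "N = 2 ^ k"
  assume "\<forall>a\<in>D. partial_perm (2 ^ k) G a"
  then have G: "partial_perm N G a" if "a \<in> D" for a using that by (simp add: N_def)
  define P where "P a = (SOME P. P permutes {..<2 * N} \<and> (\<forall>j<2*N. \<forall>l<2*N. P j = l \<longleftrightarrow> completion N G j l a))" for a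
  have P: "P a permutes {..<2 * N}" "j < 2 * N \<Longrightarrow> l < 2 * N \<Longrightarrow> P a j = l \<longleftrightarrow> completion N G j l a"
    if "a \<in> D" for a j l
    using someI_ex[OF completion_permutation[OF G[OF that]]] unfolding P_def by blast+
  let ?A = "constants \<union> dual (array N N G) \<union> array N p x"
  have mem: "G j u \<in> ?A" "(\<lambda>a. \<not> G j u a) \<in> ?A" if "j < N" "u < N" for j u
    using dual_array_memI[OF that] by blast+
  have A: "constants \<subseteq> ?A" by blast
  have M: "derives D ?A (2 * N * (2 * N) * (N * (0 + 1))) (onehot (2 * N) P)"
  proof (rule derives_array)
    fix j l assume jl: "j < 2 * N" "l < 2 * N"
    have "derives D ?A (N * (0 + 1)) {completion N G j l}"
    proof (cases "j < N")
      case True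
      show ?thesis
      proof (cases "l < N")
        case l: True
        have "completion N G j l = G j l" using True l by (auto simp: completion_def)
        then show ?thesis
          using derives_le[OF derives_wire[OF mem(1)[OF True l]]] by simp
      next
        case False
        have "completion N G j l = (\<lambda>a. l = N + j \<and> (\<forall>u<N. \<not> G j u a))"
          using True False by (auto simp: completion_def)
        then show ?thesis
          by (simp only:) (intro derives_guard_conj derives_all derives_wire mem A True)
      qed
    next
      case False
      then have j: "j - N < N" using jl by auto
      show ?thesis
      proof (cases "l < N")
        case l: True
        have "completion N G j l = (\<lambda>a. j = N + l \<and> (\<forall>i<N. \<not> G i l a))"
          using False l by (auto simp: completion_def)
        then show ?thesis
          by (simp only:) (intro derives_guard_conj derives_all derives_wire mem A l)
      next
        case l: False
        then have lN: "l - N < N" using jl by auto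
        have "completion N G j l = G (l - N) (j - N)" using False l by (auto simp: completion_def)
        then show ?thesis
          using derives_le[OF derives_wire[OF mem(1)[OF lN j]]] by simp
      qed
    qed
    then show "derives D ?A (N * (0 + 1)) {\<lambda>a. P a j = l}"
      by (rule derives_cong) (use P jl in simp)
  qed
  have two: "2 * N = 2 ^ Suc k" by (simp add: N_def)
  have "derives D (constants \<union> onehot (2 * N) P) (20 * (2 * N) ^ 5) (control_wires (Suc k) P)"
    unfolding two by (rule derives_controls) (use P(1) in \<open>simp add: two\<close>)
  then have C: "derives D (?A \<union> onehot (2 * N) P) (20 * (2 * N) ^ 5) (control_wires (Suc k) P)"
    by (rule derives_source) blast
  \<comment> \<open>The added inputs carry \<open>False\<close>, which is what an empty row of
    \<open>G\<close> has to deliver.\<close>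
  let ?x = "\<lambda>u b. if u < N then x u b else (\<lambda>_. False)"
  let ?Y = "array (2 * N) p (\<lambda>j b a. ?x (P a j) b a)"
  have "derives D (array (2 * N) p ?x \<union> control_wires (Suc k) P) (6 * p * Suc k * (2 * N)) ?Y"
    unfolding two by (rule derives_benes) (use P(1) in \<open>simp add: two\<close>)
  then have Y: "derives D (?A \<union> control_wires (Suc k) P) (6 * p * Suc k * (2 * N)) ?Y"
  proof (rule derives_source)
    have "?x u b \<in> ?A" if "b < p" for u b
      using that array_memI[of u N b p x] by (auto simp: constants_def)
    then have "array (2 * N) p ?x \<subseteq> ?A" unfolding array_def by blast
    then show "array (2 * N) p ?x \<union> control_wires (Suc k) P \<subseteq> ?A \<union> control_wires (Suc k) P" by blast
  qed
  have Z: "derives D (?A \<union> ?Y) 0 (array N p (mprod N G x))"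
  proof (rule derives_base)
    fix f assume "f \<in> array N p (mprod N G x)"
    then obtain j b where jb: "j < N" "b < p" "f = mprod N G x j b" by (auto simp: array_def)
    have "f a = ?x (P a j) b a" if "a \<in> D" for a
    proof -
      have lt: "P a j < 2 * N" using permutes_in_image[OF P(1)[OF that], of j] jb(1) by simp
      have G': "P a j = u \<longleftrightarrow> G j u a" if "u < N" for u
        using P(2)[OF \<open>a \<in> D\<close>, of j u] jb(1) that by (simp add: completion_def)
      show ?thesis
        using G' by (auto simp: jb(3) mprod_def)
    qed
    moreover have "(\<lambda>a. ?x (P a j) b a) \<in> ?A \<union> ?Y"
      using array_memI[of j "2 * N" b p "\<lambda>j b a. ?x (P a j) b a"] jb by simp
    ultimately show "\<exists>g\<in>?A \<union> ?Y. \<forall>a\<in>D. f a = g a"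
      by (intro bexI[of "\<lambda>g. \<forall>a\<in>D. f a = g a" "\<lambda>a. ?x (P a j) b a"] ballI)
  qed
  have "derives D ?A (2 * N * (2 * N) * (N * (0 + 1)) + 20 * (2 * N) ^ 5 + (6 * p * Suc k * (2 * N) + 0))
      (array N p (mprod N G x))"
    by (rule derives_trans[OF derives_trans[OF M C] derives_trans[OF Y]])
       (rule derives_source[OF Z], blast)
  moreover have "2 * N * (2 * N) * (N * (0 + 1)) + 20 * (2 * N) ^ 5 + (6 * p * Suc k * (2 * N) + 0)
     \<le> 12 * p * (k + 1) * N + 644 * N ^ 5"
  proof -
    have "2 * N * (2 * N) * (N * (0 + 1)) = 4 * N ^ 3" by (simp add: power3_eq_cube)
    moreover have "N ^ 3 \<le> N ^ 5" by (intro power_increasing) (simp_all add: N_def)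
    moreover have "20 * (2 * N) ^ 5 = 640 * N ^ 5" by (simp add: power_mult_distrib)
    moreover have "6 * p * Suc k * (2 * N) + 0 = 12 * p * (k + 1) * N" by simp
    ultimately show ?thesis by linarith
  qed
  ultimately have "derives D ?A (12 * p * (k + 1) * N + 644 * N ^ 5) (array N p (mprod N G x))"
    by (rule derives_le)
  then show "derives D (constants \<union> dual (array (2 ^ k) (2 ^ k) G) \<union> array (2 ^ k) p x)
      (12 * p * (k + 1) * 2 ^ k + 644 * (2 ^ k) ^ 5) (array (2 ^ k) p (mprod (2 ^ k) G x))"
    by (simp only: N_def)
qed

lemma derives_router:
  assumes "router D c h" "\<And>a. a \<in> D \<Longrightarrow> partial_perm (2 ^ k) G a"
    and "constants \<subseteq> A" "dual (array (2 ^ k) (2 ^ k) G) \<subseteq> A" "array (2 ^ k) p x \<subseteq> A"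
  shows "derives D A (c * p * (k + 1) * 2 ^ k + h k) (array (2 ^ k) p (mprod (2 ^ k) G x))"
proof -
  have "derives D (constants \<union> dual (array (2 ^ k) (2 ^ k) G) \<union> array (2 ^ k) p x)
          (c * p * (k + 1) * 2 ^ k + h k) (array (2 ^ k) p (mprod (2 ^ k) G x))"
    using assms(1,2) unfolding router_def by blast
  then show ?thesis by (rule derives_source) (use assms in blast)
qed

text \<open>An empty output reads \<open>False\<close> on the bits and on the negated bits alike, hence the correction
  by the emptiness of a row.\<close>

lemma derives_router_dual:
  assumes R: "router D c h" and G: "\<And>a. a \<in> D \<Longrightarrow> partial_perm (2 ^ k) G a"
    and A: "constants \<subseteq> A" "dual (array (2 ^ k) (2 ^ k) G) \<subseteq> A" "dual (array (2 ^ k) p x) \<subseteq> A"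
  shows "derives D A (2 * (c * p * (k + 1) * 2 ^ k + h k) + (2 ^ k) ^ 2 + 2 ^ k * p)
           (dual (array (2 ^ k) p (mprod (2 ^ k) G x)))"
proof -
  define N :: nat where "N = 2 ^ k"
  let ?x = "\<lambda>u b a. \<not> x u b a"
  let ?Y = "array N p (mprod N G x)" and ?Y' = "array N p (mprod N G ?x)"
  let ?E = "array N 1 (\<lambda>j i a. \<forall>u<N. \<not> G j u a)"
  have 1: "derives D A (c * p * (k + 1) * N + h k) ?Y"
    unfolding N_def by (rule derives_router[OF R G A(1,2)]) (use A in \<open>auto simp: dual_def\<close>)
  have 2: "derives D A (c * p * (k + 1) * N + h k) ?Y'"
    unfolding N_def
  proof (rule derives_router[OF R G A(1,2)])
    have "array (2 ^ k) p (\<lambda>u b a. \<not> x u b a) \<subseteq> dual (array (2 ^ k) p x)"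
      unfolding array_def dual_def by blast
    then show "array (2 ^ k) p (\<lambda>u b a. \<not> x u b a) \<subseteq> A" using A(3) by blast
  qed
  have 3: "derives D A (N * 1 * (N * (0 + 1))) ?E"
  proof (rule derives_array)
    fix j i assume "j < N"
    then show "derives D A (N * (0 + 1)) {\<lambda>a. \<forall>u<N. \<not> G j u a}"
      using A(1,2) dual_array_memI[of j N _ N G]
      by (intro derives_all derives_wire) (auto simp: N_def)
  qed
  let ?A = "A \<union> (?Y \<union> (?Y' \<union> ?E))"
  have 4: "derives D ?A (N * p * (0 + (0 + 0 + 1))) (dual ?Y)"
  proof (rule derives_dual_array)
    fix j b assume jb: "j < N" "b < p"
    show "derives D ?A 0 {mprod N G x j b}"
      by (rule derives_wire) (use array_memI[OF jb] in blast)
    have "derives D ?A (0 + 0 + 1) {\<lambda>a. mprod N G ?x j b a \<or> (\<forall>u<N. \<not> G j u a)}"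
    proof (intro derives_disj derives_wire)
      show "mprod N G ?x j b \<in> ?A" using array_memI[OF jb] by blast
      show "(\<lambda>a. \<forall>u<N. \<not> G j u a) \<in> ?A"
        using array_memI[of j N 0 1 "\<lambda>j i a. \<forall>u<N. \<not> G j u a"] jb(1) by simp
    qed
    then show "derives D ?A (0 + 0 + 1) {\<lambda>a. \<not> mprod N G x j b a}"
    proof (rule derives_cong)
      fix a assume "a \<in> D"
      then show "(mprod N G ?x j b a \<or> (\<forall>u<N. \<not> G j u a)) = (\<not> mprod N G x j b a)"
        using partial_permD(1)[OF G[folded N_def], of a j] jb(1) unfolding mprod_def by blast
    qed
  qed
  show ?thesis
    using derives_le[OF derives_trans[OF derives_Un[OF 1 derives_Un[OF 2 3]] 4],
      of "2 * (c * p * (k + 1) * 2 ^ k + h k) + (2 ^ k) ^ 2 + 2 ^ k * p"]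
    by (simp add: N_def power2_eq_square)
qed

section \<open>Routing by sorting, dealing and sorting again\<close>

text \<open>Sorting and compaction by counting: the marked position \<open>i\<close> moves to place
  \<open>rk f i\<close>.\<close>

definition rk :: "(nat \<Rightarrow> bool) \<Rightarrow> nat \<Rightarrow> nat" where
  "rk f i = card {j. j < i \<and> f j}"

lemma rk_0 [simp]: "rk f 0 = 0"
  by (simp add: rk_def)

lemma rk_Suc: "rk f (Suc i) = (if f i then Suc (rk f i) else rk f i)"
proof -
  have "{j. j < Suc i \<and> f j} = (if f i then insert i {j. j < i \<and> f j} else {j. j < i \<and> f j})"
    by (auto simp: less_Suc_eq)
  then show ?thesis by (simp add: rk_def)
qed

lemma rk_mono: "i \<le> j \<Longrightarrow> rk f i \<le> rk f j"
  by (induction j rule: dec_induct) (auto simp: rk_Suc)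

lemma rk_less: "f i \<Longrightarrow> i < j \<Longrightarrow> rk f i < rk f j"
  using rk_mono[of "Suc i" j f] by (simp add: rk_Suc Suc_le_eq)

lemma rk_inj: "f i \<Longrightarrow> f j \<Longrightarrow> rk f i = rk f j \<Longrightarrow> i = j"
  using rk_less[of f i j] rk_less[of f j i] by linarith

text \<open>Ranks leave no gaps. This is why the items of one block become an interval of places
  after sorting.\<close>

lemma rk_image: "lo \<le> hi \<Longrightarrow> rk f ` {i. lo \<le> i \<and> i < hi \<and> f i} = {rk f lo..<rk f hi}"
proof (induction hi rule: dec_induct)
  case base
  then show ?case by auto
next
  case (step hi)
  have "{i. lo \<le> i \<and> i < Suc hi \<and> f i}
      = {i. lo \<le> i \<and> i < hi \<and> f i} \<union> (if f hi then {hi} else {})"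
    using step.hyps by (auto simp: less_Suc_eq)
  then have "rk f ` {i. lo \<le> i \<and> i < Suc hi \<and> f i}
      = {rk f lo..<rk f hi} \<union> (if f hi then {rk f hi} else {})"
    using step.IH by auto
  also have "\<dots> = {rk f lo..<rk f (Suc hi)}"
    using rk_mono[OF step.hyps(1), of f] by (auto simp: rk_Suc)
  finally show ?case .
qed

text \<open>Elements of one residue class that lie in the same window of length \<open>s\<close>
  coincide, so the window number \<open>(v - \<alpha>) div s\<close> is injective.\<close>

lemma card_residue_interval:
  fixes \<alpha> L s c :: nat
  assumes "0 < s"
  shows "card {v. \<alpha> \<le> v \<and> v < \<alpha> + L \<and> v mod s = c} \<le> L div s + 1"
proof -
  let ?V = "{v. \<alpha> \<le> v \<and> v < \<alpha> + L \<and> v mod s = c}"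
  have "inj_on (\<lambda>v. (v - \<alpha>) div s) ?V"
  proof (rule inj_onI)
    have *: "v = v'" if "v \<in> ?V" "v' \<in> ?V" "(v - \<alpha>) div s = (v' - \<alpha>) div s" "v \<le> v'" for v v'
    proof -
      have "v' - v < s"
      proof -
        have "v' - \<alpha> = (v - \<alpha>) div s * s + (v' - \<alpha>) mod s"
          unfolding that(3) by simp
        moreover have "(v - \<alpha>) div s * s \<le> v - \<alpha>" "(v' - \<alpha>) mod s < s"
          using assms by simp_all
        ultimately have "v' - \<alpha> < v - \<alpha> + s" by linarith
        then show ?thesis using that by auto
      qed
      moreover have "s dvd v' - v"
        using that mod_eq_dvd_iff_nat[of v v' s] by simp
      ultimately have "v' - v = 0" by (meson nat_dvd_not_less neq0_conv)
      then show ?thesis using that by simp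
    qed
    show "v = v'" if "v \<in> ?V" "v' \<in> ?V" "(v - \<alpha>) div s = (v' - \<alpha>) div s" for v v'
      using *[of v v'] *[of v' v] that by (metis nat_le_linear)
  qed
  moreover have "(\<lambda>v. (v - \<alpha>) div s) ` ?V \<subseteq> {..L div s}"
    by (auto intro!: div_le_mono)
  ultimately have "card ?V \<le> card {..L div s}" by (intro card_inj_on_le) auto
  then show ?thesis by simp
qed

lemma sum_div_le: "(\<Sum>i\<in>I. f i div s) \<le> (\<Sum>i\<in>I. f i) div (s::nat)"
proof (cases "s = 0")
  case False
  have "(\<Sum>i\<in>I. f i div s) * s \<le> (\<Sum>i\<in>I. f i)"
    unfolding sum_distrib_right by (intro sum_mono) simp
  then show ?thesis using False by (simp add: less_eq_div_iff_mult_less_eq)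
qed simp

lemma block_less:
  fixes b v s r :: nat
  assumes "b < s" "v < r"
  shows "b * r + v < s * r"
proof -
  have "b * r + v < Suc b * r" using assms by simp
  also have "\<dots> \<le> s * r" using assms by (intro mult_le_mono1) simp
  finally show ?thesis .
qed

lemma block_eq_iff:
  fixes b v c u r :: nat
  assumes "v < r" "u < r"
  shows "b * r + v = c * r + u \<longleftrightarrow> b = c \<and> v = u"
proof
  assume eq: "b * r + v = c * r + u"
  have "(b * r + v) div r = b" "(c * r + u) div r = c" "(b * r + v) mod r = v" "(c * r + u) mod r = u"
    using assms by auto
  then show "b = c \<and> v = u" using eq by metis
qed simp

text \<open>
  Item \<open>l\<close> sits at position \<open>l mod r\<close> of group \<open>l div r\<close>, and its target \<open>j\<close> (with \<open>G j l\<close>) is position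
  \<open>j mod r\<close> (relation \<open>V\<close>) of block \<open>j div r\<close> (relation \<open>B\<close>). \<open>G1\<close> sorts a group by block:
  the rank of an item is the number of pairs in \<open>F\<close> before it when the pairs of block and position
  are enumerated lexicographically. \<open>L1\<close> tells the blocks after sorting. \<open>dealt\<close> reads the groups that arise
  from sending place \<open>v\<close> to group \<open>v mod s\<close>. \<open>G2\<close> moves the \<open>i\<close>-th item of block \<open>b\<close> in a dealt group
  to slot \<open>b * W + i\<close>, and \<open>G3\<close> sends the slots collected for a block to their final positions.
\<close>

locale split =
  fixes s g r W :: nat and G :: "nat \<Rightarrow> nat \<Rightarrow> bool"
begin

definition B :: "nat \<Rightarrow> nat \<Rightarrow> bool" where
  "B l b \<longleftrightarrow> (\<exists>v<r. G (b * r + v) l)"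

definition V :: "nat \<Rightarrow> nat \<Rightarrow> bool" where
  "V l v \<longleftrightarrow> (\<exists>b<s. G (b * r + v) l)"

definition F :: "nat \<Rightarrow> nat \<Rightarrow> bool" where
  "F c i \<longleftrightarrow> B (c * r + i mod r) (i div r)"

definition G1 :: "nat \<Rightarrow> nat \<Rightarrow> nat \<Rightarrow> bool" where
  "G1 c v u \<longleftrightarrow> (\<exists>b<s. B (c * r + u) b \<and> rk (F c) (b * r + u) = v)"

definition L1 :: "nat \<Rightarrow> nat \<Rightarrow> nat \<Rightarrow> bool" where
  "L1 c v b \<longleftrightarrow> (\<exists>u<r. G1 c v u \<and> B (c * r + u) b)"

definition dealt :: "(nat \<Rightarrow> nat \<Rightarrow> 'b) \<Rightarrow> nat \<Rightarrow> nat \<Rightarrow> 'b" where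
  "dealt f d w = f (w div g) (w mod g * s + d)"

definition G2 :: "nat \<Rightarrow> nat \<Rightarrow> nat \<Rightarrow> bool" where
  "G2 d \<sigma> w \<longleftrightarrow> w < r \<and> dealt L1 d w (\<sigma> div W) \<and> rk (\<lambda>w. dealt L1 d w (\<sigma> div W)) w = \<sigma> mod W"

definition moved1 :: "(nat \<Rightarrow> bool) \<Rightarrow> nat \<Rightarrow> nat \<Rightarrow> bool" where
  "moved1 X c v \<longleftrightarrow> (\<exists>u<r. G1 c v u \<and> X (c * r + u))"

definition moved2 :: "(nat \<Rightarrow> bool) \<Rightarrow> nat \<Rightarrow> nat \<Rightarrow> bool" where
  "moved2 X d \<sigma> \<longleftrightarrow> (\<exists>w<r. G2 d \<sigma> w \<and> dealt (moved1 X) d w)"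

definition G3 :: "nat \<Rightarrow> nat \<Rightarrow> nat \<Rightarrow> bool" where
  "G3 b t \<tau> \<longleftrightarrow> t < r \<and> moved2 (\<lambda>l. V l t) (\<tau> div W) (b * W + \<tau> mod W)"

end

section \<open>Correctness of the three rounds on one fixed input\<close>

text \<open>\<open>s \<le> g\<close> amounts to \<open>s * s \<le> r\<close> and keeps the rounding
  errors of dealing within the slot width \<open>W\<close>. The unit argument brings the matrix at
  one input into the format of \<open>partial_perm\<close>.\<close>

locale split_perm = split +
  assumes s: "0 < s" "s \<le> g" and r: "r = s * g" and W: "W = 2 * g"
    and G: "partial_perm (s * r) (\<lambda>j l (_::unit). G j l) ()"
begin

lemma s_W: "s * W = 2 * r"
  by (simp add: r W)

lemma r_pos: "0 < r" and g_pos: "0 < g" and W_pos: "0 < W"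
  using s by (auto simp: r W)

lemma G_row: "j < s * r \<Longrightarrow> l < s * r \<Longrightarrow> l' < s * r \<Longrightarrow> G j l \<Longrightarrow> G j l' \<Longrightarrow> l = l'"
  and G_column: "j < s * r \<Longrightarrow> j' < s * r \<Longrightarrow> l < s * r \<Longrightarrow> G j l \<Longrightarrow> G j' l \<Longrightarrow> j = j'"
  using partial_permD[OF G] by blast+

lemma B_unique:
  assumes "l < s * r" "b < s" "b' < s" "B l b" "B l b'"
  shows "b = b'"
proof -
  obtain v v' where v: "v < r" "G (b * r + v) l" "v' < r" "G (b' * r + v') l"
    using assms unfolding B_def by blast
  then have "b * r + v = b' * r + v'"
    by (intro G_column[of _ _ l] block_less assms) auto
  then show ?thesis using v block_eq_iff[of v r v'] by simp
qed

text \<open>An item has at most one target, so block and position may be stored as separate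
  relations. Only the \<open>r\<close> bits of \<open>V\<close> will travel with the items; the
  block is read off the slot later.\<close>

lemma BV_iff:
  assumes "l < s * r" "b < s" "v < r"
  shows "B l b \<and> V l v \<longleftrightarrow> G (b * r + v) l"
proof
  assume *: "B l b \<and> V l v"
  obtain v' where v': "v' < r" "G (b * r + v') l" using * unfolding B_def by blast
  obtain b' where b': "b' < s" "G (b' * r + v) l" using * unfolding V_def by blast
  have "b * r + v' = b' * r + v"
    using v' b' assms by (intro G_column[of _ _ l] block_less) auto
  then have "b' = b" using v' assms block_eq_iff[of v' r v] by simp
  then show "G (b * r + v) l" using b' by simp
qed (use assms in \<open>auto simp: B_def V_def\<close>)

lemma item_less: "c < s \<Longrightarrow> u < r \<Longrightarrow> c * r + u < s * r"
  by (rule block_less)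

lemma F_iff: "u < r \<Longrightarrow> F c (b * r + u) \<longleftrightarrow> B (c * r + u) b"
  by (simp add: F_def)

text \<open>An item has at most one block, so \<open>F c\<close> marks at most one pair for each of
  the \<open>r\<close> positions, and all ranks of items are places of the group.\<close>

lemma rk_F_less:
  assumes "c < s" "u < r" "b < s" "B (c * r + u) b"
  shows "rk (F c) (b * r + u) < r"
proof -
  have "rk (F c) (b * r + u) < rk (F c) (s * r)"
    by (rule rk_less) (use assms in \<open>auto simp: F_iff intro: block_less\<close>)
  also have "rk (F c) (s * r) \<le> card {..<r}"
    unfolding rk_def
  proof (rule card_inj_on_le[where f = "\<lambda>i. i mod r"])
    show "inj_on (\<lambda>i. i mod r) {j. j < s * r \<and> F c j}"
    proof (rule inj_onI)
      fix i j assume ij: "i \<in> {j. j < s * r \<and> F c j}" "j \<in> {j. j < s * r \<and> F c j}" "i mod r = j mod r"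
      then have "i div r < s" "j div r < s" by (simp_all add: less_mult_imp_div_less)
      moreover have "c * r + i mod r < s * r" using assms(1) r_pos by (intro item_less) simp_all
      ultimately have "i div r = j div r"
        using ij B_unique[of "c * r + i mod r" "i div r" "j div r"] by (simp add: F_def)
      then show "i = j" using ij(3) by (metis div_mult_mod_eq)
    qed
  qed (use r_pos in auto)
  finally show ?thesis by simp
qed

lemma G1E:
  assumes "G1 c v u"
  obtains b where "b < s" "B (c * r + u) b" "rk (F c) (b * r + u) = v"
  using assms unfolding G1_def by blast

lemma G1_row:
  assumes "c < s" "u < r" "u' < r" "G1 c v u" "G1 c v u'"
  shows "u = u'"
proof -
  obtain b where b: "b < s" "B (c * r + u) b" "rk (F c) (b * r + u) = v"
    using assms(4) by (rule G1E)
  obtain b' where b': "b' < s" "B (c * r + u') b'" "rk (F c) (b' * r + u') = v"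
    using assms(5) by (rule G1E)
  have "F c (b * r + u)" "F c (b' * r + u')" using b b' F_iff assms by auto
  then have "b * r + u = b' * r + u'" by (rule rk_inj) (simp only: b b')
  then show ?thesis using assms block_eq_iff[of u r u'] by simp
qed

lemma G1_column:
  assumes "c < s" "u < r" "G1 c v u" "G1 c v' u"
  shows "v = v'"
proof -
  obtain b where b: "b < s" "B (c * r + u) b" "rk (F c) (b * r + u) = v"
    using assms(3) by (rule G1E)
  obtain b' where b': "b' < s" "B (c * r + u) b'" "rk (F c) (b' * r + u) = v'"
    using assms(4) by (rule G1E)
  have "b = b'" using B_unique[of "c * r + u" b b'] item_less[of c u] assms b b' by simp
  then show ?thesis using b b' by simp
qed

lemma partial_perm_G1: "c < s \<Longrightarrow> partial_perm r (\<lambda>v u a. G1 c v u) a"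
  by (rule partial_permI; elim G1_row G1_column; assumption)

definition At1 :: "nat \<Rightarrow> nat \<Rightarrow> nat \<Rightarrow> bool" where
  "At1 c v l \<longleftrightarrow> (\<exists>u<r. G1 c v u \<and> l = c * r + u)"

lemma moved1_iff: "moved1 X c v \<longleftrightarrow> (\<exists>l. At1 c v l \<and> X l)"
  by (auto simp: moved1_def At1_def)

lemma At1_less: "c < s \<Longrightarrow> At1 c v l \<Longrightarrow> l < s * r"
  by (auto simp: At1_def intro: item_less)

lemma At1E:
  assumes "At1 c v l"
  obtains u where "u < r" "G1 c v u" "l = c * r + u"
  using assms unfolding At1_def by blast

lemma At1_item:
  assumes "c < s" "At1 c v l" "At1 c v l'"
  shows "l = l'"
proof -
  obtain u where u: "u < r" "G1 c v u" "l = c * r + u" using assms(2) by (rule At1E)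
  obtain u' where u': "u' < r" "G1 c v u'" "l' = c * r + u'" using assms(3) by (rule At1E)
  show ?thesis using G1_row[OF assms(1) u(1) u'(1) u(2) u'(2)] u u' by simp
qed

lemma At1_place:
  assumes "c < s" "At1 c v l" "At1 c' v' l"
  shows "c = c' \<and> v = v'"
proof -
  obtain u where u: "u < r" "G1 c v u" "l = c * r + u" using assms(2) by (rule At1E)
  obtain u' where u': "u' < r" "G1 c' v' u'" "l = c' * r + u'" using assms(3) by (rule At1E)
  have cu: "c' = c" "u' = u" using block_eq_iff[OF u(1) u'(1), of c c'] u(3) u'(3) by simp_all
  show ?thesis using G1_column[OF assms(1) u(1,2)] u'(2) cu by simp
qed

lemma At1_exists:
  assumes "l < s * r" "b < s" "B l b"
  obtains c v where "c < s" "v < r" "At1 c v l"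
proof -
  have c: "l div r < s" using assms(1) by (simp add: less_mult_imp_div_less)
  have u: "l mod r < r" using r_pos by simp
  have l: "l div r * r + l mod r = l" by simp
  let ?v = "rk (F (l div r)) (b * r + l mod r)"
  have "?v < r" by (rule rk_F_less[OF c u assms(2)]) (simp only: l assms(3))
  moreover have "At1 (l div r) ?v l"
    unfolding At1_def G1_def using u l assms(2,3) by (intro exI[of _ "l mod r"]) auto
  ultimately show thesis using that c by blast
qed

lemma L1_exists:
  assumes "L1 c v b"
  obtains l where "At1 c v l" "B l b"
  using assms unfolding L1_def At1_def by blast

lemma L1_iff:
  assumes "c < s" "At1 c v l"
  shows "L1 c v b \<longleftrightarrow> B l b"
proof
  assume "L1 c v b"
  then obtain l' where "At1 c v l'" "B l' b" by (rule L1_exists)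
  then show "B l b" using At1_item[OF assms, of l'] by simp
next
  assume "B l b"
  then show "L1 c v b" using assms(2) unfolding L1_def At1_def by blast
qed

lemma L1_unique:
  assumes "c < s" "b < s" "b' < s" "L1 c v b" "L1 c v b'"
  shows "b = b'"
proof -
  obtain l where l: "At1 c v l" "B l b" using assms(4) by (rule L1_exists)
  show ?thesis
    using B_unique[OF At1_less[OF assms(1) l(1)] assms(2,3) l(2)] L1_iff[OF assms(1) l(1)] assms(5) by simp
qed

text \<open>The items of block \<open>b\<close> in group \<open>c\<close> are ranked consecutively
  and fill an interval of places; a residue class takes at most an equal share of it, rounded down,
  plus one.\<close>

lemma card_L1_residue:
  assumes "c < s" "b < s"
  shows "card {v. L1 c v b \<and> v mod s = d} \<le> card {u. u < r \<and> B (c * r + u) b} div s + 1"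
proof -
  let ?I = "{i. b * r \<le> i \<and> i < Suc b * r \<and> F c i}"
  let ?U = "{u. u < r \<and> B (c * r + u) b}"
  have I: "?I = (\<lambda>u. b * r + u) ` ?U"
  proof (intro equalityI subsetI)
    fix i assume i: "i \<in> ?I"
    then have "i = b * r + (i - b * r)" "i - b * r < r" by auto
    then show "i \<in> (\<lambda>u. b * r + u) ` ?U"
      using i F_iff[of "i - b * r" c b] by (intro image_eqI[of _ _ "i - b * r"]) simp_all
  qed (auto simp: F_iff)
  have mem: "L1 c v b \<longleftrightarrow> v \<in> rk (F c) ` ?I" for v
  proof
    assume "L1 c v b"
    then obtain u where u: "u < r" "G1 c v u" "B (c * r + u) b" unfolding L1_def by blast
    obtain b' where b': "b' < s" "B (c * r + u) b'" "rk (F c) (b' * r + u) = v"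
      using u(2) by (rule G1E)
    then have "b' = b" using B_unique[of "c * r + u" b' b] item_less assms u by blast
    then show "v \<in> rk (F c) ` ?I" using u b' unfolding I by auto
  next
    assume "v \<in> rk (F c) ` ?I"
    then show "L1 c v b" using assms(2) unfolding I L1_def G1_def by blast
  qed
  have img: "rk (F c) ` ?I = {rk (F c) (b * r)..<rk (F c) (Suc b * r)}"
    by (rule rk_image) simp
  have "card (rk (F c) ` ?I) = card ?I"
    by (intro card_image inj_onI) (auto intro: rk_inj)
  also have "\<dots> = card ?U" unfolding I by (intro card_image) (auto simp: inj_on_def)
  finally have "rk (F c) (Suc b * r) - rk (F c) (b * r) = card ?U" unfolding img by simp
  moreover have "rk (F c) (b * r) \<le> rk (F c) (Suc b * r)" by (intro rk_mono) simp
  ultimately have L1: "L1 c v b \<longleftrightarrow> rk (F c) (b * r) \<le> v \<and> v < rk (F c) (b * r) + card ?U" for v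
    unfolding mem img atLeastLessThan_iff by linarith
  show ?thesis
    using card_residue_interval[OF s(1), of "rk (F c) (b * r)" "card ?U" d]
    by (simp add: L1 conj_assoc)
qed

text \<open>A target position of the block belongs to at most one item, so choosing the position is
  injective on the items of all groups together.\<close>

lemma card_block:
  assumes "b < s"
  shows "(\<Sum>c<s. card {u. u < r \<and> B (c * r + u) b}) \<le> r"
proof -
  let ?l = "\<lambda>(c, u). c * r + u"
  let ?S = "SIGMA c:{..<s}. {u. u < r \<and> B (c * r + u) b}"
  have "(\<Sum>c<s. card {u. u < r \<and> B (c * r + u) b}) = card ?S"
    by simp
  also have "\<dots> \<le> card {..<r}"
  proof (rule card_inj_on_le[where f = "\<lambda>p. SOME v. v < r \<and> G (b * r + v) (?l p)"])
    have *: "(SOME v. v < r \<and> G (b * r + v) (?l p)) < r \<and> G (b * r + (SOME v. v < r \<and> G (b * r + v) (?l p))) (?l p)"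
      if "p \<in> ?S" for p
      using that someI_ex[of "\<lambda>v. v < r \<and> G (b * r + v) (?l p)"] by (auto simp: B_def)
    show "inj_on (\<lambda>p. SOME v. v < r \<and> G (b * r + v) (?l p)) ?S"
    proof (rule inj_onI)
      fix p p' assume p: "p \<in> ?S" "p' \<in> ?S"
        and eq: "(SOME v. v < r \<and> G (b * r + v) (?l p)) = (SOME v. v < r \<and> G (b * r + v) (?l p'))"
      define v where "v = (SOME v. v < r \<and> G (b * r + v) (?l p))"
      have v: "v < r" "G (b * r + v) (?l p)" "G (b * r + v) (?l p')"
        using *[OF p(1)] *[OF p(2)] eq by (simp_all add: v_def)
      have "?l p = ?l p'"
        by (rule G_row[OF block_less[OF assms v(1)] _ _ v(2,3)]) (use p item_less in auto)
      then show "p = p'" using p by (auto simp: block_eq_iff)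
    qed
    show "(\<lambda>p. SOME v. v < r \<and> G (b * r + v) (?l p)) ` ?S \<subseteq> {..<r}"
      using * by blast
  qed simp
  finally show ?thesis by simp
qed

lemma dealt_place_less:
  assumes "w < r" "d < s"
  shows "w div g < s" "w mod g * s + d < r"
  using assms block_less[of "w mod g" g d s] g_pos by (auto simp: r less_mult_imp_div_less mult.commute)

text \<open>
  After sorting, a block occupies an interval of each group, hence every dealt group
  receives from an interval of length \<open>L\<close> at most \<open>L div s + 1\<close> items. This is what
  makes slots of the fixed width \<open>W\<close> sufficient.
\<close>

lemma card_dealt:
  assumes "d < s" "b < s"
  shows "card {w. w < r \<and> dealt L1 d w b} \<le> W"
proof -
  let ?S = "SIGMA c:{..<s}. {v. L1 c v b \<and> v mod s = d}"
  have fin: "finite {v. L1 c v b \<and> v mod s = d}" if "c < s" for c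
  proof (rule finite_subset)
    show "{v. L1 c v b \<and> v mod s = d} \<subseteq> {..<r}"
    proof (rule subsetI)
      fix v assume "v \<in> {v. L1 c v b \<and> v mod s = d}"
      then have "L1 c v b" by simp
      then obtain u where u: "u < r" "G1 c v u" unfolding L1_def by blast
      obtain b' where "b' < s" "B (c * r + u) b'" "rk (F c) (b' * r + u) = v"
        using u(2) by (rule G1E)
      with u(1) show "v \<in> {..<r}" using rk_F_less[OF that] by auto
    qed
  qed simp
  have "card {w. w < r \<and> dealt L1 d w b} \<le> card ?S"
  proof (rule card_inj_on_le[where f = "\<lambda>w. (w div g, w mod g * s + d)"])
    show "inj_on (\<lambda>w. (w div g, w mod g * s + d)) {w. w < r \<and> dealt L1 d w b}"
    proof (rule inj_onI)
      fix w w' assume "(w div g, w mod g * s + d) = (w' div g, w' mod g * s + d)"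
      then have "w div g = w' div g" "w mod g = w' mod g" using s(1) by auto
      then show "w = w'" by (metis div_mult_mod_eq)
    qed
    show "(\<lambda>w. (w div g, w mod g * s + d)) ` {w. w < r \<and> dealt L1 d w b} \<subseteq> ?S"
      using dealt_place_less(1) assms(1) by (auto simp: dealt_def)
    show "finite ?S" using fin by auto
  qed
  also have "card ?S = (\<Sum>c<s. card {v. L1 c v b \<and> v mod s = d})"
    using fin by simp
  also have "\<dots> \<le> (\<Sum>c<s. card {u. u < r \<and> B (c * r + u) b} div s + 1)"
    by (intro sum_mono card_L1_residue) (use assms in auto)
  also have "\<dots> = (\<Sum>c<s. card {u. u < r \<and> B (c * r + u) b} div s) + s"
    by (simp only: sum.distrib) simp
  also have "\<dots> \<le> r div s + s"
    using sum_div_le[of "\<lambda>c. card {u. u < r \<and> B (c * r + u) b}" s "{..<s}"] 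
      div_le_mono[OF card_block[OF assms(2)], of s] by linarith
  \<comment> \<open>Here \<open>s \<le> g\<close> enters: \<open>r div s\<close> is
    \<open>g\<close>, and the \<open>s\<close> roundings add at most another
    \<open>g\<close>.\<close>
  also have "\<dots> \<le> W" using s by (simp add: r W)
  finally show ?thesis .
qed

lemma slot_less: "b < s \<Longrightarrow> i < W \<Longrightarrow> b * W + i < 2 * r"
  using block_less[of b s i W] by (simp add: s_W)

lemma slot_div: "\<sigma> < 2 * r \<Longrightarrow> \<sigma> div W < s"
  by (rule less_mult_imp_div_less) (simp only: s_W)

lemma G2_row:
  assumes "G2 d \<sigma> w" "G2 d \<sigma> w'"
  shows "w = w'"
  using assms rk_inj[of "\<lambda>w. dealt L1 d w (\<sigma> div W)" w w'] by (simp add: G2_def)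

lemma G2_column:
  assumes "d < s" "\<sigma> < 2 * r" "\<sigma>' < 2 * r" "G2 d \<sigma> w" "G2 d \<sigma>' w"
  shows "\<sigma> = \<sigma>'"
proof -
  have "\<sigma> div W = \<sigma>' div W"
    using assms L1_unique[OF dealt_place_less(1)[of w d] slot_div slot_div]
    by (auto simp: G2_def dealt_def)
  moreover from this have "\<sigma> mod W = \<sigma>' mod W" using assms(4,5) by (simp add: G2_def)
  ultimately show ?thesis by (metis div_mult_mod_eq)
qed

lemma partial_perm_G2: "d < s \<Longrightarrow> partial_perm (2 * r) (\<lambda>\<sigma> w a. G2 d \<sigma> w) a"
  by (rule partial_permI; elim G2_row G2_column; assumption)

definition At2 :: "nat \<Rightarrow> nat \<Rightarrow> nat \<Rightarrow> bool" where
  "At2 d \<sigma> l \<longleftrightarrow> (\<exists>w<r. G2 d \<sigma> w \<and> dealt At1 d w l)"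

lemma moved2_iff: "moved2 X d \<sigma> \<longleftrightarrow> (\<exists>l. At2 d \<sigma> l \<and> X l)"
  unfolding moved2_def At2_def dealt_def moved1_iff by blast

lemma At2E:
  assumes "d < s" "At2 d \<sigma> l"
  obtains w where "w < r" "G2 d \<sigma> w" "w div g < s" "At1 (w div g) (w mod g * s + d) l"
  using assms dealt_place_less(1) unfolding At2_def dealt_def by blast

lemma At2_less:
  assumes "d < s" "At2 d \<sigma> l"
  shows "l < s * r"
  using assms by (rule At2E) (rule At1_less)

lemma At2_item:
  assumes "d < s" "At2 d \<sigma> l" "At2 d \<sigma> l'"
  shows "l = l'"
proof -
  obtain w where w: "w < r" "G2 d \<sigma> w" "w div g < s" "At1 (w div g) (w mod g * s + d) l"
    using assms(1,2) by (rule At2E)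
  obtain w' where w': "G2 d \<sigma> w'" "At1 (w' div g) (w' mod g * s + d) l'"
    using assms(1,3) by (rule At2E)
  have "w' = w" using G2_row[OF w'(1) w(2)] .
  then show ?thesis using At1_item[OF w(3,4)] w'(2) by simp
qed

lemma At2_place:
  assumes "d < s" "d' < s" "\<sigma> < 2 * r" "\<sigma>' < 2 * r" "At2 d \<sigma> l" "At2 d' \<sigma>' l"
  shows "d = d' \<and> \<sigma> = \<sigma>'"
proof -
  obtain w where w: "w < r" "G2 d \<sigma> w" "w div g < s" "At1 (w div g) (w mod g * s + d) l"
    using assms(1,5) by (rule At2E)
  obtain w' where w': "G2 d' \<sigma>' w'" "At1 (w' div g) (w' mod g * s + d') l"
    using assms(2,6) by (rule At2E)
  have eq: "w div g = w' div g" "w mod g * s + d = w' mod g * s + d'"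
    using At1_place[OF w(3,4) w'(2)] by auto
  then have d: "w mod g = w' mod g" "d = d'" using block_eq_iff[OF assms(1,2)] by simp_all
  then have "w = w'" using eq(1) by (metis div_mult_mod_eq)
  then show ?thesis using G2_column[OF assms(1,3,4) w(2)] w'(1) d(2) by simp
qed

lemma At2_block:
  assumes "d < s" "At2 d \<sigma> l"
  shows "B l (\<sigma> div W)"
proof -
  obtain w where w: "w < r" "G2 d \<sigma> w" "w div g < s" "At1 (w div g) (w mod g * s + d) l"
    using assms by (rule At2E)
  then show ?thesis using L1_iff[OF w(3,4)] by (simp add: G2_def dealt_def)
qed

lemma At2_exists:
  assumes "l < s * r" "b < s" "B l b"
  obtains d i where "d < s" "i < W" "At2 d (b * W + i) l"
proof -
  obtain c v where cv: "c < s" "v < r" "At1 c v l" using At1_exists[OF assms] .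
  define d where "d = v mod s"
  \<comment> \<open>Place \<open>v\<close> of group \<open>c\<close> is dealt to position
    \<open>c * g + v div s\<close> of group \<open>v mod s\<close>; this inverts
    \<open>dealt\<close>.\<close>
  define w where "w = c * g + v div s"
  have vg: "v div s < g" using cv(2) by (simp add: r less_mult_imp_div_less mult.commute)
  have d: "d < s" using s by (simp add: d_def)
  have w: "w < r" "w div g = c" "w mod g * s + d = v"
    using block_less[OF cv(1) vg] vg by (simp_all add: w_def d_def r)
  have L: "dealt L1 d w b"
    unfolding dealt_def w using L1_iff[OF cv(1,3)] assms(3) by simp
  let ?i = "rk (\<lambda>w. dealt L1 d w b) w"
  have "?i < rk (\<lambda>w. dealt L1 d w b) r" by (rule rk_less[of "\<lambda>w. dealt L1 d w b" w r, OF L w(1)])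
  also have "\<dots> \<le> W" unfolding rk_def by (rule card_dealt[OF d assms(2)])
  finally have i: "?i < W" .
  then have "(b * W + ?i) div W = b" "(b * W + ?i) mod W = ?i" by auto
  then have "G2 d (b * W + ?i) w" using w(1) L by (simp only: G2_def)
  then have "At2 d (b * W + ?i) l"
    unfolding At2_def dealt_def using w cv(3) by auto
  then show thesis using that d i by blast
qed

text \<open>The index \<open>\<tau>\<close> stands for slot \<open>\<tau> mod W\<close> of segment
  \<open>b\<close> in dealt group \<open>\<tau> div W\<close>. The segment supplies the block and
  the bit of \<open>V\<close> found there supplies the position; together they determine the
  target.\<close>

lemma G3_cases:
  assumes "b < s" "\<tau> < 2 * r" "G3 b t \<tau>"
  obtains l where "l < s * r" "At2 (\<tau> div W) (b * W + \<tau> mod W) l" "G (b * r + t) l" "t < r"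
proof -
  have t: "t < r" and "moved2 (\<lambda>l. V l t) (\<tau> div W) (b * W + \<tau> mod W)"
    using assms(3) by (auto simp: G3_def)
  then obtain l where l: "At2 (\<tau> div W) (b * W + \<tau> mod W) l" "V l t"
    by (auto simp: moved2_iff)
  have "B l ((b * W + \<tau> mod W) div W)" using At2_block[OF slot_div[OF assms(2)] l(1)] .
  then have "B l b" using W_pos by simp
  moreover have "l < s * r" using At2_less[OF slot_div[OF assms(2)] l(1)] .
  ultimately show thesis using that[of l] BV_iff[OF _ assms(1) t] l t by blast
qed

lemma partial_perm_G3:
  assumes "b < s"
  shows "partial_perm (2 * r) (\<lambda>t \<tau> a. G3 b t \<tau>) a"
proof (rule partial_permI)
  note slot = slot_less[OF assms, of "\<tau> mod W" for \<tau>]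
  fix t \<tau> \<tau>' assume *: "\<tau> < 2 * r" "\<tau>' < 2 * r" "G3 b t \<tau>" "G3 b t \<tau>'"
  obtain l where l: "l < s * r" "At2 (\<tau> div W) (b * W + \<tau> mod W) l" "G (b * r + t) l" "t < r"
    using G3_cases[OF assms *(1,3)] .
  obtain l' where l': "l' < s * r" "At2 (\<tau>' div W) (b * W + \<tau>' mod W) l'" "G (b * r + t) l'"
    using G3_cases[OF assms *(2,4)] .
  have "l = l'" using G_row[OF block_less[OF assms l(4)] l(1) l'(1) l(3) l'(3)] .
  then have "\<tau> div W = \<tau>' div W \<and> b * W + \<tau> mod W = b * W + \<tau>' mod W"
    using l(2) l'(2) slot[of \<tau>] slot[of \<tau>'] W_pos by (intro At2_place[of _ _ _ _ l] slot_div *) auto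
  then show "\<tau> = \<tau>'" by (metis add_left_cancel div_mult_mod_eq)
next
  fix t t' \<tau> assume *: "\<tau> < 2 * r" "G3 b t \<tau>" "G3 b t' \<tau>"
  obtain l where l: "l < s * r" "At2 (\<tau> div W) (b * W + \<tau> mod W) l" "G (b * r + t) l" "t < r"
    using G3_cases[OF assms *(1,2)] .
  obtain l' where l': "l' < s * r" "At2 (\<tau> div W) (b * W + \<tau> mod W) l'" "G (b * r + t') l'" "t' < r"
    using G3_cases[OF assms *(1,3)] .
  have "l = l'" using At2_item[OF slot_div[OF *(1)] l(2) l'(2)] .
  then have "b * r + t = b * r + t'"
    using l l' by (intro G_column[of _ _ l] block_less assms) auto
  then show "t = t'" by simp
qed

text \<open>Correctness of the whole scheme. A result can only come from the single item in its
  slot; conversely, sorting and dealing lose no item that has a target.\<close>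

lemma G3_moved2:
  assumes "b < s" "t < r"
  shows "(\<exists>\<tau><2 * r. G3 b t \<tau> \<and> moved2 X (\<tau> div W) (b * W + \<tau> mod W)) \<longleftrightarrow>
    (\<exists>l<s * r. G (b * r + t) l \<and> X l)"
proof
  assume "\<exists>\<tau><2 * r. G3 b t \<tau> \<and> moved2 X (\<tau> div W) (b * W + \<tau> mod W)"
  then obtain \<tau> where \<tau>: "\<tau> < 2 * r" "G3 b t \<tau>" "moved2 X (\<tau> div W) (b * W + \<tau> mod W)" by blast
  obtain l where l: "l < s * r" "At2 (\<tau> div W) (b * W + \<tau> mod W) l" "G (b * r + t) l"
    using G3_cases[OF assms(1) \<tau>(1,2)] .
  obtain l' where "At2 (\<tau> div W) (b * W + \<tau> mod W) l'" "X l'" using \<tau>(3) by (auto simp: moved2_iff)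
  then have "X l" using At2_item[OF slot_div[OF \<tau>(1)] l(2)] by blast
  then show "\<exists>l<s * r. G (b * r + t) l \<and> X l" using l by blast
next
  assume "\<exists>l<s * r. G (b * r + t) l \<and> X l"
  then obtain l where l: "l < s * r" "G (b * r + t) l" "X l" by blast
  then have BV: "B l b" "V l t" using BV_iff[OF l(1) assms] by auto
  obtain d i where di: "d < s" "i < W" "At2 d (b * W + i) l" using At2_exists[OF l(1) assms(1) BV(1)] .
  have "(d * W + i) div W = d" "(d * W + i) mod W = i" using di by auto
  moreover have "d * W + i < 2 * r" using slot_less[OF di(1,2)] .
  moreover have "moved2 X d (b * W + i)" "moved2 (\<lambda>l. V l t) d (b * W + i)"
    using di l BV by (auto simp: moved2_iff)
  ultimately show "\<exists>\<tau><2 * r. G3 b t \<tau> \<and> moved2 X (\<tau> div W) (b * W + \<tau> mod W)"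
    unfolding G3_def using assms(2) by (intro exI[of _ "d * W + i"]) simp
qed

end

section \<open>Circuits for the sorting scheme\<close>

text \<open>Counters are held in one-hot form: advancing by \<open>f L\<close> shifts the row or
  keeps it, which is one multiplexer per entry and polarity. Cutting the row off at \<open>m\<close>
  is safe, because a new entry depends only on the old entries \<open>v\<close> and
  \<open>v - 1\<close>.\<close>

lemma derives_counter:
  assumes "constants \<subseteq> A" "\<And>i. i < L \<Longrightarrow> f i \<in> A" "\<And>i. i < L \<Longrightarrow> (\<lambda>a. \<not> f i a) \<in> A"
  shows "derives D A (6 * L * m) (dual (array (Suc L) m (\<lambda>i v a. rk (\<lambda>j. f j a) i = v)))"
  using assms(2,3)
proof (induction L)
  case 0
  have "derives D A (1 * m * (0 + 0)) (dual (array 1 m (\<lambda>i v a. rk (\<lambda>j. f j a) i = v)))"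
    by (rule derives_dual_array) (simp_all add: derives_const assms(1))
  then show ?case by simp
next
  case (Suc L)
  let ?cnt = "\<lambda>i v a. rk (\<lambda>j. f j a) i = v"
  let ?R = "dual (array (Suc L) m ?cnt)"
  let ?A = "A \<union> ?R"
  have IH: "derives D A (6 * L * m) ?R"
    using Suc.prems by (intro Suc.IH) simp_all
  have f: "f L \<in> ?A" "(\<lambda>a. \<not> f L a) \<in> ?A" using Suc.prems by simp_all
  have nf: "(\<lambda>a. \<not> \<not> f L a) \<in> ?A" using f(1) by simp
  have mem: "?cnt L v \<in> ?A" "(\<lambda>a. \<not> ?cnt L v a) \<in> ?A" if "v < m" for v
    using dual_array_memI[of L "Suc L" v m ?cnt] that by blast+
  have A: "constants \<subseteq> ?A" using assms(1) by blast
  have row: "derives D ?A (1 * m * (3 + 3)) (dual (array 1 m (\<lambda>i v. ?cnt (Suc L) v)))"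
  proof (rule derives_dual_array)
    fix v assume v: "v < m"
    have "derives D ?A 3 {\<lambda>a. if f L a then 0 < v \<and> ?cnt L (v - 1) a else ?cnt L v a}"
      by (rule derives_mux[OF f]) (intro derives_guard_conj A derives_wire mem; use v in simp)+
    then show "derives D ?A 3 {?cnt (Suc L) v}"
      by (rule derives_cong) (auto simp: rk_Suc)
    have "derives D ?A 3 {\<lambda>a. if f L a then 0 < v \<longrightarrow> \<not> ?cnt L (v - 1) a else \<not> ?cnt L v a}"
      by (rule derives_mux[OF f]) (intro derives_guard_imp A derives_wire mem; use v in simp)+
    then show "derives D ?A 3 {\<lambda>a. \<not> ?cnt (Suc L) v a}"
      by (rule derives_cong) (auto simp: rk_Suc)
  qed
  have "dual (array (Suc (Suc L)) m ?cnt) \<subseteq> ?R \<union> dual (array 1 m (\<lambda>i v. ?cnt (Suc L) v))"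
  proof -
    have "array (Suc (Suc L)) m ?cnt \<subseteq> array (Suc L) m ?cnt \<union> array 1 m (\<lambda>i v. ?cnt (Suc L) v)"
    proof
      fix h assume "h \<in> array (Suc (Suc L)) m ?cnt"
      then obtain i v where iv: "i < Suc (Suc L)" "v < m" "h = ?cnt i v" unfolding array_def by blast
      show "h \<in> array (Suc L) m ?cnt \<union> array 1 m (\<lambda>i v. ?cnt (Suc L) v)"
      proof (cases "i = Suc L")
        case True
        then show ?thesis using array_memI[of 0 1 v m "\<lambda>i v. ?cnt (Suc L) v"] iv by simp
      next
        case False
        then show ?thesis using array_memI[of i "Suc L" v m ?cnt] iv by simp
      qed
    qed
    then show ?thesis unfolding dual_def by blast
  qed
  then have "derives D A (6 * L * m + 1 * m * (3 + 3)) (dual (array (Suc (Suc L)) m ?cnt))"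
    by (intro derives_mono[OF derives_trans[OF IH derives_keep[OF row]]]) auto
  then show ?case by (simp add: algebra_simps)
qed

text \<open>The relations of the scheme now depend on the input and become wires. The arithmetic
  conditions are stated again because \<open>perm\<close> yields them only when \<open>D\<close> has
  an element.\<close>

locale split_net =
  fixes D :: "'a set" and s g r W :: nat and G :: "nat \<Rightarrow> nat \<Rightarrow> 'a \<Rightarrow> bool"
  assumes perm: "\<And>a. a \<in> D \<Longrightarrow> split_perm s g r W (\<lambda>j l. G j l a)"
    and s: "0 < s" "s \<le> g" and r: "r = s * g" and W: "W = 2 * g"
begin

definition "wB l b a = split.B r (\<lambda>j l. G j l a) l b"
definition "wV l v a = split.V s r (\<lambda>j l. G j l a) l v"
definition "wG1 c v u a = split.G1 s r (\<lambda>j l. G j l a) c v u"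
definition "wL1 c v b a = split.L1 s r (\<lambda>j l. G j l a) c v b"
definition "wG2 d \<sigma> w a = split.G2 s g r W (\<lambda>j l. G j l a) d \<sigma> w"
definition "w1 x c v (b::nat) a = split.moved1 s r (\<lambda>j l. G j l a) (\<lambda>l. x l b a) c v"
definition "w2 x d \<sigma> (b::nat) a = split.moved2 s g r W (\<lambda>j l. G j l a) (\<lambda>l. x l b a) d \<sigma>"
definition "wG3 b t \<tau> a = split.G3 s g r W (\<lambda>j l. G j l a) b t \<tau>"

lemma derives_B_V:
  assumes A: "constants \<subseteq> A" "dual (array (s * r) (s * r) G) \<subseteq> A"
  shows "derives D A (4 * (s * r)\<^sup>2) (dual (array (s * r) s wB) \<union> dual (array (s * r) r wV))"
proof -
  have mem: "G j l \<in> A" "(\<lambda>a. \<not> G j l a) \<in> A" if "j < s * r" "l < s * r" for j l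
    using dual_array_memI[OF that, of G] A by blast+
  have B: "derives D A (s * r * s * (r * (0 + 1) + r * (0 + 1))) (dual (array (s * r) s wB))"
  proof (rule derives_dual_array)
    fix l b assume lb: "l < s * r" "b < s"
    show "derives D A (r * (0 + 1)) {wB l b}"
      unfolding wB_def[abs_def] split.B_def
      by (intro derives_ex derives_wire A mem block_less lb)
    have "derives D A (r * (0 + 1)) {\<lambda>a. \<forall>v<r. \<not> G (b * r + v) l a}"
      by (intro derives_all derives_wire A mem block_less lb)
    then show "derives D A (r * (0 + 1)) {\<lambda>a. \<not> wB l b a}"
      by (rule derives_cong) (auto simp: wB_def split.B_def)
  qed
  have V: "derives D A (s * r * r * (s * (0 + 1) + s * (0 + 1))) (dual (array (s * r) r wV))"
  proof (rule derives_dual_array)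
    fix l v assume lv: "l < s * r" "v < r"
    show "derives D A (s * (0 + 1)) {wV l v}"
      unfolding wV_def[abs_def] split.V_def
      by (intro derives_ex derives_wire A mem block_less lv)
    have "derives D A (s * (0 + 1)) {\<lambda>a. \<forall>b<s. \<not> G (b * r + v) l a}"
      by (intro derives_all derives_wire A mem block_less lv)
    then show "derives D A (s * (0 + 1)) {\<lambda>a. \<not> wV l v a}"
      by (rule derives_cong) (auto simp: wV_def split.V_def)
  qed
  show ?thesis
    by (rule derives_le[OF derives_Un[OF B V]]) (simp add: power2_eq_square algebra_simps)
qed

text \<open>For one group the counter runs over all \<open>s * r\<close> pairs and keeps
  \<open>r\<close> values. Summed over the \<open>s\<close> groups this is of order
  \<open>(s * r)^2\<close>, so finding the sorting permutations stays quadratic.\<close>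

lemma derives_G1:
  assumes A: "constants \<subseteq> A" "dual (array (s * r) s wB) \<subseteq> A" and c: "c < s"
  shows "derives D A (10 * s * r\<^sup>2) (dual (array r r (wG1 c)))"
proof -
  define f where "f i a = split.F r (\<lambda>j l. G j l a) c i" for i a
  have mem: "wB (c * r + u) b \<in> A" "(\<lambda>a. \<not> wB (c * r + u) b a) \<in> A" if "u < r" "b < s" for u b
    using dual_array_memI[OF block_less[OF c that(1)] that(2), of wB] A by blast+
  have f: "f i \<in> A \<and> (\<lambda>a. \<not> f i a) \<in> A" if "i < s * r" for i
  proof -
    have "i div r < s" "i mod r < r" using that by (cases "r = 0"; simp add: less_mult_imp_div_less)+
    moreover have "f i = wB (c * r + i mod r) (i div r)"
      by (simp add: f_def[abs_def] wB_def[abs_def] split.F_def)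
    ultimately show ?thesis using mem by simp
  qed
  let ?cnt = "\<lambda>i v a. rk (\<lambda>j. f j a) i = v"
  let ?R = "dual (array (Suc (s * r)) r ?cnt)"
  have 1: "derives D A (6 * (s * r) * r) ?R"
    by (rule derives_counter) (use A f in auto)
  have cnt: "?cnt (b * r + u) v \<in> A \<union> ?R" "(\<lambda>a. \<not> ?cnt (b * r + u) v a) \<in> A \<union> ?R"
    if "b < s" "u < r" "v < r" for b u v
    using dual_array_memI[OF less_SucI[OF block_less[OF that(1,2)]] that(3), of ?cnt] by blast+
  have 2: "derives D (A \<union> ?R) (r * r * (s * (0 + 0 + 1 + 1) + s * (0 + 0 + 1 + 1))) (dual (array r r (wG1 c)))"
  proof (rule derives_dual_array)
    fix v u assume vu: "v < r" "u < r"
    have A': "constants \<subseteq> A \<union> ?R" using A by blast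
    have eq: "wG1 c v u a \<longleftrightarrow> (\<exists>b<s. wB (c * r + u) b a \<and> ?cnt (b * r + u) v a)" for a
      by (simp add: wG1_def wB_def f_def split.G1_def)
    have "derives D (A \<union> ?R) (s * (0 + 0 + 1 + 1)) {\<lambda>a. \<exists>b<s. wB (c * r + u) b a \<and> ?cnt (b * r + u) v a}"
      by (intro derives_ex derives_conj derives_wire A' cnt vu UnI1 mem)
    then show "derives D (A \<union> ?R) (s * (0 + 0 + 1 + 1)) {wG1 c v u}"
      by (rule derives_cong) (simp only: eq)
    have "derives D (A \<union> ?R) (s * (0 + 0 + 1 + 1)) {\<lambda>a. \<forall>b<s. \<not> wB (c * r + u) b a \<or> \<not> ?cnt (b * r + u) v a}"
      by (intro derives_all derives_disj derives_wire A' cnt vu UnI1 mem)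
    then show "derives D (A \<union> ?R) (s * (0 + 0 + 1 + 1)) {\<lambda>a. \<not> wG1 c v u a}"
      by (rule derives_cong) (simp only: eq, blast)
  qed
  show ?thesis
    by (rule derives_le[OF derives_trans[OF 1 2]]) (simp add: power2_eq_square algebra_simps)
qed

lemma derives_L1:
  assumes A: "constants \<subseteq> A" "dual (array (s * r) s wB) \<subseteq> A" "dual (array r r (wG1 c)) \<subseteq> A" and c: "c < s"
  shows "derives D A (4 * s * r\<^sup>2) (dual (array r s (wL1 c)))"
proof -
  have mem: "wB (c * r + u) b \<in> A" "(\<lambda>a. \<not> wB (c * r + u) b a) \<in> A" if "u < r" "b < s" for u b
    using dual_array_memI[OF block_less[OF c that(1)] that(2), of wB] A by blast+
  have mem1: "wG1 c v u \<in> A" "(\<lambda>a. \<not> wG1 c v u a) \<in> A" if "v < r" "u < r" for u v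
    using dual_array_memI[OF that, of "wG1 c"] A by blast+
  have "derives D A (r * s * (r * (0 + 0 + 1 + 1) + r * (0 + 0 + 1 + 1))) (dual (array r s (wL1 c)))"
  proof (rule derives_dual_array)
    fix v b assume vb: "v < r" "b < s"
    have eq: "wL1 c v b a \<longleftrightarrow> (\<exists>u<r. wG1 c v u a \<and> wB (c * r + u) b a)" for a
      by (simp add: wL1_def wG1_def wB_def split.L1_def)
    have "derives D A (r * (0 + 0 + 1 + 1)) {\<lambda>a. \<exists>u<r. wG1 c v u a \<and> wB (c * r + u) b a}"
      by (intro derives_ex derives_conj derives_wire A mem mem1 vb)
    then show "derives D A (r * (0 + 0 + 1 + 1)) {wL1 c v b}"
      by (rule derives_cong) (simp only: eq)
    have "derives D A (r * (0 + 0 + 1 + 1)) {\<lambda>a. \<forall>u<r. \<not> wG1 c v u a \<or> \<not> wB (c * r + u) b a}"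
      by (intro derives_all derives_disj derives_wire A mem mem1 vb)
    then show "derives D A (r * (0 + 0 + 1 + 1)) {\<lambda>a. \<not> wL1 c v b a}"
      by (rule derives_cong) (simp only: eq, blast)
  qed
  then show ?thesis
    by (rule derives_le) (simp add: power2_eq_square algebra_simps)
qed

lemma place_less:
  assumes "w < r" "d < s"
  shows "w div g < s" "w mod g * s + d < r"
proof -
  have "0 < g" using assms r by (auto intro: Nat.gr0I)
  then show "w div g < s" "w mod g * s + d < r"
    using assms block_less[of "w mod g" g d s] by (auto simp: r less_mult_imp_div_less mult.commute)
qed

lemma slot_div: "\<sigma> < 2 * r \<Longrightarrow> \<sigma> div W < s"
  by (rule less_mult_imp_div_less) (simp add: r W)

lemma slot_mod: "\<sigma> mod W < W"
  using s W by simp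

lemma slot_less: "b < s \<Longrightarrow> b * W + \<tau> mod W < 2 * r"
  using block_less[of b s "\<tau> mod W" W] slot_mod[of \<tau>] by (simp add: r W)

text \<open>There are \<open>s\<close> counters, one per block, but each keeps only \<open>W\<close>
  values; as \<open>s * W = 2 * r\<close>, the cost is quadratic in the group size.\<close>

lemma derives_G2:
  assumes A: "constants \<subseteq> A" "\<And>c. c < s \<Longrightarrow> dual (array r s (wL1 c)) \<subseteq> A" and d: "d < s"
  shows "derives D A (20 * r\<^sup>2) (dual (array (2 * r) (2 * r) (wG2 d)))"
proof -
  define f where "f b w a = split.dealt s g (\<lambda>c v. wL1 c v b a) d w" for b w a
  have f: "f b w \<in> A" "(\<lambda>a. \<not> f b w a) \<in> A" if "w < r" "b < s" for w b
  proof -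
    have "f b w = wL1 (w div g) (w mod g * s + d) b"
      by (simp add: f_def[abs_def] split.dealt_def)
    then show "f b w \<in> A" "(\<lambda>a. \<not> f b w a) \<in> A"
      using dual_array_memI[OF place_less(2)[OF that(1) d] that(2), of "wL1 (w div g)"]
        A(2)[OF place_less(1)[OF that(1) d]] by auto
  qed
  let ?cnt = "\<lambda>b i v a. rk (\<lambda>j. f b j a) i = v"
  let ?R = "\<Union>b\<in>{..<s}. dual (array (Suc r) W (?cnt b))"
  have 1: "derives D A (card {..<s} * (6 * r * W)) ?R"
    by (rule derives_UN) (auto intro!: derives_counter f A(1))
  have cnt: "?cnt b w v \<in> A \<union> ?R" "(\<lambda>a. \<not> ?cnt b w v a) \<in> A \<union> ?R"
    if "b < s" "w < r" "v < W" for b w v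
    using dual_array_memI[OF less_SucI[OF that(2)] that(3), of "?cnt b"] that(1) by blast+
  have 2: "derives D (A \<union> ?R) (2 * r * (2 * r) * ((0 + 0 + 1) + (0 + 0 + 1))) (dual (array (2 * r) (2 * r) (wG2 d)))"
  proof (rule derives_dual_array)
    fix \<sigma> w assume \<sigma>: "\<sigma> < 2 * r"
    let ?b = "\<sigma> div W"
    have b: "?b < s" by (rule slot_div[OF \<sigma>])
    have A': "constants \<subseteq> A \<union> ?R" using A by blast
    have eq: "wG2 d \<sigma> w a \<longleftrightarrow> w < r \<and> (f ?b w a \<and> ?cnt ?b w (\<sigma> mod W) a)" for a
      by (simp add: wG2_def f_def split.G2_def wL1_def split.dealt_def)
    have "derives D (A \<union> ?R) (0 + 0 + 1) {\<lambda>a. w < r \<and> (f ?b w a \<and> ?cnt ?b w (\<sigma> mod W) a)}"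
      by (intro derives_guard_conj derives_conj derives_wire A' cnt b slot_mod UnI1 f)
    then show "derives D (A \<union> ?R) (0 + 0 + 1) {wG2 d \<sigma> w}"
      by (rule derives_cong) (simp only: eq)
    have "derives D (A \<union> ?R) (0 + 0 + 1) {\<lambda>a. w < r \<longrightarrow> (\<not> f ?b w a \<or> \<not> ?cnt ?b w (\<sigma> mod W) a)}"
      by (intro derives_guard_imp derives_disj derives_wire A' cnt b slot_mod UnI1 f)
    then show "derives D (A \<union> ?R) (0 + 0 + 1) {\<lambda>a. \<not> wG2 d \<sigma> w a}"
      by (rule derives_cong) (simp only: eq, blast)
  qed
  have "s * (r * W) = 2 * (r * r)" by (simp add: r W)
  then show ?thesis
    by (intro derives_le[OF derives_trans[OF 1 2]]) (auto simp: power2_eq_square algebra_simps)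
qed

lemma mprod_G1: "mprod r (wG1 c) (\<lambda>u b. x (c * r + u) b) v b a = w1 x c v b a"
  by (simp add: mprod_def w1_def wG1_def split.moved1_def)

lemma mprod_G2:
  "mprod (2 * r) (wG2 d) (\<lambda>w b. if w < r then split.dealt s g (\<lambda>c v. w1 x c v b) d w else (\<lambda>_. False)) \<sigma> b a
     = w2 x d \<sigma> b a"
proof -
  have "w < r \<longleftrightarrow> w < 2 * r \<and> w < r" for w by auto
  then show ?thesis
    unfolding mprod_def w2_def wG2_def split.moved2_def split.dealt_def w1_def by auto
qed

lemma mprod_G3:
  assumes "a \<in> D" "e < s" "t < r"
  shows "mprod (2 * r) (wG3 e) (\<lambda>\<tau> b. w2 x (\<tau> div W) (e * W + \<tau> mod W) b) t b a
     = mprod (s * r) G x (e * r + t) b a"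
  unfolding mprod_def w2_def wG3_def
  using split_perm.G3_moved2[OF perm[OF assms(1)] assms(2,3), of "\<lambda>l. x l b a"] by simp

text \<open>The control of the last round is the moved array \<open>wV\<close> itself, so it costs
  no gates.\<close>

lemma wG3_iff: "wG3 e t \<tau> a \<longleftrightarrow> t < r \<and> w2 wV (\<tau> div W) (e * W + \<tau> mod W) t a"
  by (simp add: wG3_def split.G3_def w2_def wV_def)

lemma partial_perm_wires:
  assumes "a \<in> D" "c < s"
  shows "partial_perm r (wG1 c) a" "partial_perm (2 * r) (wG2 c) a" "partial_perm (2 * r) (wG3 c) a"
  using split_perm.partial_perm_G1[OF perm[OF assms(1)] assms(2), of a]
    split_perm.partial_perm_G2[OF perm[OF assms(1)] assms(2), of a]
    split_perm.partial_perm_G3[OF perm[OF assms(1)] assms(2), of a]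
  by (simp_all add: partial_perm_def wG1_def wG2_def wG3_def)

end

section \<open>Gate count of one application of the scheme\<close>

lemma derives_chain: "derives D A k B \<Longrightarrow> derives D B l C \<Longrightarrow> derives D A (k + l) C"
  by (erule derives_trans) (erule derives_source, blast)

lemma derives_array_cong:
  assumes "derives D A k (array N M f)" "\<And>i j a. i < N \<Longrightarrow> j < M \<Longrightarrow> a \<in> D \<Longrightarrow> f i j a = f' i j a"
  shows "derives D A k (array N M f')"
proof -
  have "derives D (A \<union> array N M f) (N * M * 0) (array N M f')"
  proof (rule derives_array)
    fix i j assume ij: "i < N" "j < M"
    show "derives D (A \<union> array N M f) 0 {f' i j}"
      by (rule derives_cong[OF derives_wire[of "f i j"]]) (use assms(2) ij array_memI[of i N j M f] in auto)
  qed
  from derives_trans[OF assms(1) this] show ?thesis by simp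
qed

lemma array_subset:
  assumes "\<And>i j. i < N \<Longrightarrow> j < M \<Longrightarrow> f i j \<in> A"
  shows "array N M f \<subseteq> A"
  using assms unfolding array_def by blast

lemma dual_array_subset:
  assumes "\<And>i j. i < N \<Longrightarrow> j < M \<Longrightarrow> f i j \<in> A" "\<And>i j. i < N \<Longrightarrow> j < M \<Longrightarrow> (\<lambda>a. \<not> f i j a) \<in> A"
  shows "dual (array N M f) \<subseteq> A"
  using assms unfolding array_def dual_def by blast

context split_net
begin

text \<open>The data presented to the routers of the three rounds. Dealing and collecting are mere
  renamings of wires.\<close>

definition "w1_in x c u b = x (c * r + u) b"
definition "w2_in x d w b = (if w < r then split.dealt s g (\<lambda>c v. w1 x c v b) d w else (\<lambda>_. False))"
definition "w3_in x e \<tau> b = w2 x (\<tau> div W) (e * W + \<tau> mod W) b"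

lemma mprod_w1: "mprod r (wG1 c) (w1_in x c) = w1 x c"
  using mprod_G1 by (intro ext) (simp add: w1_in_def[abs_def])

lemma mprod_w2: "mprod (2 * r) (wG2 d) (w2_in x d) = w2 x d"
  using mprod_G2 by (intro ext) (simp add: w2_in_def[abs_def])

lemma mprod_w3:
  "a \<in> D \<Longrightarrow> e < s \<Longrightarrow> t < r \<Longrightarrow> mprod (2 * r) (wG3 e) (w3_in x e) t b a = mprod (s * r) G x (e * r + t) b a"
  using mprod_G3 by (simp add: w3_in_def[abs_def])

lemma w2_in_cases:
  assumes "d < s"
  obtains c v where "c < s" "v < r" "w2_in x d w b = w1 x c v b" | "w2_in x d w b = (\<lambda>_. False)"
proof (cases "w < r")
  case True
  then have "w2_in x d w b = w1 x (w div g) (w mod g * s + d) b"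
    by (simp add: w2_in_def split.dealt_def)
  then show thesis using that(1) place_less[OF True assms] by blast
next
  case False
  then show thesis using that(2) by (simp add: w2_in_def)
qed

text \<open>The data pass routers of sizes \<open>r\<close>, \<open>2 * r\<close> and
  \<open>2 * r\<close>, which gives \<open>(m + 1) + 2 * 2 * (m + 2) = 5 * m + 9\<close>. The bits
  \<open>wV\<close> pass the first two rounds in both polarities, so a group pays for control 1 + 2
  times at level \<open>m\<close> and, with the third round, 1 + 2 + 1 times at level
  \<open>Suc m\<close>. Moving the \<open>r\<close> bits of \<open>wV\<close> gives
  \<open>6 * m + 10\<close>. The 18 consists of 4 for \<open>wB\<close> and \<open>wV\<close>, 10
  for \<open>wG1\<close> and 4 for \<open>wL1\<close>.\<close>

lemma derives_split:
  assumes R: "router D c h" and m: "r = 2 ^ m"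
  shows "derives D (constants \<union> dual (array (s * r) (s * r) G) \<union> array (s * r) p x)
    (c * p * (s * r) * (5 * m + 9) + s * (3 * h m + 4 * h (Suc m))
      + (s * r\<^sup>2 * (c * (6 * m + 10) + 28) + 18 * (s * r)\<^sup>2))
    (array (s * r) p (mprod (s * r) G x))"
proof -
  have m2: "2 * r = 2 ^ Suc m" by (simp add: m)
  define n where "n = s * r"
  define A0 where "A0 = constants \<union> dual (array n n G) \<union> array n p x"
  define A1 where "A1 = A0 \<union> (dual (array n s wB) \<union> dual (array n r wV))"
  define A2 where "A2 = A1 \<union> (\<Union>c\<in>{..<s}. dual (array r r (wG1 c)))"
  define A3 where "A3 = A2 \<union> (\<Union>c\<in>{..<s}. array r p (w1 x c) \<union>
    (dual (array r r (w1 wV c)) \<union> dual (array r s (wL1 c))))"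
  define A4 where "A4 = A3 \<union> (\<Union>d\<in>{..<s}. dual (array (2 * r) (2 * r) (wG2 d)))"
  define A5 where "A5 = A4 \<union> (\<Union>d\<in>{..<s}. array (2 * r) p (w2 x d) \<union> dual (array (2 * r) r (w2 wV d)))"
  define A6 where "A6 = A5 \<union> (\<Union>e\<in>{..<s}. dual (array (2 * r) (2 * r) (wG3 e)))"
  note Adefs = A0_def A1_def A2_def A3_def A4_def A5_def A6_def
  have const: "constants \<subseteq> A0" "constants \<subseteq> A1" "constants \<subseteq> A2" "constants \<subseteq> A3" "constants \<subseteq> A4" "constants \<subseteq> A5" "constants \<subseteq> A6"
    unfolding Adefs by blast+
  have 1: "derives D A0 (4 * n\<^sup>2) A1"
    unfolding A1_def n_def
    by (rule derives_keep, rule derives_B_V) (auto simp: A0_def n_def const)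
  have 2: "derives D A1 (card {..<s} * (10 * s * r\<^sup>2)) A2"
    unfolding A2_def
  proof (rule derives_keep, rule derives_UN)
    fix c assume "c \<in> {..<s}"
    then show "derives D A1 (10 * s * r\<^sup>2) (dual (array r r (wG1 c)))"
      by (intro derives_G1 const) (auto simp: A1_def n_def)
  qed simp
  let ?k3 = "(c * p * (m + 1) * r + h m) +
    ((2 * (c * r * (m + 1) * r + h m) + r\<^sup>2 + r * r) + 4 * s * r\<^sup>2)"
  have 3: "derives D A2 (card {..<s} * ?k3) A3"
    unfolding A3_def
  proof (rule derives_keep, rule derives_UN)
    fix i assume "i \<in> {..<s}"
    then have i: "i < s" by simp
    have G1: "dual (array r r (wG1 i)) \<subseteq> A2" unfolding A2_def using i by blast
    have "derives D A2 (c * p * (m + 1) * r + h m) (array r p (mprod r (wG1 i) (w1_in x i)))"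
      unfolding m
    proof (rule derives_router[OF R], fold m)
      show "array r p (w1_in x i) \<subseteq> A2"
        by (rule array_subset)
          (use array_memI[OF block_less[OF i], of _ r _ p x] in \<open>auto simp: w1_in_def A2_def A1_def A0_def n_def\<close>)
    qed (use G1 const partial_perm_wires i in auto)
    then have x: "derives D A2 (c * p * (m + 1) * r + h m) (array r p (w1 x i))"
      by (simp only: mprod_w1)
    have "derives D A2 (2 * (c * r * (m + 1) * r + h m) + r\<^sup>2 + r * r)
        (dual (array r r (mprod r (wG1 i) (w1_in wV i))))"
    proof (rule derives_router_dual[OF R, of m "wG1 i" A2 r "w1_in wV i", folded m])
      show "dual (array r r (w1_in wV i)) \<subseteq> A2"
        by (rule dual_array_subset)
          (use dual_array_memI[OF block_less[OF i], of _ r _ r wV] in \<open>auto simp: w1_in_def A2_def A1_def n_def\<close>)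
    qed (use G1 const partial_perm_wires i in auto)
    then have V: "derives D A2 (2 * (c * r * (m + 1) * r + h m) + r\<^sup>2 + r * r) (dual (array r r (w1 wV i)))"
      by (simp only: mprod_w1)
    have L: "derives D A2 (4 * s * r\<^sup>2) (dual (array r s (wL1 i)))"
      by (intro derives_L1 const G1 i) (auto simp: A2_def A1_def n_def)
    show "derives D A2 ?k3 (array r p (w1 x i) \<union> (dual (array r r (w1 wV i)) \<union> dual (array r s (wL1 i))))"
      by (intro derives_Un x V L)
  qed simp
  have 4: "derives D A3 (card {..<s} * (20 * r\<^sup>2)) A4"
    unfolding A4_def
  proof (rule derives_keep, rule derives_UN)
    fix d assume "d \<in> {..<s}"
    then show "derives D A3 (20 * r\<^sup>2) (dual (array (2 * r) (2 * r) (wG2 d)))"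
      by (intro derives_G2 const) (auto simp: A3_def)
  qed simp
  have W1: "w1 x i v b \<in> A4" if "i < s" "v < r" "b < p" for i v b
    using array_memI[OF that(2,3), of "w1 x i"] that(1) unfolding A4_def A3_def by blast
  have WV1: "w1 wV i v b \<in> A4" "(\<lambda>a. \<not> w1 wV i v b a) \<in> A4" if "i < s" "v < r" "b < r" for i v b
    using dual_array_memI[OF that(2,3), of "w1 wV i"] that(1) unfolding A4_def A3_def by blast+
  have FT: "(\<lambda>_. False) \<in> A4" "(\<lambda>_. True) \<in> A4" using const by (auto simp: constants_def)
  let ?k5 = "(c * p * (Suc m + 1) * (2 * r) + h (Suc m)) +
    (2 * (c * r * (Suc m + 1) * (2 * r) + h (Suc m)) + (2 * r)\<^sup>2 + 2 * r * r)"
  have 5: "derives D A4 (card {..<s} * ?k5) A5"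
    unfolding A5_def
  proof (rule derives_keep, rule derives_UN)
    fix d assume "d \<in> {..<s}"
    then have d: "d < s" by simp
    have G2: "dual (array (2 * r) (2 * r) (wG2 d)) \<subseteq> A4" unfolding A4_def using d by blast
    have "derives D A4 (c * p * (Suc m + 1) * (2 * r) + h (Suc m))
        (array (2 * r) p (mprod (2 * r) (wG2 d) (w2_in x d)))"
      unfolding m2
    proof (rule derives_router[OF R], fold m2)
      show "array (2 * r) p (w2_in x d) \<subseteq> A4"
      proof (rule array_subset)
        fix w b assume "b < p"
        then show "w2_in x d w b \<in> A4"
          using w2_in_cases[OF d, of x w b] W1 FT by metis
      qed
    qed (use G2 const partial_perm_wires d in auto)
    then have x: "derives D A4 (c * p * (Suc m + 1) * (2 * r) + h (Suc m)) (array (2 * r) p (w2 x d))"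
      by (simp only: mprod_w2)
    have "derives D A4 (2 * (c * r * (Suc m + 1) * (2 * r) + h (Suc m)) + (2 * r)\<^sup>2 + 2 * r * r)
        (dual (array (2 * r) r (mprod (2 * r) (wG2 d) (w2_in wV d))))"
    proof (rule derives_router_dual[OF R, of "Suc m" "wG2 d" A4 r "w2_in wV d", folded m2])
      show "dual (array (2 * r) r (w2_in wV d)) \<subseteq> A4"
      proof (rule dual_array_subset)
        fix w b assume b: "b < r"
        show "w2_in wV d w b \<in> A4"
          using w2_in_cases[OF d, of wV w b] WV1(1) b FT by metis
        show "(\<lambda>a. \<not> w2_in wV d w b a) \<in> A4"
        proof (rule w2_in_cases[OF d, of wV w b])
          assume "w2_in wV d w b = (\<lambda>_. False)"
          then show ?thesis using FT by simp
        next
          fix i v assume "i < s" "v < r" "w2_in wV d w b = w1 wV i v b"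
          then show ?thesis using WV1(2) b by simp
        qed
      qed
    qed (use G2 const partial_perm_wires d in auto)
    then have V: "derives D A4 (2 * (c * r * (Suc m + 1) * (2 * r) + h (Suc m)) + (2 * r)\<^sup>2 + 2 * r * r)
        (dual (array (2 * r) r (w2 wV d)))"
      by (simp only: mprod_w2)
    show "derives D A4 ?k5 (array (2 * r) p (w2 x d) \<union> dual (array (2 * r) r (w2 wV d)))"
      by (intro derives_Un x V)
  qed simp
  have W2: "w2 x d \<sigma> b \<in> A5" if "d < s" "\<sigma> < 2 * r" "b < p" for d \<sigma> b
    using array_memI[OF that(2,3), of "w2 x d"] that(1) unfolding A5_def by blast
  have WV2: "w2 wV d \<sigma> b \<in> A5" "(\<lambda>a. \<not> w2 wV d \<sigma> b a) \<in> A5" if "d < s" "\<sigma> < 2 * r" "b < r" for d \<sigma> b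
    using dual_array_memI[OF that(2,3), of "w2 wV d"] that(1) unfolding A5_def by blast+
  have 6: "derives D A5 (card {..<s} * (2 * r * (2 * r) * (0 + 0))) A6"
    unfolding A6_def
  proof (rule derives_keep, rule derives_UN)
    fix e assume "e \<in> {..<s}"
    then have e: "e < s" by simp
    show "derives D A5 (2 * r * (2 * r) * (0 + 0)) (dual (array (2 * r) (2 * r) (wG3 e)))"
    proof (rule derives_dual_array)
      fix t \<tau> assume \<tau>: "\<tau> < 2 * r"
      have "derives D A5 0 {\<lambda>a. t < r \<and> w2 wV (\<tau> div W) (e * W + \<tau> mod W) t a}"
        by (intro derives_guard_conj derives_wire const WV2 slot_div slot_less \<tau> e)
      then show "derives D A5 0 {wG3 e t \<tau>}" by (rule derives_cong) (simp add: wG3_iff)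
      have "derives D A5 0 {\<lambda>a. t < r \<longrightarrow> \<not> w2 wV (\<tau> div W) (e * W + \<tau> mod W) t a}"
        by (intro derives_guard_imp derives_wire const WV2 slot_div slot_less \<tau> e)
      then show "derives D A5 0 {\<lambda>a. \<not> wG3 e t \<tau> a}" by (rule derives_cong) (simp add: wG3_iff)
    qed
  qed simp
  let ?Z = "\<lambda>e. array r p (\<lambda>t. mprod n G x (e * r + t))"
  have 7: "derives D A6 (card {..<s} * (c * p * (Suc m + 1) * (2 * r) + h (Suc m))) (\<Union>e\<in>{..<s}. ?Z e)"
  proof (rule derives_UN)
    fix e assume "e \<in> {..<s}"
    then have e: "e < s" by simp
    have G3: "dual (array (2 * r) (2 * r) (wG3 e)) \<subseteq> A6" unfolding A6_def using e by blast
    have "derives D A6 (c * p * (Suc m + 1) * (2 * r) + h (Suc m))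
        (array (2 * r) p (mprod (2 * r) (wG3 e) (w3_in x e)))"
      unfolding m2
    proof (rule derives_router[OF R], fold m2)
      show "array (2 * r) p (w3_in x e) \<subseteq> A6"
        by (rule array_subset)
          (use W2 slot_div slot_less e in \<open>auto simp: w3_in_def A6_def\<close>)
    qed (use G3 const partial_perm_wires e in auto)
    then have "derives D A6 (c * p * (Suc m + 1) * (2 * r) + h (Suc m))
        (array r p (mprod (2 * r) (wG3 e) (w3_in x e)))"
    proof (rule derives_mono)
      show "array r p (mprod (2 * r) (wG3 e) (w3_in x e)) \<subseteq> array (2 * r) p (mprod (2 * r) (wG3 e) (w3_in x e))"
        by (rule array_subset) (simp add: array_memI)
    qed simp_all
    then show "derives D A6 (c * p * (Suc m + 1) * (2 * r) + h (Suc m)) (?Z e)"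
      by (rule derives_array_cong) (simp add: mprod_w3 e n_def)
  qed simp
  have Z: "array n p (mprod n G x) \<subseteq> (\<Union>e\<in>{..<s}. ?Z e)"
  proof (rule array_subset)
    fix j b assume jb: "j < n" "b < p"
    have j: "j div r < s" "j mod r < r"
      using jb(1) by (cases "r = 0"; simp add: n_def less_mult_imp_div_less)+
    have "mprod n G x (j div r * r + j mod r) b \<in> ?Z (j div r)"
      using array_memI[OF j(2) jb(2), of "\<lambda>t. mprod n G x (j div r * r + t)"] .
    then show "mprod n G x j b \<in> (\<Union>e\<in>{..<s}. ?Z e)" using j(1) by auto
  qed
  have "derives D A0 (4 * n\<^sup>2 + (card {..<s} * (10 * s * r\<^sup>2) + (card {..<s} * ?k3 +
      (card {..<s} * (20 * r\<^sup>2) + (card {..<s} * ?k5 + (card {..<s} * (2 * r * (2 * r) * (0 + 0))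
       + card {..<s} * (c * p * (Suc m + 1) * (2 * r) + h (Suc m))))))))
     (array n p (mprod n G x))"
    by (rule derives_chain[OF 1], rule derives_chain[OF 2], rule derives_chain[OF 3],
        rule derives_chain[OF 4], rule derives_chain[OF 5], rule derives_chain[OF 6],
        rule derives_mono[OF 7]) (use Z in simp_all)
  then have "derives D A0 (c * p * n * (5 * m + 9) + s * (3 * h m + 4 * h (Suc m))
      + (s * r\<^sup>2 * (c * (6 * m + 10) + 28) + 18 * n\<^sup>2)) (array n p (mprod n G x))"
    by (rule derives_le) (simp add: n_def power2_eq_square algebra_simps)
  then show ?thesis by (simp only: A0_def n_def)
qed

end

section \<open>The two upper bounds\<close>

definition split_cost :: "nat \<Rightarrow> (nat \<Rightarrow> nat) \<Rightarrow> nat \<Rightarrow> nat" where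
  "split_cost c h k =
     2 ^ (k div 3) * (3 * h (k - k div 3) + 4 * h (Suc (k - k div 3))) + (30 * c + 46) * (2 ^ k)\<^sup>2"

lemma router_split:
  assumes R: "router D c h"
  shows "router D (14 * c) (split_cost c h)"
  unfolding router_def
proof (intro allI impI)
  fix k p :: nat and G x :: "nat \<Rightarrow> nat \<Rightarrow> 'a \<Rightarrow> bool"
  assume G: "\<forall>a\<in>D. partial_perm (2 ^ k) G a"
  define t where "t = k div 3"
  define m where "m = k - t"
  define s :: nat where "s = 2 ^ t"
  define g :: nat where "g = 2 ^ (m - t)"
  define r :: nat where "r = 2 ^ m"
  define W where "W = 2 * g"
  \<comment> \<open>\<open>t \<le> m - t\<close> is the condition \<open>s \<le> g\<close> and means
    \<open>3 * t \<le> k\<close>; \<open>k div 3\<close> is the largest such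
    \<open>t\<close>.\<close>
  have tm: "t \<le> m - t" "t \<le> m" "t + m = k" by (auto simp: t_def m_def)
  have s: "0 < s" "s \<le> g" using tm by (auto simp: s_def g_def power_increasing)
  have r: "r = s * g" using tm by (simp add: r_def s_def g_def flip: power_add)
  have n: "s * r = 2 ^ k" using tm by (simp add: r_def s_def flip: power_add)
  interpret split_net D s g r W G
  proof
    fix a assume "a \<in> D"
    then have "partial_perm (s * r) G a" using G by (simp add: n)
    then show "partial_perm (s * r) (\<lambda>j l (_::unit). G j l a) ()"
      by (simp add: partial_perm_def)
  qed (use s r W_def in auto)
  have "derives D (constants \<union> dual (array (s * r) (s * r) G) \<union> array (s * r) p x)
    (c * p * (s * r) * (5 * m + 9) + s * (3 * h m + 4 * h (Suc m))
      + (s * r\<^sup>2 * (c * (6 * m + 10) + 28) + 18 * (s * r)\<^sup>2))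
    (array (s * r) p (mprod (s * r) G x))"
    by (rule derives_split[OF R r_def])
  then show "derives D (constants \<union> dual (array (2 ^ k) (2 ^ k) G) \<union> array (2 ^ k) p x)
    (14 * c * p * (k + 1) * 2 ^ k + split_cost c h k) (array (2 ^ k) p (mprod (2 ^ k) G x))"
    unfolding n
  proof (rule derives_le)
    have "5 * m + 9 \<le> 14 * (k + 1)" by (simp add: m_def)
    then have 1: "c * p * 2 ^ k * (5 * m + 9) \<le> c * p * 2 ^ k * (14 * (k + 1))"
      by (rule mult_le_mono2)
    \<comment> \<open>Moving the target positions costs about \<open>s * r^2 * m\<close>, which lies
      below \<open>(s * r)^2 * m\<close> by a factor \<open>s\<close>; as \<open>m\<close> is at
      most \<open>2 * t + 2\<close>, that factor absorbs the logarithm.\<close>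
    have "t + 1 \<le> s" unfolding s_def by (induction t) auto
    moreover have "k \<le> 3 * t + 2" unfolding t_def by linarith
    ultimately have "6 * m + 10 \<le> 30 * s" using tm by linarith
    then have "s * r\<^sup>2 * (c * (6 * m + 10) + 28) \<le> s * r\<^sup>2 * (c * (30 * s) + 28 * s)"
      using s by (intro mult_le_mono2 add_mono) auto
    also have "\<dots> = (30 * c + 28) * (s * r)\<^sup>2"
      by (simp add: power2_eq_square algebra_simps)
    finally have 2: "s * r\<^sup>2 * (c * (6 * m + 10) + 28) \<le> (30 * c + 28) * (2 ^ k)\<^sup>2" by (simp only: n)
    have "split_cost c h k = s * (3 * h m + 4 * h (Suc m)) + ((30 * c + 28) * (2 ^ k)\<^sup>2 + 18 * (2 ^ k)\<^sup>2)"
      by (simp add: split_cost_def s_def m_def t_def algebra_simps)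
    then show "c * p * 2 ^ k * (5 * m + 9) + s * (3 * h m + 4 * h (Suc m))
      + (s * r\<^sup>2 * (c * (6 * m + 10) + 28) + 18 * (2 ^ k)\<^sup>2) \<le> 14 * c * p * (k + 1) * 2 ^ k + split_cost c h k"
      using 1 2 by (simp add: algebra_simps)
  qed
qed

text \<open>\<open>2 ^ (k div 3)\<close> groups of logarithmic size about \<open>2 * k / 3\<close>
  give the exponent \<open>(2 * e + 1) / 3\<close>; the factor \<open>2 powr (2 * e)\<close> pays
  for rounding \<open>k div 3\<close> and for the routers of doubled size.\<close>

lemma split_cost_bound:
  assumes h: "\<And>k. real (h k) \<le> C * 2 powr (e * real k)" and e: "1 \<le> e"
    and e': "2 \<le> e'" "(2 * e + 1) / 3 \<le> e'"
  shows "real (split_cost c h k) \<le> (7 * C * 2 powr (2 * e) + 30 * real c + 46) * 2 powr (e' * real k)"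
proof -
  let ?t = "k div 3" and ?m = "k - k div 3"
  have C: "0 \<le> C" using h[of 0] by simp
  have t: "real k - 2 \<le> 3 * real ?t" "real ?t \<le> real k" by linarith+
  have m: "real ?m = real k - real ?t" by (simp add: of_nat_diff)
  have "h ?m \<le> C * 2 powr (e * (real ?m + 1))"
    by (rule order_trans[OF h mult_left_mono]) (use C e in auto)
  moreover have "h (Suc ?m) \<le> C * 2 powr (e * (real ?m + 1))"
    using h[of "Suc ?m"] by (simp add: add.commute)
  ultimately have "3 * real (h ?m) + 4 * real (h (Suc ?m)) \<le> 7 * (C * 2 powr (e * (real ?m + 1)))" by linarith
  then have "2 ^ ?t * (3 * real (h ?m) + 4 * real (h (Suc ?m)))
      \<le> 2 powr real ?t * (7 * (C * 2 powr (e * (real ?m + 1))))"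
    by (simp add: powr_realpow)
  also have "\<dots> = 7 * C * 2 powr (real ?t + e * (real ?m + 1))"
    by (simp add: powr_add)
  also have "\<dots> \<le> 7 * C * 2 powr (2 * e + e' * real k)"
  proof -
    \<comment> \<open>As \<open>e\<close> is at least 1, rounding \<open>k div 3\<close> down makes
      groups larger and costs more; the bound \<open>k - 2 \<le> 3 * (k div 3)\<close> limits the
      loss.\<close>
    have "0 \<le> (e - 1) * (3 * real ?t - (real k - 2))" using t e by (intro mult_nonneg_nonneg) auto
    then have "real ?t + e * (real ?m + 1) \<le> 2 * e + (2 * e + 1) / 3 * real k"
      using e by (simp add: m field_simps)
    also have "\<dots> \<le> 2 * e + e' * real k" using e' by (intro add_left_mono mult_right_mono) auto
    finally show ?thesis using C by (intro mult_left_mono) auto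
  qed
  also have "\<dots> = 7 * C * 2 powr (2 * e) * 2 powr (e' * real k)"
    by (simp add: powr_add)
  finally have 1: "2 ^ ?t * (3 * real (h ?m) + 4 * real (h (Suc ?m))) \<le> 7 * C * 2 powr (2 * e) * 2 powr (e' * real k)" .
  have "((2::real) ^ k)\<^sup>2 = 2 powr (2 * real k)"
    by (simp add: powr_realpow[symmetric] powr_powr mult.commute flip: powr_numeral)
  also have "\<dots> \<le> 2 powr (e' * real k)" using e' by (intro powr_mono mult_right_mono) auto
  finally have "(30 * real c + 46) * ((2::real) ^ k)\<^sup>2 \<le> (30 * real c + 46) * 2 powr (e' * real k)"
    by (intro mult_left_mono) auto
  with 1 show ?thesis
    unfolding split_cost_def by (simp add: algebra_simps)
qed

text \<open>\<open>c\<close>, \<open>h\<close> and \<open>C\<close> are chosen before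
  \<open>D\<close>, which depends on \<open>n\<close>; this keeps the constants absolute.\<close>

lemma router_exponent_step:
  assumes "\<exists>c h C. (\<forall>D :: 'a set. router D c h) \<and> (\<forall>k. real (h k) \<le> C * 2 powr (e * real k))"
    and "1 \<le> e" "2 \<le> e'" "(2 * e + 1) / 3 \<le> e'"
  shows "\<exists>c h C. (\<forall>D :: 'a set. router D c h) \<and> (\<forall>k. real (h k) \<le> C * 2 powr (e' * real k))"
proof -
  obtain c h C where R: "\<And>D :: 'a set. router D c h" and h: "\<And>k. real (h k) \<le> C * 2 powr (e * real k)"
    using assms(1) by blast
  have "\<forall>D :: 'a set. router D (14 * c) (split_cost c h)" using router_split[OF R] by blast
  moreover have "\<forall>k. real (split_cost c h k) \<le> (7 * C * 2 powr (2 * e) + 30 * real c + 46) * 2 powr (e' * real k)"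
    using split_cost_bound[OF h assms(2-4)] by blast
  ultimately show ?thesis by blast
qed

text \<open>The map from \<open>e\<close> to \<open>(2 * e + 1) / 3\<close> contracts
  \<open>e - 1\<close> by the factor 2/3: from 5 it leads to 11/3, 25/9, 59/27 and then 145/81,
  which is below 2.\<close>

lemma router_quadratic:
  "\<exists>c h C. (\<forall>D :: 'a set. router D c h) \<and> (\<forall>k. real (h k) \<le> C * (2 ^ k)\<^sup>2)"
proof -
  have "real (644 * (2 ^ k) ^ 5) \<le> 644 * 2 powr (5 * real k)" for k
    by (simp add: powr_realpow[symmetric] powr_powr mult.commute flip: powr_numeral)
  then have "\<exists>c h C. (\<forall>D :: 'a set. router D c h) \<and> (\<forall>k. real (h k) \<le> C * 2 powr (5 * real k))"
    using router_benes by blast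
  from router_exponent_step[OF this, of "11/3"]
  have "\<exists>c h C. (\<forall>D :: 'a set. router D c h) \<and> (\<forall>k. real (h k) \<le> C * 2 powr (11/3 * real k))" by simp
  from router_exponent_step[OF this, of "25/9"]
  have "\<exists>c h C. (\<forall>D :: 'a set. router D c h) \<and> (\<forall>k. real (h k) \<le> C * 2 powr (25/9 * real k))" by simp
  from router_exponent_step[OF this, of "59/27"]
  have "\<exists>c h C. (\<forall>D :: 'a set. router D c h) \<and> (\<forall>k. real (h k) \<le> C * 2 powr (59/27 * real k))" by simp
  from router_exponent_step[OF this, of 2]
  have "\<exists>c h C. (\<forall>D :: 'a set. router D c h) \<and> (\<forall>k. real (h k) \<le> C * 2 powr (2 * real k))" by simp
  moreover have "((2::real) ^ k)\<^sup>2 = 2 powr (2 * real k)" for k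
    by (simp add: powr_realpow[symmetric] powr_powr mult.commute flip: powr_numeral)
  ultimately show ?thesis by simp
qed

lemma power_of_two_above:
  assumes "2 \<le> (n::nat)"
  obtains k where "n \<le> 2 ^ k" "2 ^ k \<le> 2 * n" "real k \<le> 2 * log 2 (real n)" "1 \<le> log 2 (real n)"
proof -
  obtain j where j: "2 ^ j < n" "n \<le> 2 ^ (j + 1)"
    using ex_power_ivl2[of 2 n] assms by auto
  have "log 2 2 \<le> log 2 (real n)" using assms by (subst log_le_cancel_iff) auto
  then have one: "1 \<le> log 2 (real n)" by simp
  have "real j = log 2 (2 ^ j)" by simp
  also have "\<dots> \<le> log 2 (real n)"
  proof (subst log_le_cancel_iff)
    show "2 ^ j \<le> real n" using j(1) by (metis less_imp_le of_nat_le_iff of_nat_numeral of_nat_power)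
  qed (use assms in auto)
  finally show thesis using that[of "j + 1"] j one by simp
qed

section \<open>The first bound: switch states as a code\<close>

text \<open>Feed the network with constant data, the \<open>u\<close>-th unit vector on line
  \<open>u\<close>. The outputs then spell out the permutation, and as circuit outputs they depend
  on the switch states alone.\<close>

lemma controls_determine:
  assumes "\<pi> permutes {..<2 ^ k}" "\<rho> permutes {..<2 ^ k}" "\<And>\<kappa>. \<kappa> \<in> controls k \<Longrightarrow> \<kappa> \<pi> = \<kappa> \<rho>"
  shows "\<pi> = \<rho>"
proof
  fix j
  let ?D = "{\<pi>. \<pi> permutes {..<2 ^ k :: nat}}"
  let ?x = "\<lambda>u b (_ :: nat \<Rightarrow> nat). u = b"
  have benes: "derives ?D (array (2 ^ k) (2 ^ k) ?x \<union> control_wires k (\<lambda>\<pi>. \<pi>)) (6 * 2 ^ k * k * 2 ^ k)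
      (array (2 ^ k) (2 ^ k) (\<lambda>j b \<pi>. ?x (\<pi> j) b \<pi>))"
    by (rule derives_benes) simp
  have wires: "f \<pi> = f \<rho>" if "f \<in> array (2 ^ k) (2 ^ k) ?x \<union> control_wires k (\<lambda>\<pi>. \<pi>)" for f
    using that assms(3) by (auto simp: array_def control_wires_def dual_def)
  show "\<pi> j = \<rho> j"
  proof (cases "j < 2 ^ k")
    case True
    then have "\<pi> j < 2 ^ k" using permutes_in_image[OF assms(1), of j] by simp
    with True have mem: "(\<lambda>\<pi>'. \<pi>' j = \<pi> j) \<in> array (2 ^ k) (2 ^ k) (\<lambda>j b \<pi>. ?x (\<pi> j) b \<pi>)"
      using array_memI[of j "2 ^ k" "\<pi> j" "2 ^ k" "\<lambda>j b \<pi>. ?x (\<pi> j) b \<pi>"] by simp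
    have "(\<pi> j = \<pi> j) = (\<rho> j = \<pi> j)"
      by (rule derives_determines[where f = "\<lambda>\<pi>'. \<pi>' j = \<pi> j" and a = \<pi> and b = \<rho>,
            OF benes _ _ wires mem]) (use assms(1,2) in simp_all)
    then show ?thesis by simp
  next
    case False
    then show ?thesis using permutes_not_in[OF assms(1)] permutes_not_in[OF assms(2)] by simp
  qed
qed

lemma permutation_operator_upper:
  assumes n: "2 \<le> n" "n \<le> 2 ^ k"
  shows "\<exists>m S \<sigma>. cube_antichain {..<m} S \<and> card S = fact n \<and>
    bij_betw \<sigma> S {\<pi>. \<pi> permutes {..<n}} \<and>
    complexity (perm_operator q n {..<m::nat} S \<sigma>) \<le> enat (6 * q * k * 2 ^ k)"
proof -
  define L where "L = card (controls k)"
  obtain \<kappa> where \<kappa>: "bij_betw \<kappa> {0..<L} (controls k)"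
    using ex_bij_betw_nat_finite[OF finite_controls] unfolding L_def by blast
  define m where "m = 2 * L"
  \<comment> \<open>Coordinates \<open>2 * i\<close> and \<open>Suc (2 * i)\<close> hold a switch
    state and its complement, so both polarities required by the multiplexers are variables.\<close>
  define code where "code \<pi> = (\<lambda>j \<in> {..<m}. if even j then \<kappa> (j div 2) \<pi> else \<not> \<kappa> (j div 2) \<pi>)" for \<pi>
  let ?P = "{\<pi>. \<pi> permutes {..<n}}"
  define S where "S = code ` ?P"
  define \<sigma> where "\<sigma> = inv_into ?P code"
  have code: "code \<pi> (2 * i) = \<kappa> i \<pi>" "code \<pi> (Suc (2 * i)) = (\<not> \<kappa> i \<pi>)" if "i < L" for i \<pi>
    using that by (auto simp: code_def m_def)
  have big: "\<pi> permutes {..<2 ^ k}" if "\<pi> \<in> ?P" for \<pi>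
    using that n(2) by (auto intro: permutes_subset)
  have \<kappa>_cases: "\<exists>i<L. \<kappa>' = \<kappa> i" if "\<kappa>' \<in> controls k" for \<kappa>'
  proof -
    have "\<kappa>' \<in> \<kappa> ` {0..<L}" using \<kappa> that by (simp add: bij_betw_def)
    then show ?thesis by (elim imageE) auto
  qed
  have inj: "inj_on code ?P"
  proof (rule inj_onI)
    fix \<pi> \<rho> assume *: "\<pi> \<in> ?P" "\<rho> \<in> ?P" "code \<pi> = code \<rho>"
    show "\<pi> = \<rho>"
    proof (rule controls_determine[OF big[OF *(1)] big[OF *(2)]])
      fix \<kappa>' assume "\<kappa>' \<in> controls k"
      then obtain i where "i < L" "\<kappa>' = \<kappa> i" using \<kappa>_cases by metis
      then show "\<kappa>' \<pi> = \<kappa>' \<rho>" using code(1)[of i] *(3) by metis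
    qed
  qed
  have bij: "bij_betw \<sigma> S ?P"
    unfolding \<sigma>_def S_def by (rule bij_betw_inv_into) (simp add: inj bij_betw_def)
  have "card S = fact n"
    unfolding S_def using card_image[OF inj] card_permutations[of "{..<n}" n] by simp
  moreover have "cube_antichain {..<m} S"
  proof -
    have "code \<pi> = code \<rho>" if le: "\<forall>j\<in>{..<m}. code \<pi> j \<le> code \<rho> j" for \<pi> \<rho>
    proof
      fix j
      show "code \<pi> j = code \<rho> j"
      proof (cases "j < m")
        case True
        then have i: "j div 2 < L" by (simp add: m_def less_mult_imp_div_less mult.commute)
        then have "code \<pi> (2 * (j div 2)) \<le> code \<rho> (2 * (j div 2))"
          "code \<pi> (Suc (2 * (j div 2))) \<le> code \<rho> (Suc (2 * (j div 2)))"
          using le by (auto simp: m_def)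
        then have "\<kappa> (j div 2) \<pi> = \<kappa> (j div 2) \<rho>" using code[OF i] by auto
        then show ?thesis by (simp add: code_def)
      qed (simp add: code_def)
    qed
    moreover have "code \<pi> \<in> {..<m} \<rightarrow>\<^sub>E UNIV" for \<pi> by (simp add: code_def)
    ultimately show ?thesis unfolding cube_antichain_def S_def by blast
  qed
  moreover have "complexity (perm_operator q n {..<m} S \<sigma>) \<le> enat (6 * q * k * 2 ^ k)"
  proof -
    let ?F = "perm_operator q n {..<m} S \<sigma>"
    define Y where "Y a = (\<lambda>j \<in> {..<m}. a (YVar j))" for a :: "nat pvar \<Rightarrow> bool"
    define D where "D = {a. Y a \<in> S}"
    define P where "P a = \<sigma> (Y a)" for a
    define x where "x u b a = a (XVar b (if u < n then u else 0))" for u b and a :: "nat pvar \<Rightarrow> bool"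
    define out where "out = (\<lambda>(i, j). \<lambda>a. x (P a j) i a)"
    let ?I = "(\<lambda>v a. a v) ` in_vars ?F"
    have P: "P a \<in> ?P" "code (P a) = Y a" if "a \<in> D" for a
      using that bij_betwE[OF bij] f_inv_into_f[of "Y a" code ?P]
      by (auto simp: P_def D_def \<sigma>_def S_def)
    have X: "(\<lambda>a. a (XVar i j)) \<in> ?I" if "i < q" "j < n" for i j
      by (rule image_eqI[of _ _ "XVar i j"]) (use that in \<open>auto simp: perm_operator_def\<close>)
    have YI: "(\<lambda>a. a (YVar j)) \<in> ?I" if "j < m" for j
      by (rule image_eqI[of _ _ "YVar j"]) (use that in \<open>auto simp: perm_operator_def\<close>)
    have benes: "derives D (array (2 ^ k) q x \<union> control_wires k P) (6 * q * k * 2 ^ k)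
        (array (2 ^ k) q (\<lambda>j b a. x (P a j) b a))"
      by (rule derives_benes) (use P big in blast)
    have "derives D ?I (6 * q * k * 2 ^ k) (array (2 ^ k) q (\<lambda>j b a. x (P a j) b a))"
    proof (rule derives_cong_source[OF benes])
      fix f assume "f \<in> array (2 ^ k) q x \<union> control_wires k P"
      then consider u b where "u < 2 ^ k" "b < q" "f = x u b"
        | \<kappa>' where "\<kappa>' \<in> controls k" "f = (\<lambda>a. \<kappa>' (P a)) \<or> f = (\<lambda>a. \<not> \<kappa>' (P a))"
        by (auto simp: array_def control_wires_def dual_def)
      then show "\<exists>g\<in>?I. \<forall>a\<in>D. f a = g a"
      proof cases
        case 1
        have "f \<in> ?I" unfolding 1(3) x_def[abs_def] using n 1 by (intro X) auto
        then show ?thesis by (rule bexI[of "\<lambda>g. \<forall>a\<in>D. f a = g a", rotated]) simp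
      next
        case 2
        then obtain i where i: "i < L" "\<kappa>' = \<kappa> i" using \<kappa>_cases by metis
        have Yi: "\<kappa> i (P a) = a (YVar (2 * i))" "(\<not> \<kappa> i (P a)) = a (YVar (Suc (2 * i)))" if "a \<in> D" for a
          using code[OF i(1), of "P a"] P(2)[OF that] i(1) by (auto simp: Y_def m_def)
        have "2 * i < m" "Suc (2 * i) < m" using i(1) by (auto simp: m_def)
        note mem = YI[OF this(1)] YI[OF this(2)]
        from 2(2) show ?thesis
        proof
          assume "f = (\<lambda>a. \<kappa>' (P a))"
          then show ?thesis using mem(1) Yi(1) i(2)
            by (intro bexI[of _ "\<lambda>a. a (YVar (2 * i))"]) simp_all
        next
          assume "f = (\<lambda>a. \<not> \<kappa>' (P a))"
          then show ?thesis using mem(2) Yi(2) i(2)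
            by (intro bexI[of _ "\<lambda>a. a (YVar (Suc (2 * i)))"]) simp_all
        qed
      qed
    qed
    then have "derives D ?I (6 * q * k * 2 ^ k) (out ` out_pos ?F)"
    proof (rule derives_mono)
      show "out ` out_pos ?F \<subseteq> array (2 ^ k) q (\<lambda>j b a. x (P a j) b a)"
      proof (rule image_subsetI)
        fix w assume "w \<in> out_pos ?F"
        then obtain i j where "w = (i, j)" "i < q" "j < 2 ^ k" using n(2) by (auto simp: perm_operator_def)
        then show "out w \<in> array (2 ^ k) q (\<lambda>j b a. x (P a j) b a)"
          using array_memI[of j "2 ^ k" i q "\<lambda>j b a. x (P a j) b a"] by (simp add: out_def)
      qed
    qed simp_all
    then show ?thesis
    proof (rule complexity_le_derives)
      fix a z w assume z: "op_map ?F a = Some z" and w: "w \<in> out_pos ?F"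
      obtain i j where ij: "w = (i, j)" "i < q" "j < n" using w by (auto simp: perm_operator_def)
      have "Y a \<in> S" and z: "z = (\<lambda>(i, k). a (XVar i (\<sigma> (Y a) k)))"
        using z by (auto simp: perm_operator_def Let_def Y_def split: if_splits)
      then have a: "a \<in> D" by (simp add: D_def)
      have "P a j < n" using P(1)[OF a] ij(3) permutes_in_image[of "P a" "{..<n}" j] by simp
      then show "a \<in> D \<and> out w a = z w"
        using a by (simp add: out_def ij z x_def P_def)
    qed
  qed
  ultimately show ?thesis using bij by blast
qed

section \<open>The second bound: complements and constants from a permutation matrix\<close>

text \<open>Every prefix extends the previous one by a single gate, so all \<open>L\<close>
  disjunctions together cost \<open>L\<close>.\<close>

lemma derives_prefix_disj:
  assumes "\<And>i. i < L \<Longrightarrow> f i \<in> A"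
  shows "derives D A L ((\<lambda>i a. \<exists>j\<le>i. f j a) ` {..<L})"
  using assms
proof (induction L)
  case 0
  then show ?case by (simp add: derives_subset)
next
  case (Suc L)
  let ?p = "\<lambda>i a. \<exists>j\<le>i. f j a"
  let ?R = "?p ` {..<L}"
  have IH: "derives D A L ?R" using Suc by simp
  have "derives D (A \<union> ?R) 1 {?p L}"
  proof (cases L)
    case 0
    have "?p L = f 0" using 0 by auto
    then show ?thesis using Suc.prems[of 0] by (simp add: derives_subset)
  next
    case (Suc l)
    have "derives D (A \<union> ?R) (0 + 0 + 1) {\<lambda>a. ?p l a \<or> f L a}"
    proof (intro derives_disj derives_wire)
      show "?p l \<in> A \<union> ?R" by (rule UnI2, rule image_eqI[of _ _ l]) (use Suc in simp_all)
      show "f L \<in> A \<union> ?R" using Suc.prems by simp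
    qed
    then show ?thesis
      by (rule derives_cong[OF derives_le]) (auto simp: Suc le_Suc_eq)
  qed
  from derives_trans[OF IH derives_keep[OF this]]
  show ?case
    by (rule derives_mono) (auto simp: lessThan_Suc)
qed

text \<open>With exactly one entry on per row, the complement of an entry is the disjunction of the
  entries before and after it. Prefixes, suffixes and their combination cost \<open>n\<close> gates
  each per row, hence \<open>3 * n\<close>; separate disjunctions would be cubic in all.\<close>

lemma derives_not_entries:
  assumes n: "2 \<le> n"
    and one: "\<And>a j. a \<in> D \<Longrightarrow> j < n \<Longrightarrow> \<exists>u<n. \<forall>v<n. y j v a \<longleftrightarrow> v = u"
    and A: "array n n y \<subseteq> A"
  shows "derives D A (n * (3 * n) + 1) (constants \<union> dual (array n n y))"
proof -
  have mem: "y j u \<in> A" if "j < n" "u < n" for j u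
    using array_memI[OF that, of y] A by blast
  let ?pre = "\<lambda>j i a. \<exists>u\<le>i. y j u a" and ?suf = "\<lambda>j i a. \<exists>u\<le>i. y j (n - 1 - u) a"
  have col: "derives D A (3 * n) ({?pre j (n - 1)} \<union> (\<lambda>u a. \<not> y j u a) ` {..<n})" if j: "j < n" for j
  proof -
    let ?R = "?pre j ` {..<n} \<union> ?suf j ` {..<n}"
    have 1: "derives D A (n + n) ?R"
      by (intro derives_Un derives_prefix_disj mem) (use j in auto)
    have pre: "?pre j i \<in> A \<union> ?R" if "i < n" for i
      by (rule UnI2, rule UnI1, rule image_eqI[of _ _ i]) (use that in simp_all)
    have suf: "?suf j i \<in> A \<union> ?R" if "i < n" for i
      by (rule UnI2, rule UnI2, rule image_eqI[of _ _ i]) (use that in simp_all)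
    have "derives D (A \<union> ?R) (card {..<n} * 1) ((\<lambda>u a. \<not> y j u a) ` {..<n})"
    proof (rule derives_image)
      fix u assume u: "u \<in> {..<n}"
      have sufiff: "?suf j i a \<longleftrightarrow> (\<exists>v. n - 1 - i \<le> v \<and> v < n \<and> y j v a)" if "i < n" for i a
      proof
        assume "?suf j i a"
        then obtain v where "v \<le> i" "y j (n - 1 - v) a" by blast
        then show "\<exists>v. n - 1 - i \<le> v \<and> v < n \<and> y j v a"
          using n by (intro exI[of _ "n - 1 - v"]) auto
      next
        assume "\<exists>v. n - 1 - i \<le> v \<and> v < n \<and> y j v a"
        then obtain v where "n - 1 - i \<le> v" "v < n" "y j v a" by blast
        then show "?suf j i a" by (intro exI[of _ "n - 1 - v"]) (use that in auto)
      qed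
      \<comment> \<open>\<open>n - 2 - u\<close> selects the suffix that starts at
        \<open>u + 1\<close>. For \<open>u = n - 1\<close> the truncated subtraction would give the
        last entry itself, hence the guard.\<close>
      have neg: "\<not> y j u a \<longleftrightarrow> (0 < u \<and> ?pre j (u - 1) a) \<or> (u < n - 1 \<and> ?suf j (n - 2 - u) a)"
        if a: "a \<in> D" for a
      proof -
        obtain w where w: "w < n" "\<And>v. v < n \<Longrightarrow> y j v a \<longleftrightarrow> v = w" using one[OF a j] by blast
        have "0 < u \<and> ?pre j (u - 1) a \<longleftrightarrow> w < u"
        proof
          assume "0 < u \<and> ?pre j (u - 1) a"
          then obtain v where "v \<le> u - 1" "y j v a" "0 < u" by blast
          then show "w < u" using w(2)[of v] u by auto
        next
          assume "w < u"
          then show "0 < u \<and> ?pre j (u - 1) a" using w by (auto intro!: exI[of _ w])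
        qed
        moreover have "u < n - 1 \<and> ?suf j (n - 2 - u) a \<longleftrightarrow> u < w"
        proof (cases "u < n - 1")
          case True
          have "?suf j (n - 2 - u) a \<longleftrightarrow> (\<exists>v. u < v \<and> v < n \<and> y j v a)"
            using True by (subst sufiff) (auto simp: Suc_le_eq[symmetric] Suc_diff_Suc numeral_2_eq_2)
          also have "\<dots> \<longleftrightarrow> u < w" using w by blast
          finally show ?thesis using True by blast
        next
          case False
          then show ?thesis using w(1) u by auto
        qed
        ultimately show ?thesis using w(2)[of u] u by auto
      qed
      show "derives D (A \<union> ?R) 1 {\<lambda>a. \<not> y j u a}"
      proof -
        consider "u = 0" | "u = n - 1" "0 < u" | "0 < u" "u < n - 1" using u by fastforce
        then show ?thesis
        proof cases
          case 1
          have "derives D (A \<union> ?R) 0 {?suf j (n - 2 - u)}" by (intro derives_wire suf) (use n in simp)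
          then show ?thesis by (rule derives_cong[OF derives_le]) (use neg 1 n in auto)
        next
          case 2
          have "derives D (A \<union> ?R) 0 {?pre j (u - 1)}" by (intro derives_wire pre) (use u in auto)
          then show ?thesis by (rule derives_cong[OF derives_le]) (use neg 2 n in auto)
        next
          case 3
          have "derives D (A \<union> ?R) (0 + 0 + 1) {\<lambda>a. ?pre j (u - 1) a \<or> ?suf j (n - 2 - u) a}"
            by (intro derives_disj derives_wire pre suf) (use u n in auto)
          then show ?thesis by (rule derives_cong[OF derives_le]) (use neg 3 in auto)
        qed
      qed
    qed simp
    from derives_trans[OF 1 derives_keep[OF this]]
    show ?thesis
      by (rule derives_mono) (use pre[of "n - 1"] n in auto)
  qed
  let ?B = "\<Union>j\<in>{..<n}. {?pre j (n - 1)} \<union> (\<lambda>u a. \<not> y j u a) ` {..<n}"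
  have 1: "derives D A (card {..<n} * (3 * n)) ?B"
    by (rule derives_UN) (use col in auto)
  \<comment> \<open>Two entries of one row are never on together, and some entry of a row is on:
    this gives the two constants.\<close>
  have "derives D (A \<union> ?B) (0 + 0 + 1) {\<lambda>a. y 0 0 a \<and> y 0 1 a}"
    by (intro derives_conj derives_wire UnI1 mem) (use n in auto)
  then have F: "derives D (A \<union> ?B) (0 + 0 + 1) {\<lambda>_. False}"
  proof (rule derives_cong)
    fix a assume "a \<in> D"
    then obtain w where "\<And>v. v < n \<Longrightarrow> y 0 v a \<longleftrightarrow> v = w" using one[of a 0] n by auto
    from this[of 0] this[of 1] show "(y 0 0 a \<and> y 0 1 a) = False" using n by auto
  qed
  have "derives D (A \<union> ?B) 0 {?pre 0 (n - 1)}" by (intro derives_wire) (use n in auto)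
  then have T: "derives D (A \<union> ?B) 0 {\<lambda>_. True}"
  proof (rule derives_cong)
    fix a assume "a \<in> D"
    then obtain w where "w < n" "y 0 w a" using one[of a 0] n by auto
    then show "?pre 0 (n - 1) a = True" by (auto intro!: exI[of _ w])
  qed
  have N: "derives D (A \<union> ?B) 0 (dual (array n n y))"
  proof (rule derives_subset, rule dual_array_subset)
    fix j u assume ju: "j < n" "u < n"
    show "y j u \<in> A \<union> ?B" using mem[OF ju] by blast
    have "(\<lambda>a. \<not> y j u a) \<in> (\<lambda>u a. \<not> y j u a) ` {..<n}"
      by (rule image_eqI[of _ _ u]) (use ju in simp_all)
    then show "(\<lambda>a. \<not> y j u a) \<in> A \<union> ?B" using ju(1) by blast
  qed
  have "derives D A (card {..<n} * (3 * n) + ((0 + 0 + 1) + (0 + 0))) ({\<lambda>_. False} \<union> ({\<lambda>_. True} \<union> dual (array n n y)))"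
    by (rule derives_trans[OF 1 derives_Un[OF F derives_Un[OF T N]]])
  then show ?thesis by (rule derives_mono) (auto simp: constants_def)
qed

lemma matrix_operator_upper:
  assumes R: "\<And>D :: ((nat \<times> nat) pvar \<Rightarrow> bool) set. router D c h" and n: "2 \<le> n" "n \<le> 2 ^ k"
  shows "complexity (perm_operator q n ({..<n} \<times> {..<n}) (perm_matrices n) (perm_of_matrix n))
    \<le> enat (n * (3 * n) + 1 + (c * q * (k + 1) * 2 ^ k + h k))"
proof -
  let ?F = "perm_operator q n ({..<n} \<times> {..<n}) (perm_matrices n) (perm_of_matrix n)"
  let ?I = "(\<lambda>v a. a v) ` in_vars ?F"
  define N :: nat where "N = 2 ^ k"
  define Y where "Y a = (\<lambda>p \<in> {..<n} \<times> {..<n}. a (YVar p))" for a :: "(nat \<times> nat) pvar \<Rightarrow> bool"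
  define D where "D = {a. Y a \<in> perm_matrices n}"
  \<comment> \<open>\<open>y\<close> is the transpose of \<open>Y\<close>: row \<open>j\<close> of
    the routing matrix lists the possible sources of output column \<open>j\<close>.\<close>
  define y where "y j u a = a (YVar (u, j))" for j u and a :: "(nat \<times> nat) pvar \<Rightarrow> bool"
  define G where "G j u a \<longleftrightarrow> j < n \<and> u < n \<and> y j u a" for j u a
  define x where "x u b a \<longleftrightarrow> u < n \<and> a (XVar b u)" for u b and a :: "(nat \<times> nat) pvar \<Rightarrow> bool"
  define out where "out = (\<lambda>(i, j). mprod N G x j i)"
  have iff: "y j u a \<longleftrightarrow> u = perm_of_matrix n (Y a) j" "perm_of_matrix n (Y a) j < n"
    if "a \<in> D" "j < n" "u < n" for a j u
    using perm_of_matrix_iff[of "Y a" n j u] perm_of_matrix_iff[of "Y a" n j "perm_of_matrix n (Y a) j"] that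
    by (auto simp: D_def Y_def y_def)
  have X: "(\<lambda>a. a (XVar i j)) \<in> ?I" if "i < q" "j < n" for i j
    by (rule image_eqI[of _ _ "XVar i j"]) (use that in \<open>auto simp: perm_operator_def\<close>)
  have YI: "array n n y \<subseteq> ?I"
  proof (rule array_subset)
    fix j u assume "j < n" "u < n"
    then show "y j u \<in> ?I"
      by (intro image_eqI[of _ _ "YVar (u, j)"]) (auto simp: perm_operator_def y_def)
  qed
  let ?B = "constants \<union> dual (array n n y)"
  have 1: "derives D ?I (n * (3 * n) + 1) ?B"
  proof (rule derives_not_entries[OF n(1) _ YI])
    fix a j assume "a \<in> D" "j < n"
    then show "\<exists>u<n. \<forall>v<n. y j v a \<longleftrightarrow> v = u"
      using iff by (intro exI[of _ "perm_of_matrix n (Y a) j"]) auto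
  qed
  have mem: "y j u \<in> ?I \<union> ?B" "(\<lambda>a. \<not> y j u a) \<in> ?I \<union> ?B" if "j < n" "u < n" for j u
    using dual_array_memI[OF that, of y] by blast+
  have const: "constants \<subseteq> ?I \<union> ?B" by blast
  have G: "derives D (?I \<union> ?B) (N * N * (0 + 0)) (dual (array N N G))"
  proof (rule derives_dual_array)
    fix j u
    have "derives D (?I \<union> ?B) 0 {\<lambda>a. (j < n \<and> u < n) \<and> y j u a}"
      by (intro derives_guard_conj derives_wire const mem) simp_all
    then show "derives D (?I \<union> ?B) 0 {G j u}"
      by (rule derives_cong) (simp add: G_def)
    have "derives D (?I \<union> ?B) 0 {\<lambda>a. (j < n \<and> u < n) \<longrightarrow> \<not> y j u a}"
      by (intro derives_guard_imp derives_wire const mem) simp_all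
    then show "derives D (?I \<union> ?B) 0 {\<lambda>a. \<not> G j u a}"
      by (rule derives_cong) (auto simp: G_def)
  qed
  have x: "derives D (?I \<union> ?B) (N * q * 0) (array N q x)"
  proof (rule derives_array)
    fix u b assume "b < q"
    then show "derives D (?I \<union> ?B) 0 {x u b}"
      unfolding x_def[abs_def] by (intro derives_guard_conj derives_wire const UnI1 X)
  qed
  have "derives D (?I \<union> ?B) (0 + (N * N * (0 + 0) + N * q * 0)) (constants \<union> (dual (array N N G) \<union> array N q x))"
    by (intro derives_Un G x derives_subset const)
  then have 2: "derives D (?I \<union> ?B) 0 (constants \<union> dual (array N N G) \<union> array N q x)"
    by (simp add: Un_assoc)
  have "derives D (constants \<union> dual (array N N G) \<union> array N q x) (c * q * (k + 1) * N + h k)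
      (array N q (mprod N G x))"
    unfolding N_def
  proof (rule derives_router[OF R])
    fix a assume a: "a \<in> D"
    have inj: "perm_of_matrix n (Y a) i = perm_of_matrix n (Y a) j \<longleftrightarrow> i = j" for i j
    proof -
      have "perm_of_matrix n (Y a) permutes {..<n}"
        using bij_betwE[OF bij_betw_perm_of_matrix[of n]] a by (auto simp: D_def)
      then show ?thesis using permutes_inj by (metis injD)
    qed
    show "partial_perm (2 ^ k) G a"
      by (rule partial_permI) (use iff[OF a] inj in \<open>auto simp: G_def\<close>)
  qed auto
  from derives_trans[OF 1 derives_chain[OF 2 this]]
  have "derives D ?I (n * (3 * n) + 1 + (c * q * (k + 1) * 2 ^ k + h k)) (array N q (mprod N G x))"
    by (simp add: N_def)
  then have "derives D ?I (n * (3 * n) + 1 + (c * q * (k + 1) * 2 ^ k + h k)) (out ` out_pos ?F)"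
  proof (rule derives_mono)
    show "out ` out_pos ?F \<subseteq> array N q (mprod N G x)"
    proof (rule image_subsetI)
      fix w assume "w \<in> out_pos ?F"
      then obtain i j where "w = (i, j)" "i < q" "j < N" using n(2) by (auto simp: perm_operator_def N_def)
      then show "out w \<in> array N q (mprod N G x)"
        using array_memI[of j N i q "mprod N G x"] by (simp add: out_def)
    qed
  qed simp_all
  then show ?thesis
  proof (rule complexity_le_derives)
    fix a z w assume z: "op_map ?F a = Some z" and w: "w \<in> out_pos ?F"
    obtain i j where ij: "w = (i, j)" "i < q" "j < n" using w by (auto simp: perm_operator_def)
    have "Y a \<in> perm_matrices n" and z: "z = (\<lambda>(i, k). a (XVar i (perm_of_matrix n (Y a) k)))"
      using z by (auto simp: perm_operator_def Let_def Y_def split: if_splits)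
    then have a: "a \<in> D" by (simp add: D_def)
    have "u < n \<longleftrightarrow> u < N \<and> u < n" for u using n(2) by (auto simp: N_def)
    then have "mprod N G x j i a \<longleftrightarrow> (\<exists>u<n. y j u a \<and> a (XVar i u))"
      using ij(3) unfolding mprod_def G_def x_def by blast
    also have "\<dots> \<longleftrightarrow> a (XVar i (perm_of_matrix n (Y a) j))"
      using iff(1)[OF a ij(3)] iff(2)[OF a ij(3) ij(3)] by blast
    finally show "a \<in> D \<and> out w a = z w"
      using a by (simp add: out_def ij z)
  qed
qed

section \<open>Assembling the two bounds\<close>

lemma ereal_of_enat_le: "K \<le> enat m \<Longrightarrow> real m \<le> y \<Longrightarrow> ereal_of_enat K \<le> ereal y"
  by (cases K) auto

theorem theorem2:
  "(\<exists>c::real. c > 0 \<and>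
     (\<forall>(n::nat) (q::nat). n \<ge> 2 \<longrightarrow> q \<ge> 1 \<longrightarrow>
        (\<exists>(m::nat) (S::(nat \<Rightarrow> bool) set) (\<sigma>::(nat \<Rightarrow> bool) \<Rightarrow> nat \<Rightarrow> nat).
           cube_antichain {..<m} S \<and> card S = fact n \<and>
           bij_betw \<sigma> S {\<pi>. \<pi> permutes {..<n}} \<and>
           ereal_of_enat (complexity (perm_operator q n {..<m} S \<sigma>))
             \<le> ereal (c * (real q * real n * log 2 (real n)))))) \<and>
   (\<exists>c::real. c > 0 \<and>
     (\<forall>(n::nat) (q::nat). n \<ge> 2 \<longrightarrow> q \<ge> 1 \<longrightarrow>
        ereal_of_enat (complexity
            (perm_operator q n ({..<n} \<times> {..<n}) (perm_matrices n) (perm_of_matrix n)))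
          \<le> ereal (c * (real q * real n * log 2 (real n) + (real n)\<^sup>2))))"
proof (intro conjI)
  show "\<exists>c::real. c > 0 \<and>
     (\<forall>(n::nat) (q::nat). n \<ge> 2 \<longrightarrow> q \<ge> 1 \<longrightarrow>
        (\<exists>(m::nat) (S::(nat \<Rightarrow> bool) set) (\<sigma>::(nat \<Rightarrow> bool) \<Rightarrow> nat \<Rightarrow> nat).
           cube_antichain {..<m} S \<and> card S = fact n \<and>
           bij_betw \<sigma> S {\<pi>. \<pi> permutes {..<n}} \<and>
           ereal_of_enat (complexity (perm_operator q n {..<m} S \<sigma>))
             \<le> ereal (c * (real q * real n * log 2 (real n)))))"
  \<comment> \<open>\<open>6 * k * 2 ^ k\<close> is at most
    \<open>6 * (2 * log 2 n) * (2 * n)\<close>, hence 24.\<close>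
  proof (intro exI[of _ "24::real"] conjI allI impI)
    fix n q :: nat assume n: "2 \<le> n"
    obtain k where k: "n \<le> 2 ^ k" "2 ^ k \<le> 2 * n" "real k \<le> 2 * log 2 (real n)" "1 \<le> log 2 (real n)"
      using power_of_two_above[OF n] .
    obtain m S \<sigma> where *: "cube_antichain {..<m} S" "card S = fact n"
      "bij_betw \<sigma> S {\<pi>. \<pi> permutes {..<n}}"
      "complexity (perm_operator q n {..<m::nat} S \<sigma>) \<le> enat (6 * q * k * 2 ^ k)"
      using permutation_operator_upper[OF n k(1), of q] by blast
    have "real (2 ^ k) \<le> 2 * real n" using k(2) by (metis of_nat_le_iff of_nat_mult of_nat_numeral)
    then have "real k * 2 ^ k \<le> (2 * log 2 (real n)) * (2 * real n)"
      using k(3,4) by (intro mult_mono) auto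
    then have "6 * real q * (real k * 2 ^ k) \<le> 6 * real q * ((2 * log 2 (real n)) * (2 * real n))"
      by (intro mult_left_mono) auto
    then have "real (6 * q * k * 2 ^ k) \<le> 24 * (real q * real n * log 2 (real n))"
      by (simp add: algebra_simps)
    with * show "\<exists>(m::nat) (S::(nat \<Rightarrow> bool) set) (\<sigma>::(nat \<Rightarrow> bool) \<Rightarrow> nat \<Rightarrow> nat).
           cube_antichain {..<m} S \<and> card S = fact n \<and>
           bij_betw \<sigma> S {\<pi>. \<pi> permutes {..<n}} \<and>
           ereal_of_enat (complexity (perm_operator q n {..<m} S \<sigma>))
             \<le> ereal (24 * (real q * real n * log 2 (real n)))"
      using ereal_of_enat_le by blast
  qed simp
  show "\<exists>c::real. c > 0 \<and>
     (\<forall>(n::nat) (q::nat). n \<ge> 2 \<longrightarrow> q \<ge> 1 \<longrightarrow>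
        ereal_of_enat (complexity
            (perm_operator q n ({..<n} \<times> {..<n}) (perm_matrices n) (perm_of_matrix n)))
          \<le> ereal (c * (real q * real n * log 2 (real n) + (real n)\<^sup>2)))"
  proof -
    obtain c h C where R: "\<And>D :: ((nat \<times> nat) pvar \<Rightarrow> bool) set. router D c h"
      and h: "\<And>k. real (h k) \<le> C * (2 ^ k)\<^sup>2"
      using router_quadratic by blast
    have C: "0 \<le> C" using h[of 0] by simp
    show ?thesis
    \<comment> \<open>The \<open>6 * real c\<close> comes from
      \<open>(k + 1) * 2 ^ k \<le> (3 * log 2 n) * (2 * n)\<close>, the \<open>4 * C\<close> from
      \<open>2 ^ k \<le> 2 * n\<close>, and the last 4 from \<open>3 * n^2 + 1\<close>.\<close>
    proof (intro exI[of _ "6 * real c + 4 * C + 4"] conjI allI impI)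
      show "0 < 6 * real c + 4 * C + 4" using C by linarith
      fix n q :: nat assume n: "2 \<le> n"
      obtain k where k: "n \<le> 2 ^ k" "2 ^ k \<le> 2 * n" "real k \<le> 2 * log 2 (real n)" "1 \<le> log 2 (real n)"
        using power_of_two_above[OF n] .
      let ?l = "real q * real n * log 2 (real n)"
      have le: "(2::real) ^ k \<le> 2 * real n"
        using k(2) by (metis of_nat_le_iff of_nat_mult of_nat_numeral of_nat_power)
      have "(real k + 1) * 2 ^ k \<le> (3 * log 2 (real n)) * (2 * real n)"
        using k(3,4) le by (intro mult_mono) auto
      then have "real c * real q * ((real k + 1) * 2 ^ k) \<le> real c * real q * ((3 * log 2 (real n)) * (2 * real n))"
        by (intro mult_left_mono) auto
      then have 1: "real c * real q * ((real k + 1) * 2 ^ k) \<le> 6 * real c * ?l" by (simp add: algebra_simps)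
      have "C * ((2::real) ^ k)\<^sup>2 \<le> C * (2 * real n)\<^sup>2"
        using le C by (intro mult_left_mono power_mono) auto
      then have 2: "real (h k) \<le> 4 * C * (real n)\<^sup>2"
        using h[of k] by (simp add: power2_eq_square algebra_simps)
      have 3: "1 \<le> (real n)\<^sup>2" using n by simp
      have l: "0 \<le> ?l" using k(4) by simp
      have "real (n * (3 * n) + 1 + (c * q * (k + 1) * 2 ^ k + h k))
          = 3 * (real n)\<^sup>2 + 1 + (real c * real q * ((real k + 1) * 2 ^ k) + real (h k))"
        by (simp add: power2_eq_square algebra_simps)
      also have "\<dots> \<le> 6 * real c * ?l + (4 * C + 4) * (real n)\<^sup>2"
        using 1 2 3 by (simp add: algebra_simps)
      also have "\<dots> \<le> (6 * real c + 4 * C + 4) * (?l + (real n)\<^sup>2)"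
        using l C by (simp add: algebra_simps)
      finally show "ereal_of_enat (complexity
            (perm_operator q n ({..<n} \<times> {..<n}) (perm_matrices n) (perm_of_matrix n)))
          \<le> ereal ((6 * real c + 4 * C + 4) * (?l + (real n)\<^sup>2))"
        by (rule ereal_of_enat_le[OF matrix_operator_upper[OF R n k(1)]])
    qed
  qed
qed

end
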